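(* Let $M$ be a smooth manifold of dimension $m>1$, let $\mathcal{X}$ be a centered Gaussian random field which is a non-degenerate Gaussian vector in a finite dimensional subspace $\mathscr{F}\subset C^\infty(M)$ such that for all $x\in M$ there is $f\in\mathscr{F}$ with $f(x)\ne0$. Let $f_0\in C^\infty(M)\setminus\mathscr{F}$ with $f_0(x)\ne0$ for all $x\in M$, and let $\mathcal{X}_0=\mathcal{X}+\xi_0f_0$ with $\xi_0$ a standard Gaussian variable independent of $\mathcal{X}$. Let $t\in\mathbb{R}$ be a regular value of $\Phi_0(x)=\frac12\log\big(\mathbb{E}[\mathcal{X}(x)^2]/f_0(x)^2\big)$ and let $S_t:=\Phi_0^{-1}(t)$, a smooth hypersurface of $M$. For any admissible random field $W\in C^\infty(S_t,\mathbb{R}^{m-2})$ on $S_t$, independent of $\mathcal{X}$ and $\mathcal{X}_0$, and every open set $U\subset S_t$, $$\mathbb{E}\#\mathcal{S}\{\mathcal{X}_0|_{S_t},W;U\}\le\mathbb{E}\#\mathcal{S}\{\mathcal{X}|_{S_t},W;U\}.$$ In particular $$\mathbb{E}\mathbb{S}\{\mathcal{X}_0|_{S_t};U\}\le\mathbb{E}\mathbb{S}\{\mathcal{X}|_{S_t};U\}.$$ In both cases, the inequality is an equality if and only if the right-hand side is zero, in which case every term is equal to zero.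
   Context: $\mathcal{S}\{f_1,\dots,f_k;U\}$ is the set of common zeros in $U$ of the (scalar or vector valued) functions $f_1,\dots,f_k$. For a scalar random field $\mathcal{Y}$ on a manifold $S$ of dimension $n$, $\mathbb{E}\mathbb{S}\{\mathcal{Y};U\}$ is the (possibly infinite) expected number of common zeros in $U$ of $n$ i.i.d. copies of $\mathcal{Y}$ (here $n=m-1$ for $S=S_t$). A random field $W\in C^\infty(S,\mathbb{R}^k)$ is admissible if there is a finite dimensional subspace $\mathscr{G}\subset C^\infty(S,\mathbb{R}^k)$ with a scalar product such that $W\in\mathscr{G}$ almost surely, (i) for all $x\in S$ the evaluation map $\mathscr{G}\to\mathbb{R}^k$, $f\mapsto f(x)$, is surjective, and (ii) $W$ has a continuous density $\rho:\mathscr{G}\to[0,\infty)$ with $\rho(0)>0$ and $\rho(f)=O(\|f\|^{-\beta})$ as $\|f\|\to\infty$ for some $\beta>\dim\mathscr{G}$. If $m=2$, $W$ is absent.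
   Formalization: The claim that equality holds if and only if the right-hand side is zero is proved only when the right-hand side is finite; when it is infinite both sides are infinite, so the equivalence as worded fails. *)

theory Defs
  imports "HOL-Probability.Probability" "HOL-Library.Function_Algebras"
begin

subsection \<open>Function spaces as real vector spaces\<close>

instantiation "fun" :: (type, real_vector) real_vector
begin

definition scaleR_fun :: "real \<Rightarrow> ('a \<Rightarrow> 'b) \<Rightarrow> 'a \<Rightarrow> 'b" where
  "scaleR_fun c f = (\<lambda>x. c *\<^sub>R f x)"

instance
  by standard (auto simp: scaleR_fun_def fun_eq_iff algebra_simps)

end

definition finite_dim_subspace :: "'v::real_vector set \<Rightarrow> bool" where
  "finite_dim_subspace V \<longleftrightarrow> subspace V \<and> (\<exists>B. finite B \<and> V \<subseteq> span B)"

definition scalar_product_on :: "'v::real_vector set \<Rightarrow> ('v \<Rightarrow> 'v \<Rightarrow> real) \<Rightarrow> bool" where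
  "scalar_product_on V ip \<longleftrightarrow>
     (\<forall>f\<in>V. \<forall>g\<in>V. ip f g = ip g f) \<and>
     (\<forall>f\<in>V. \<forall>g\<in>V. \<forall>h\<in>V. ip (f + g) h = ip f h + ip g h) \<and>
     (\<forall>c. \<forall>f\<in>V. \<forall>g\<in>V. ip (c *\<^sub>R f) g = c * ip f g) \<and>
     (\<forall>f\<in>V. f \<noteq> 0 \<longrightarrow> ip f f > 0)"

definition ip_norm :: "('v \<Rightarrow> 'v \<Rightarrow> real) \<Rightarrow> 'v \<Rightarrow> real" where
  "ip_norm ip f = sqrt (ip f f)"

definition orthonormal_basis :: "'v::real_vector set \<Rightarrow> ('v \<Rightarrow> 'v \<Rightarrow> real) \<Rightarrow> (nat \<Rightarrow> 'v) \<Rightarrow> bool" where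
  "orthonormal_basis V ip e \<longleftrightarrow>
     span (e ` {..<dim V}) = V \<and>
     (\<forall>i<dim V. \<forall>j<dim V. ip (e i) (e j) = (if i = j then 1 else 0))"


subsection \<open>Smooth manifolds and smooth functions\<close>

fun Ck_on :: "nat \<Rightarrow> ('e::real_normed_vector \<Rightarrow> 'b::real_normed_vector) \<Rightarrow> 'e set \<Rightarrow> bool" where
  "Ck_on 0 f S \<longleftrightarrow> continuous_on S f"
| "Ck_on (Suc k) f S \<longleftrightarrow>
     (\<forall>x\<in>S. f differentiable (at x)) \<and>
     (\<forall>v. Ck_on k (\<lambda>x. frechet_derivative f (at x) v) S)"

text \<open>Meaningful for open \<open>S\<close> in a finite-dimensional space only.\<close>

definition smooth_on :: "('e::euclidean_space \<Rightarrow> 'b::real_normed_vector) \<Rightarrow> 'e set \<Rightarrow> bool" where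
  "smooth_on f S \<longleftrightarrow> (\<forall>k. Ck_on k f S)"

text \<open>
  The manifold is the whole type \<open>'a\<close> (Hausdorff and second countable by its sort), with an
  atlas of pairs (domain, coordinate map) modelled on \<open>'e\<close>; its dimension is \<open>DIM('e)\<close>.
\<close>

definition smooth_atlas ::
    "('a::{t2_space,second_countable_topology} set \<times> ('a \<Rightarrow> 'e::euclidean_space)) set \<Rightarrow> bool" where
  "smooth_atlas A \<longleftrightarrow>
     (\<Union>(D, \<phi>)\<in>A. D) = UNIV \<and>
     (\<forall>(D, \<phi>)\<in>A. open D \<and> open (\<phi> ` D) \<and> homeomorphism D (\<phi> ` D) \<phi> (inv_into D \<phi>)) \<and>
     (\<forall>(D, \<phi>)\<in>A. \<forall>(E, \<psi>)\<in>A. smooth_on (\<psi> \<circ> inv_into D \<phi>) (\<phi> ` (D \<inter> E)))"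

definition smooth_on_open ::
    "('a::topological_space set \<times> ('a \<Rightarrow> 'e::euclidean_space)) set \<Rightarrow> ('a \<Rightarrow> real) \<Rightarrow> 'a set \<Rightarrow> bool" where
  "smooth_on_open A f V \<longleftrightarrow>
     (\<forall>(D, \<phi>)\<in>A. smooth_on (f \<circ> inv_into D \<phi>) (\<phi> ` (D \<inter> V)))"

text \<open>
  \<open>C\<^sup>\<infinity>(S)\<close> for \<open>S\<close> the whole manifold or an embedded submanifold: functions that extend
  smoothly to a neighbourhood of each point of \<open>S\<close>. A function on \<open>S\<close> is represented by its
  extension by \<open>0\<close>, so that \<open>smooth_funs A S\<close> is a linear space isomorphic to
  \<open>C\<^sup>\<infinity>(S)\<close>. The same convention applies to \<open>smooth_fields A S k\<close>, which is
  \<open>C\<^sup>\<infinity>(S, \<real>\<^sup>k)\<close>, with \<open>\<real>\<^sup>k\<close> the set of sequences vanishing from index \<open>k\<close> on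
  (\<open>k\<close> may be \<open>0\<close>).
\<close>

definition smooth_funs ::
    "('a::topological_space set \<times> ('a \<Rightarrow> 'e::euclidean_space)) set \<Rightarrow> 'a set \<Rightarrow> ('a \<Rightarrow> real) set" where
  "smooth_funs A S = {f. (\<forall>x. x \<notin> S \<longrightarrow> f x = 0) \<and>
     (\<forall>x\<in>S. \<exists>V g. open V \<and> x \<in> V \<and> smooth_on_open A g V \<and> (\<forall>y\<in>V \<inter> S. g y = f y))}"

definition Rn :: "nat \<Rightarrow> (nat \<Rightarrow> real) set" where
  "Rn k = {v. \<forall>i\<ge>k. v i = 0}"

definition smooth_fields ::
    "('a::topological_space set \<times> ('a \<Rightarrow> 'e::euclidean_space)) set \<Rightarrow> 'a set \<Rightarrow> nat
     \<Rightarrow> ('a \<Rightarrow> nat \<Rightarrow> real) set" where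
  "smooth_fields A S k = {f. (\<forall>x. f x \<in> Rn k) \<and> (\<forall>i. (\<lambda>x. f x i) \<in> smooth_funs A S)}"

definition regular_value ::
    "('a::topological_space set \<times> ('a \<Rightarrow> 'e::euclidean_space)) set \<Rightarrow> ('a \<Rightarrow> real) \<Rightarrow> real \<Rightarrow> bool" where
  "regular_value A f t \<longleftrightarrow>
     (\<forall>x. f x = t \<longrightarrow> (\<forall>(D, \<phi>)\<in>A. x \<in> D \<longrightarrow>
        (f \<circ> inv_into D \<phi>) differentiable (at (\<phi> x)) \<and>
        surj (frechet_derivative (f \<circ> inv_into D \<phi>) (at (\<phi> x)))))"


subsection \<open>Random fields\<close>

text \<open>The \<open>\<sigma>\<close>-algebra generated by the evaluations at points.\<close>

definition path_space :: "('a \<Rightarrow> 'b::topological_space) measure" where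
  "path_space = (\<Pi>\<^sub>M x\<in>UNIV. borel)"

text \<open>\<open>indep_var\<close> without the restriction that both variables have the same type.\<close>

definition independent_rv ::
    "'w measure \<Rightarrow> 'x measure \<Rightarrow> ('w \<Rightarrow> 'x) \<Rightarrow> 'y measure \<Rightarrow> ('w \<Rightarrow> 'y) \<Rightarrow> bool" where
  "independent_rv P M X N Y \<longleftrightarrow>
     X \<in> measurable P M \<and> Y \<in> measurable P N \<and>
     prob_space.indep_set P {X -` B \<inter> space P | B. B \<in> sets M} {Y -` B \<inter> space P | B. B \<in> sets N}"

text \<open>
  Every linear functional of \<open>X\<close> that does not vanish on \<open>F\<close> is centered normal with positive
  variance. Each linear functional on \<open>F\<close> is the restriction of some \<open>l\<close> below.
\<close>

definition centered_nondegenerate_gaussian ::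
    "'w measure \<Rightarrow> 'v::real_vector set \<Rightarrow> ('w \<Rightarrow> 'v) \<Rightarrow> bool" where
  "centered_nondegenerate_gaussian P F X \<longleftrightarrow>
     (\<forall>\<omega>\<in>space P. X \<omega> \<in> F) \<and>
     (\<forall>l :: 'v \<Rightarrow> real. linear l \<and> (\<exists>f\<in>F. l f \<noteq> 0) \<longrightarrow>
        (\<exists>\<sigma>>0. distributed P lborel (\<lambda>\<omega>. l (X \<omega>)) (\<lambda>y. ennreal (normal_density 0 \<sigma> y))))"

text \<open>
  \<open>W \<in> V\<close> almost surely, with density \<open>\<rho>\<close> with respect to the Lebesgue measure of the
  Euclidean space \<open>(V, ip)\<close>; \<open>c\<close> are the coordinates of \<open>W\<close> in an orthonormal basis.
\<close>

definition has_density_in ::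
    "'w measure \<Rightarrow> 'v::real_vector set \<Rightarrow> ('v \<Rightarrow> 'v \<Rightarrow> real) \<Rightarrow> ('w \<Rightarrow> 'v) \<Rightarrow> ('v \<Rightarrow> real) \<Rightarrow> bool" where
  "has_density_in P V ip W \<rho> \<longleftrightarrow>
     (\<exists>e c. orthonormal_basis V ip e \<and>
        (AE \<omega> in P. W \<omega> = (\<Sum>i<dim V. c \<omega> i *\<^sub>R e i)) \<and>
        distributed P (\<Pi>\<^sub>M i\<in>{..<dim V}. lborel) c
          (\<lambda>y. ennreal (\<rho> (\<Sum>i<dim V. y i *\<^sub>R e i))))"

definition admissible ::
    "('a::topological_space set \<times> ('a \<Rightarrow> 'e::euclidean_space)) set \<Rightarrow> 'a set \<Rightarrow> nat
     \<Rightarrow> 'w measure \<Rightarrow> ('w \<Rightarrow> 'a \<Rightarrow> nat \<Rightarrow> real) \<Rightarrow> bool" where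
  "admissible A S k P W \<longleftrightarrow>
     W \<in> measurable P path_space \<and>
     (\<forall>\<omega>\<in>space P. W \<omega> \<in> smooth_fields A S k) \<and>
     (\<exists>G ip. finite_dim_subspace G \<and> G \<subseteq> smooth_fields A S k \<and> scalar_product_on G ip \<and>
        (AE \<omega> in P. W \<omega> \<in> G) \<and>
        (\<forall>x\<in>S. (\<lambda>f. f x) ` G = Rn k) \<and>
        (\<exists>\<rho>. (\<forall>f\<in>G. \<rho> f \<ge> 0) \<and>
           has_density_in P G ip W \<rho> \<and>
           (\<forall>f\<in>G. \<forall>\<epsilon>>0. \<exists>\<delta>>0. \<forall>g\<in>G. ip_norm ip (g - f) < \<delta> \<longrightarrow> \<bar>\<rho> g - \<rho> f\<bar> < \<epsilon>) \<and>
           \<rho> 0 > 0 \<and>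
           (\<exists>\<beta>::real. \<beta> > real (dim G) \<and>
              (\<exists>C R. \<forall>f\<in>G. ip_norm ip f > R \<longrightarrow> \<rho> f \<le> C * ip_norm ip f powr (- \<beta>)))))"


subsection \<open>Expected numbers of zeros\<close>

text \<open>Counting measure on the full power set has value \<open>\<infinity>\<close> on infinite sets, unlike \<open>card\<close>.\<close>

definition expected_zeros ::
    "'w measure \<Rightarrow> ('w \<Rightarrow> 'a \<Rightarrow> real) \<Rightarrow> ('w \<Rightarrow> 'a \<Rightarrow> nat \<Rightarrow> real) \<Rightarrow> 'a set \<Rightarrow> ennreal" where
  "expected_zeros P Y W U =
     (\<integral>\<^sup>+\<omega>. emeasure (count_space UNIV) {x\<in>U. Y \<omega> x = 0 \<and> W \<omega> x = 0} \<partial>P)"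

text \<open>
  The \<open>n\<close> i.i.d. copies of \<open>Y\<close> are \<open>\<eta> \<mapsto> Y (\<eta> j)\<close> on the \<open>n\<close>-fold power of \<open>P\<close>. Taking the
  power of the law of \<open>Y\<close> on \<open>path_space\<close> instead would not do: its \<open>\<sigma>\<close>-algebra is too small
  for the number of zeros to be measurable.
\<close>

definition expected_zeros_iid ::
    "nat \<Rightarrow> 'w measure \<Rightarrow> ('w \<Rightarrow> 'a \<Rightarrow> real) \<Rightarrow> 'a set \<Rightarrow> ennreal" where
  "expected_zeros_iid n P Y U =
     (\<integral>\<^sup>+\<eta>. emeasure (count_space UNIV) {x\<in>U. \<forall>j<n. Y (\<eta> j) x = 0} \<partial>(\<Pi>\<^sub>M j\<in>{..<n}. P))"

end

theory Submission
  imports Defs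
begin

text \<open>
  Let \<open>v\<^sub>k\<close> be the basis of \<open>F\<close> in which \<open>X\<close> has independent standard normal coordinates
  \<open>\<xi>\<^sub>k\<close>. On \<open>S\<close> the functions \<open>v\<^sub>k / (e\<^sup>t f\<^sub>0)\<close> are the components of a unit vector
  \<open>u(x)\<close>; the zeros of \<open>X\<close> are the solutions of \<open>\<xi> \<bullet> u(x) = 0\<close>, and those of \<open>X\<^sub>0\<close> are the
  solutions of \<open>\<xi> \<bullet> u(x) = s\<close> with \<open>s = - e\<^sup>-\<^sup>t \<xi>\<^sub>0\<close> independent of everything else. In the
  Kac-Rice integral for the second equation, translate \<open>\<xi>\<close> by \<open>s u(x)\<close>. This gives the integral
  for the first equation: the Jacobian does not change, since \<open>u\<close> is orthogonal to its
  derivatives, and the Gaussian density on the hyperplane \<open>\<xi> \<bullet> u(x) = 0\<close> is multiplied by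
  \<open>exp (- s\<^sup>2 / 2)\<close>. Hence the expected number of zeros of \<open>X\<^sub>0\<close> is that of \<open>X\<close> times the
  mean of \<open>exp (- s\<^sup>2 / 2)\<close>, a constant less than \<open>1\<close>. The same works with further equations
  that do not involve \<open>\<xi>\<close>, and with several such equations in independent blocks of variables.
\<close>

text \<open>Both inequalities follow from one identity in \<open>ennreal\<close>: left-hand side =
  \<open>q\<close> times right-hand side with \<open>q < 1\<close>
  (\<open>expected_zeros_ratio\<close>). Infinite values then matter only in the equality clause, as
  \<open>q * \<infinity> = \<infinity>\<close> for \<open>q > 0\<close>. The Kac-Rice integral is
  not set up through conditional densities. Once all randomness is fixed except a shift of the
  coefficients along a few constant directions, zeros are preimages under an explicit map between
  spaces of equal dimension, and the area formula counts them. The translation by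
  \<open>s u(x)\<close> takes place for fixed \<open>x\<close>, inside the integral over the
  coefficients. The unit length of \<open>u\<close> is the choice of the level: on \<open>S\<close>
  the variance of \<open>X\<close> is \<open>exp (2 * t) * f\<^sub>0\<^sup>2\<close>. Because
  \<open>f\<^sub>0\<close> is not in \<open>F\<close>, finitely many evaluations of
  \<open>X\<^sub>0\<close> determine both \<open>X\<close> and \<open>\<xi>\<^sub>0\<close>; so
  independence of \<open>W\<close> from \<open>X\<^sub>0\<close> is independence of \<open>W\<close>
  from all Gaussian variables jointly. For this reason all coordinates of random fields are taken as
  combinations of point evaluations, which are measurable on \<open>path_space\<close>.\<close>

text \<open>
  An index type with \<open>DIM('e) - 1\<close> elements, so that hypersurfaces are parametrized by open sets
  of \<open>real^('e hyper)\<close>; the change of variables theorems want a well-ordered index type. The value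
  for \<open>DIM('e) = 1\<close> is junk, as a type cannot be empty.
\<close>

typedef (overloaded) 'e::euclidean_space hyper = "if DIM('e) > 1 then Basis - {SOME b :: 'e. b \<in> Basis} else (Basis :: 'e set)"
proof (cases "DIM('e) > 1")
  case True
  have "\<not> (Basis :: 'e set) \<subseteq> {SOME b :: 'e. b \<in> Basis}"
  proof
    assume "(Basis :: 'e set) \<subseteq> {SOME b :: 'e. b \<in> Basis}"
    then have "DIM('e) \<le> card {SOME b :: 'e. b \<in> Basis}" by (intro card_mono) auto
    with True show False by simp
  qed
  then show ?thesis using True by auto
next
  case False
  then show ?thesis using SOME_Basis[where 'a='e] by (auto intro!: exI)
qed

instance hyper :: (euclidean_space) finite
proof
  have "UNIV = Abs_hyper ` (if DIM('a) > 1 then Basis - {SOME b :: 'a. b \<in> Basis} else (Basis :: 'a set))"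
    by (metis (mono_tags, lifting) Rep_hyper Rep_hyper_inverse UNIV_eq_I image_eqI)
  then show "finite (UNIV :: 'a hyper set)"
    by (metis finite_Basis finite_Diff finite_imageI)
qed

instantiation hyper :: (euclidean_space) wellorder
begin

definition less_eq_hyper :: "'a hyper \<Rightarrow> 'a hyper \<Rightarrow> bool" where
  "less_eq_hyper x y \<longleftrightarrow> to_nat_on (UNIV :: 'a hyper set) x \<le> to_nat_on (UNIV :: 'a hyper set) y"

definition less_hyper :: "'a hyper \<Rightarrow> 'a hyper \<Rightarrow> bool" where
  "less_hyper x y \<longleftrightarrow> to_nat_on (UNIV :: 'a hyper set) x < to_nat_on (UNIV :: 'a hyper set) y"

instance
proof
  have inj: "inj (to_nat_on (UNIV :: 'a hyper set))"
    by (simp add: countable_finite inj_on_to_nat_on)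
  show "x = y" if "x \<le> y" "y \<le> x" for x y :: "'a hyper"
    using that inj by (auto simp: less_eq_hyper_def inj_def)
  show "P a" if "\<And>x. (\<And>y. y < x \<Longrightarrow> P y) \<Longrightarrow> P x" for P and a :: "'a hyper"
    using that
  proof (induction a rule: measure_induct_rule[of "to_nat_on (UNIV :: 'a hyper set)"])
    case (less x)
    then show ?case unfolding less_hyper_def by blast
  qed
qed (auto simp: less_eq_hyper_def less_hyper_def)

end

lemma CARD_hyper: "DIM('e::euclidean_space) > 1 \<Longrightarrow> CARD('e hyper) = DIM('e) - 1"
proof -
  assume "DIM('e) > 1"
  then have "CARD('e hyper) = card (Basis - {SOME b :: 'e. b \<in> Basis})"
    using type_definition.card[OF type_definition_hyper[where 'e='e]] by simp
  also have "\<dots> = DIM('e) - 1"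
    using some_in_eq[of "Basis :: 'e set"] by (simp add: card_Diff_singleton)
  finally show ?thesis .
qed

subsection \<open>The area formula with multiplicity\<close>

lemma continuous_on_det_matrix:
  fixes D :: "'a::t2_space \<Rightarrow> (real^'n) \<Rightarrow>\<^sub>L (real^'n)"
  assumes "continuous_on S D"
  shows "continuous_on S (\<lambda>y. det (matrix (D y)))"
  unfolding det_def matrix_def
  using assms by (auto intro!: continuous_intros)

text \<open>Two measures on the target agree on every Borel set \<open>B\<close>: Lebesgue measure
  restricted to the image of \<open>T\<close>, and the push-forward of the measure on
  \<open>T\<close> whose density is the absolute Jacobian. For a single \<open>B\<close> this is the
  change of variables formula for sets, applied to the part of \<open>T\<close> that
  \<open>g\<close> sends into \<open>B\<close>. Integrating \<open>h\<close> against both gives the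
  claim.\<close>

lemma nn_area_injective:
  fixes g :: "real^'n::{finite,wellorder} \<Rightarrow> real^'n::{finite,wellorder}" and D :: "real^'n::{finite,wellorder} \<Rightarrow> (real^'n::{finite,wellorder}) \<Rightarrow>\<^sub>L (real^'n::{finite,wellorder})"
  assumes T: "T \<in> sets borel" "T \<subseteq> K" and K: "compact K"
    and der: "\<And>y. y \<in> K \<Longrightarrow> (g has_derivative D y) (at y)" and D: "continuous_on K D"
    and inj: "inj_on g K" and h[measurable]: "h \<in> borel_measurable borel"
  shows "g ` T \<in> sets borel"
    and "(\<integral>\<^sup>+z. h z * indicator (g ` T) z \<partial>lborel) =
      (\<integral>\<^sup>+y. h (g y) * ennreal \<bar>det (matrix (D y))\<bar> * indicator T y \<partial>lborel)"
proof -
  have contg: "continuous_on K g"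
    by (rule has_derivative_continuous_on[of K g "\<lambda>y. blinfun_apply (D y)"]) (use der has_derivative_at_withinI in blast)
  \<comment> \<open>On a compact set an injective continuous map has a continuous inverse, so images
    of Borel sets are preimages under \<open>k\<close> and hence Borel.\<close>
  obtain k where k: "continuous_on (g ` K) k" "\<And>y. y \<in> K \<Longrightarrow> k (g y) = y"
    using continuous_on_inv[OF contg K, of "the_inv_into K g"] inj by (metis the_inv_into_f_f)
  have Kb: "K \<in> sets borel" and gKb: "g ` K \<in> sets borel"
    using K contg by (auto intro!: borel_closed compact_imp_closed compact_continuous_image)
  have img: "g ` B \<in> sets borel" if B: "B \<in> sets borel" "B \<subseteq> K" for B
  proof -
    have "k -` B \<inter> g ` K \<in> sets (restrict_space borel (g ` K))"
      using measurable_sets[OF borel_measurable_continuous_on_restrict[OF k(1)] B(1)]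
      by (simp add: space_restrict_space)
    then have "k -` B \<inter> g ` K \<in> sets borel"
      using gKb by (simp add: sets_restrict_space_iff)
    also have "k -` B \<inter> g ` K = g ` B" using k(2) B(2) by force
    finally show ?thesis .
  qed
  show "g ` T \<in> sets borel" using img T by blast
  \<comment> \<open>Off \<open>K\<close> nothing is known about \<open>D\<close> and
    \<open>g\<close>; extension by 0 gives globally Borel functions that agree with them on
    \<open>T\<close>.\<close>
  define d where "d = (\<lambda>y. if y \<in> K then \<bar>det (matrix (D y))\<bar> else 0)"
  have d[measurable]: "d \<in> borel_measurable borel"
    unfolding d_def
    by (rule borel_measurable_continuous_on_if[of K]) (use Kb D in \<open>auto intro!: continuous_intros continuous_on_det_matrix\<close>)
  define g2 where "g2 = (\<lambda>y. if y \<in> K then g y else 0)"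
  have g2[measurable]: "g2 \<in> borel_measurable borel"
    unfolding g2_def
    by (rule borel_measurable_continuous_on_if[of K]) (use Kb contg in \<open>auto intro!: continuous_intros\<close>)
  note T(1)[measurable]
  have gT[measurable]: "g ` T \<in> sets borel" using img T by blast
  have eq: "density lborel (indicator (g ` T)) = distr (density lborel (\<lambda>y. ennreal (d y) * indicator T y)) borel g2"
  proof (rule measure_eqI)
    show "sets (density lborel (indicator (g ` T))) = sets (distr (density lborel (\<lambda>y. ennreal (d y) * indicator T y)) borel g2)"
      by simp
    fix B assume "B \<in> sets (density lborel (indicator (g ` T)))"
    then have B[measurable]: "B \<in> sets borel" by simp
    define T' where "T' = T \<inter> g2 -` B"
    have T'[measurable]: "T' \<in> sets borel" unfolding T'_def
      using measurable_sets[OF g2 B] by auto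
    have T'K: "T' \<subseteq> K" using T by (auto simp: T'_def)
    have gT': "g ` T' = g ` T \<inter> B" using T(2) by (auto simp: T'_def g2_def)
    have lm: "g ` T' \<in> lmeasurable"
    proof (rule bounded_set_imp_lmeasurable)
      show "bounded (g ` T')"
        using T'K contg K by (meson bounded_subset compact_continuous_image compact_imp_bounded image_mono)
      show "g ` T' \<in> sets lebesgue" using img[OF T' T'K] by simp
    qed
    have "((\<lambda>y. \<bar>det (matrix (D y))\<bar>) has_integral measure lebesgue (g ` T')) T'"
    proof (rule has_measure_differentiable_image[THEN iffD1])
      show "T' \<in> sets lebesgue" using T' by simp
      show "\<And>x. x \<in> T' \<Longrightarrow> (g has_derivative D x) (at x within T')"
        using der T'K by (meson has_derivative_at_withinI subsetD)
      show "inj_on g T'" using inj T'K inj_on_subset by blast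
    qed (use lm in auto)
    then have "(\<integral>\<^sup>+y. ennreal \<bar>det (matrix (D y))\<bar> * indicator T' y \<partial>lborel) = ennreal (measure lebesgue (g ` T'))"
      by (intro nn_integral_has_integral_lebesgue') auto
    also have "\<dots> = emeasure lborel (g ` T')"
      using emeasure_eq_measure2[OF lm] emeasure_completion[of "g ` T'" lborel] img[OF T' T'K] by simp
    finally have 1: "(\<integral>\<^sup>+y. ennreal \<bar>det (matrix (D y))\<bar> * indicator T' y \<partial>lborel) = emeasure lborel (g ` T')" .
    have "emeasure (density lborel (indicator (g ` T))) B = (\<integral>\<^sup>+z. indicator (g ` T) z * indicator B z \<partial>lborel)"
      by (subst emeasure_density) simp_all
    also have "\<dots> = (\<integral>\<^sup>+z. indicator (g ` T') z \<partial>lborel)"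
      unfolding gT' indicator_inter_arith ..
    also have "\<dots> = emeasure lborel (g ` T')" using img[OF T' T'K] by simp
    also have "\<dots> = (\<integral>\<^sup>+y. ennreal (d y) * indicator T y * indicator (g2 -` B) y \<partial>lborel)"
      unfolding 1[symmetric] using T'K T(2)
      by (auto intro!: nn_integral_cong simp: d_def T'_def split: split_indicator)
    also have "\<dots> = emeasure (distr (density lborel (\<lambda>y. ennreal (d y) * indicator T y)) borel g2) B"
      using measurable_sets[OF g2 B]
      by (subst emeasure_distr, simp, simp, subst emeasure_density) auto
    finally show "emeasure (density lborel (indicator (g ` T))) B = \<dots>" .
  qed
  have "(\<integral>\<^sup>+z. h z * indicator (g ` T) z \<partial>lborel) = (\<integral>\<^sup>+z. h z \<partial>density lborel (indicator (g ` T)))"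
    by (subst nn_integral_density) (auto simp: mult.commute)
  also have "\<dots> = (\<integral>\<^sup>+y. ennreal (d y) * indicator T y * h (g2 y) \<partial>lborel)"
    unfolding eq by (subst nn_integral_distr, simp, simp, subst nn_integral_density) auto
  also have "\<dots> = (\<integral>\<^sup>+y. h (g y) * ennreal \<bar>det (matrix (D y))\<bar> * indicator T y \<partial>lborel)"
    using T(2) by (auto intro!: nn_integral_cong simp: d_def g2_def mult.commute mult.left_commute split: split_indicator)
  finally show "(\<integral>\<^sup>+z. h z * indicator (g ` T) z \<partial>lborel) =
      (\<integral>\<^sup>+y. h (g y) * ennreal \<bar>det (matrix (D y))\<bar> * indicator T y \<partial>lborel)" .
qed

lemma inj_on_cball_of_det_nonzero:
  fixes g :: "real^'n::{finite,wellorder} \<Rightarrow> real^'n::{finite,wellorder}" and D :: "real^'n::{finite,wellorder} \<Rightarrow> (real^'n::{finite,wellorder}) \<Rightarrow>\<^sub>L (real^'n::{finite,wellorder})"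
  assumes Om: "open Om" and der: "\<And>y. y \<in> Om \<Longrightarrow> (g has_derivative D y) (at y)" and D: "continuous_on Om D"
    and y: "y \<in> Om" "det (matrix (D y)) \<noteq> 0"
  obtains r where "r > 0" "cball y r \<subseteq> Om" "inj_on g (cball y r)"
proof -
  \<comment> \<open>The inverse function theorem takes a left inverse of the derivative in the space
    of bounded operators; the inverse matrix provides it.\<close>
  have "invertible (matrix (D y))" using y by (simp add: invertible_det_nz)
  then obtain B where B: "B ** matrix (D y) = mat 1"
    by (auto simp: invertible_def)
  have D': "blinfun_apply (D y) = (*v) (matrix (D y))"
    by (simp add: matrix_works bounded_linear.linear blinfun.bounded_linear_right fun_eq_iff)
  have "Blinfun ((*v) B) o\<^sub>L D y = id_blinfun"
  proof (rule blinfun_eqI)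
    fix v
    have "(Blinfun ((*v) B) o\<^sub>L D y) v = B *v (matrix (D y) *v v)"
      by (simp add: bounded_linear_Blinfun_apply matrix_vector_mul_bounded_linear) (metis D')
    also have "\<dots> = v" by (simp add: matrix_vector_mul_assoc B)
    finally show "(Blinfun ((*v) B) o\<^sub>L D y) v = id_blinfun v" by simp
  qed
  then obtain U' V k k' where U': "open U'" "U' \<subseteq> Om" "y \<in> U'" "homeomorphism U' V g k"
    using inverse_function_theorem[OF Om der D y(1)] by metis
  then obtain r where r: "r > 0" "cball y r \<subseteq> U'" by (meson open_contains_cball)
  moreover have "inj_on g U'" using U'(4) by (metis homeomorphism_apply1 inj_on_inverseI)
  ultimately show ?thesis using that U' by (meson inj_on_subset order_trans)
qed

text \<open>Every noncritical point has a closed ball on which \<open>g\<close> is injective, and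
  countably many of these balls cover all noncritical points. Cutting \<open>E\<close> along them
  leaves a set of critical points, whose image is negligible by Sard's theorem, and disjoint pieces
  to which \<open>nn_area_injective\<close> applies. Off the negligible image, the number of
  preimages of \<open>z\<close> is the number of pieces whose image contains
  \<open>z\<close>.\<close>

lemma nn_area:
  fixes g :: "real^'n::{finite,wellorder} \<Rightarrow> real^'n::{finite,wellorder}" and D :: "real^'n::{finite,wellorder} \<Rightarrow> (real^'n::{finite,wellorder}) \<Rightarrow>\<^sub>L (real^'n::{finite,wellorder})"
  assumes Om: "open Om" and E: "E \<in> sets borel" "E \<subseteq> Om"
    and der: "\<And>y. y \<in> Om \<Longrightarrow> (g has_derivative D y) (at y)" and D: "continuous_on Om D"
    and h[measurable]: "h \<in> borel_measurable borel"
  shows "(\<integral>\<^sup>+z. h z * emeasure (count_space UNIV) {y\<in>E. g y = z} \<partial>lborel) =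
      (\<integral>\<^sup>+y. h (g y) * ennreal \<bar>det (matrix (D y))\<bar> * indicator E y \<partial>lborel)"
proof -
  let ?N = "{y\<in>Om. det (matrix (D y)) \<noteq> 0}"
  have "\<exists>r. r > 0 \<and> cball y r \<subseteq> Om \<and> inj_on g (cball y r)" if "y \<in> ?N" for y
  proof -
    have y: "y \<in> Om" "det (matrix (D y)) \<noteq> 0" using that by auto
    obtain r where "r > 0" "cball y r \<subseteq> Om" "inj_on g (cball y r)"
      by (rule inj_on_cball_of_det_nonzero[OF Om der D y])
    then show ?thesis by blast
  qed
  then have "\<exists>r. \<forall>y\<in>?N. r y > 0 \<and> cball y (r y) \<subseteq> Om \<and> inj_on g (cball y (r y))"
    by (intro bchoice ballI)
  then obtain r where r: "\<And>y. y \<in> ?N \<Longrightarrow> r y > 0 \<and> cball y (r y) \<subseteq> Om \<and> inj_on g (cball y (r y))"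
    by (elim exE) (rule that, erule bspec)
  obtain F' where F': "F' \<subseteq> (\<lambda>y. ball y (r y)) ` ?N" "countable F'" "\<Union>F' = \<Union>((\<lambda>y. ball y (r y)) ` ?N)"
    using Lindelof[of "(\<lambda>y. ball y (r y)) ` ?N"] by auto
  have "\<exists>Y. countable Y \<and> Y \<subseteq> ?N \<and> F' = (\<lambda>y. ball y (r y)) ` Y"
    by (rule iffD1[OF countable_subset_image conjI[OF F'(2,1)]])
  then obtain Y where Y: "Y \<subseteq> ?N" "countable Y" "F' = (\<lambda>y. ball y (r y)) ` Y"
    by (elim exE conjE)
  \<comment> \<open>The selected balls as a sequence, possibly with repetitions; if there is no
    noncritical point, all \<open>K n\<close> are empty.\<close>
  define K where "K n = (if Y = {} then {} else cball (from_nat_into Y n) (r (from_nat_into Y n)))" for n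
  have fromY: "from_nat_into Y n \<in> ?N" if "Y \<noteq> {}" for n
    using from_nat_into[OF that] Y(1) by blast
  have K: "compact (K n)" "K n \<subseteq> Om" "inj_on g (K n)" for n
    using r[OF fromY] by (auto simp: K_def)
  have cover: "?N \<subseteq> (\<Union>n. K n)"
  proof
    fix x assume x: "x \<in> ?N"
    then have "x \<in> \<Union>F'" unfolding F'(3) using r[OF x] by auto
    then obtain y where y: "y \<in> Y" "x \<in> ball y (r y)" using Y(3) by auto
    then obtain n where "y = from_nat_into Y n" using Y(2) by (metis from_nat_into_surj)
    then show "x \<in> (\<Union>n. K n)" using y unfolding K_def by (auto intro!: exI[of _ n])
  qed
  \<comment> \<open>The balls overlap; \<open>disjointed\<close> assigns each point to the first
    ball that contains it. A piece may still contain critical points, which the injective case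
    allows.\<close>
  define T where "T n = E \<inter> disjointed K n" for n
  define C where "C = E - (\<Union>n. K n)"
  have Kb[measurable]: "K n \<in> sets borel" for n using K(1) by (simp add: borel_compact)
  have Tb[measurable]: "T n \<in> sets borel" for n
  proof -
    have "range (disjointed K) \<subseteq> sets borel" by (rule sets.range_disjointed_sets) (use Kb in blast)
    then show ?thesis unfolding T_def using E(1) by (intro sets.Int) blast+
  qed
  have TK: "T n \<subseteq> K n" for n unfolding T_def using disjointed_subset[of K n] by auto
  have disj: "disjoint_family T"
    unfolding T_def using disjoint_family_disjointed[of K] by (auto simp: disjoint_family_on_def)
  have Eq: "E = C \<union> (\<Union>n. T n)" "C \<inter> (\<Union>n. T n) = {}"
    using UN_disjointed_eq[of K] TK unfolding C_def T_def by auto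
  have CN: "det (matrix (D y)) = 0" if "y \<in> C" for y
    using that cover E(2) by (auto simp: C_def)
  have "negligible (g ` C)"
  proof (rule baby_Sard)
    show "\<And>x. x \<in> C \<Longrightarrow> (g has_derivative D x) (at x within C)"
      using der E(2) by (metis C_def DiffD1 has_derivative_at_withinI subsetD)
    show "\<And>x. x \<in> C \<Longrightarrow> rank (matrix (D x)) < CARD('n)"
      using CN less_rank_noninjective det_eq_0_rank by metis
  qed simp
  then have "g ` C \<in> null_sets lebesgue" by (simp add: negligible_iff_null_sets)
  then have AE1: "AE z in lborel. z \<notin> g ` C"
    using AE_not_in[of "g ` C" lebesgue] by (simp add: AE_completion_iff)
  have cnt: "emeasure (count_space UNIV) {y\<in>E. g y = z} = (\<Sum>n. indicator (g ` T n) z)" if "z \<notin> g ` C" for z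
  proof -
    have "{y\<in>E. g y = z} = (\<Union>n. {y\<in>T n. g y = z})" using that Eq(1) by auto
    also have "emeasure (count_space UNIV) \<dots> = (\<Sum>n. emeasure (count_space UNIV) {y\<in>T n. g y = z})"
      using disj by (intro suminf_emeasure[symmetric]) (auto simp: disjoint_family_on_def)
    also have "\<dots> = (\<Sum>n. indicator (g ` T n) z)"
    proof (rule suminf_cong)
      fix n
      show "emeasure (count_space UNIV) {y \<in> T n. g y = z} = indicator (g ` T n) z"
      proof (cases "z \<in> g ` T n")
        case True
        then obtain y where y: "y \<in> T n" "g y = z" by auto
        then have "{y \<in> T n. g y = z} = {y}" using K(3)[of n] TK[of n] by (auto dest: inj_onD)
        then show ?thesis using True by simp
      next
        case False
        then have e: "{y \<in> T n. g y = z} = {}" by auto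
        show ?thesis unfolding e using False by simp
      qed
    qed
    finally show ?thesis .
  qed
  have DK: "continuous_on (K n) D" for n using D K(2) continuous_on_subset by blast
  have derK: "\<And>y. y \<in> K n \<Longrightarrow> (g has_derivative D y) (at y)" for n using der K(2) by blast
  have A: "g ` T n \<in> sets borel"
    "(\<integral>\<^sup>+z. h z * indicator (g ` T n) z \<partial>lborel) =
      (\<integral>\<^sup>+y. h (g y) * ennreal \<bar>det (matrix (D y))\<bar> * indicator (T n) y \<partial>lborel)" for n
    by (rule nn_area_injective[OF Tb TK K(1) derK DK K(3) h]; assumption)+
  note A(1)[measurable]
  define d where "d n = (\<lambda>y. h (g y) * ennreal \<bar>det (matrix (D y))\<bar> * indicator (T n) y)" for n
  have dm: "d n \<in> borel_measurable borel" for n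
  proof -
    have "(\<lambda>y. h (if y \<in> K n then g y else 0) * ennreal (if y \<in> K n then \<bar>det (matrix (D y))\<bar> else 0) * indicator (T n) y) \<in> borel_measurable borel"
    proof -
      have [measurable]: "(\<lambda>y. if y \<in> K n then \<bar>det (matrix (D y))\<bar> else 0) \<in> borel_measurable borel"
        by (rule borel_measurable_continuous_on_if) (use DK in \<open>auto intro!: continuous_intros continuous_on_det_matrix\<close>)
      have [measurable]: "(\<lambda>y. if y \<in> K n then g y else 0) \<in> borel_measurable borel"
        by (rule borel_measurable_continuous_on_if) (auto intro!: has_derivative_continuous_on[of _ g "\<lambda>y. blinfun_apply (D y)"] has_derivative_at_withinI derK)
      show ?thesis by measurable
    qed
    also have "(\<lambda>y. h (if y \<in> K n then g y else 0) * ennreal (if y \<in> K n then \<bar>det (matrix (D y))\<bar> else 0) * indicator (T n) y) = d n"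
      using TK[of n] by (auto simp: d_def fun_eq_iff split: split_indicator)
    finally show ?thesis .
  qed
  have "(\<integral>\<^sup>+z. h z * emeasure (count_space UNIV) {y\<in>E. g y = z} \<partial>lborel)
     = (\<integral>\<^sup>+z. (\<Sum>n. h z * indicator (g ` T n) z) \<partial>lborel)"
    using AE1 by (intro nn_integral_cong_AE) (auto simp: cnt)
  also have "\<dots> = (\<Sum>n. \<integral>\<^sup>+z. h z * indicator (g ` T n) z \<partial>lborel)"
    by (intro nn_integral_suminf) measurable
  also have "\<dots> = (\<Sum>n. \<integral>\<^sup>+y. d n y \<partial>lborel)" unfolding d_def by (simp add: A(2))
  also have "\<dots> = (\<integral>\<^sup>+y. (\<Sum>n. d n y) \<partial>lborel)"
    by (intro nn_integral_suminf[symmetric]) (use dm in simp)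
  also have "\<dots> = (\<integral>\<^sup>+y. h (g y) * ennreal \<bar>det (matrix (D y))\<bar> * indicator E y \<partial>lborel)"
  proof (intro nn_integral_cong)
    fix y
    have ind: "(\<Sum>n. indicator (T n) y) = (indicator (\<Union>n. T n) y :: ennreal)"
      using disj by (rule suminf_indicator)
    have "(\<Sum>n. d n y) = h (g y) * ennreal \<bar>det (matrix (D y))\<bar> * indicator (\<Union>n. T n) y"
      unfolding d_def ind[symmetric] by simp
    \<comment> \<open>On \<open>C\<close> the left side is 0 because no piece contains the point,
      and the right side is 0 because the determinant vanishes there.\<close>
    also have "\<dots> = h (g y) * ennreal \<bar>det (matrix (D y))\<bar> * indicator E y"
      using Eq CN[of y] by (cases "y \<in> C") (auto split: split_indicator)
    finally show "(\<Sum>n. d n y) = h (g y) * ennreal \<bar>det (matrix (D y))\<bar> * indicator E y" .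
  qed
  finally show ?thesis .
qed

subsection \<open>Measurability of the number of zeros\<close>

text \<open>By compactness the norm of \<open>F w\<close> attains its infimum, so a zero exists
  exactly when the norm gets below every \<open>1 / Suc n\<close>, and by continuity this can be
  tested on a countable dense subset. The event becomes a countable combination of events about
  single points.\<close>

lemma sets_hit_compact:
  fixes F :: "'w \<Rightarrow> 'e::euclidean_space \<Rightarrow> 'b::euclidean_space"
  assumes meas: "\<And>y. y \<in> K \<Longrightarrow> (\<lambda>w. F w y) \<in> borel_measurable M"
    and cont: "\<And>w. w \<in> space M \<Longrightarrow> continuous_on K (F w)" and K: "compact K"
  shows "{w\<in>space M. \<exists>y\<in>K. F w y = 0} \<in> sets M"
proof -
  obtain T where T: "countable T" "T \<subseteq> K" "K \<subseteq> closure T" using separable by metis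
  have "(\<exists>y\<in>K. F w y = 0) \<longleftrightarrow> (\<forall>n. \<exists>y\<in>T. norm (F w y) < 1 / real (Suc n))" if w: "w \<in> space M" for w
  proof
    assume "\<exists>y\<in>K. F w y = 0"
    then obtain y where y: "y \<in> K" "F w y = 0" by auto
    show "\<forall>n. \<exists>y\<in>T. norm (F w y) < 1 / real (Suc n)"
    proof
      fix n
      obtain d where d: "d > 0" "\<And>y'. y' \<in> K \<Longrightarrow> dist y' y < d \<Longrightarrow> dist (F w y') (F w y) < 1 / real (Suc n)"
        using cont[OF w] y(1) unfolding continuous_on_iff by (metis of_nat_0_less_iff zero_less_Suc zero_less_divide_1_iff)
      obtain y' where "y' \<in> T" "dist y' y < d"
        using T(3) y(1) d(1) closure_approachable by (metis subsetD)
      then show "\<exists>y\<in>T. norm (F w y) < 1 / real (Suc n)"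
        using d(2)[of y'] T(2) y(2) by (auto simp: dist_norm)
    qed
  next
    assume a: "\<forall>n. \<exists>y\<in>T. norm (F w y) < 1 / real (Suc n)"
    then have "K \<noteq> {}" using T(2) by auto
    then obtain y0 where y0: "y0 \<in> K" "\<And>y. y \<in> K \<Longrightarrow> norm (F w y0) \<le> norm (F w y)"
      using continuous_attains_inf[OF K, of "\<lambda>y. norm (F w y)"] cont[OF w] by (auto intro: continuous_on_norm)
    have "norm (F w y0) < 1 / real (Suc n)" for n using a y0(2) T(2) by (meson le_less_trans subsetD)
    then have "\<not> norm (F w y0) > 0"
      by (metis inverse_eq_divide less_asym reals_Archimedean)
    then show "\<exists>y\<in>K. F w y = 0" using y0(1) by auto
  qed
  then have "{w\<in>space M. \<exists>y\<in>K. F w y = 0} = {w\<in>space M. \<forall>n. \<exists>y\<in>T. norm (F w y) < 1 / real (Suc n)}" by auto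
  also have "\<dots> \<in> sets M"
  proof -
    have "{w\<in>space M. \<exists>y\<in>T. norm (F w y) < 1 / real (Suc n)} \<in> sets M" for n
    proof -
      have "{w\<in>space M. norm (F w y) < 1 / real (Suc n)} \<in> sets M" if "y \<in> T" for y
      proof -
        have [measurable]: "(\<lambda>w. F w y) \<in> borel_measurable M" using meas T(2) that by auto
        show ?thesis by measurable
      qed
      then have "(\<Union>y\<in>T. {w\<in>space M. norm (F w y) < 1 / real (Suc n)}) \<in> sets M"
        using T(1) by (intro sets.countable_UN') auto
      also have "(\<Union>y\<in>T. {w\<in>space M. norm (F w y) < 1 / real (Suc n)}) = {w\<in>space M. \<exists>y\<in>T. norm (F w y) < 1 / real (Suc n)}"
        by auto
      finally show ?thesis .
    qed
    then show ?thesis by (rule sets.sets_Collect_countable_All)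
  qed
  finally show ?thesis .
qed

lemma fsigma_in_Union_compact:
  fixes E :: "'e::euclidean_space set"
  assumes "fsigma_in euclidean E"
  obtains K :: "nat \<Rightarrow> 'e set" where "\<And>n. compact (K n)" "E = (\<Union>n. K n)"
proof -
  obtain C :: "nat \<Rightarrow> 'e set" where C: "\<And>n. closed (C n)" "E = (\<Union>n. C n)"
    using assms unfolding fsigma_in_ascending by (auto simp: closedin_closed_eq)
  have "fsigma E" unfolding C(2) by (rule fsigma.intros) (rule C(1))
  then have "\<exists>F::nat \<Rightarrow> 'e set. range F \<subseteq> Collect compact \<and> E = \<Union>(F ` UNIV)"
    by (simp only: fsigma_Union_compact)
  then obtain F :: "nat \<Rightarrow> 'e set" where F: "range F \<subseteq> Collect compact" "E = \<Union>(F ` UNIV)"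
    by (elim exE conjE)
  from F(1) have "compact (F n)" for n by blast
  then show ?thesis by (rule that[OF _ F(2)])
qed

lemma fsigma_in_imp_borel:
  fixes E :: "'e::euclidean_space set"
  assumes "fsigma_in euclidean E"
  shows "E \<in> sets borel"
proof -
  obtain K :: "nat \<Rightarrow> 'e set" where K: "\<And>n. compact (K n)" "E = (\<Union>n. K n)"
    using fsigma_in_Union_compact[OF assms] by blast
  show ?thesis unfolding K(2) by (intro sets.countable_UN image_subsetI borel_compact K(1))
qed

text \<open>F-sigma sets fit here because they are countable unions of compact sets, are stable
  under intersection with open sets, and include the differences of open sets by which a cover is
  made disjoint in \<open>ex_patches\<close>.\<close>

lemma sets_hit_fsigma:
  fixes F :: "'w \<Rightarrow> 'e::euclidean_space \<Rightarrow> 'b::euclidean_space"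
  assumes meas: "\<And>y. y \<in> E \<Longrightarrow> (\<lambda>w. F w y) \<in> borel_measurable M"
    and cont: "\<And>w. w \<in> space M \<Longrightarrow> continuous_on E (F w)" and E: "fsigma_in euclidean E"
  shows "{w\<in>space M. \<exists>y\<in>E. F w y = 0} \<in> sets M"
proof -
  obtain K :: "nat \<Rightarrow> 'e set" where K: "\<And>n. compact (K n)" "E = (\<Union>n. K n)"
    using fsigma_in_Union_compact[OF E] by blast
  have "{w\<in>space M. \<exists>y\<in>E. F w y = 0} = (\<Union>n. {w\<in>space M. \<exists>y\<in>K n. F w y = 0})"
    unfolding K(2) by auto
  also have "\<dots> \<in> sets M"
    by (intro sets.countable_UN image_subsetI sets_hit_compact)
      (use K meas in \<open>auto intro!: continuous_on_subset[OF cont]\<close>)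
  finally show ?thesis .
qed

text \<open>The number of zeros is the supremum, over finite disjoint families from a countable
  basis, of the number of members that contain a zero. There are countably many such families, and
  each summand is the indicator of a hitting event. The formula also gives infinity when there are
  infinitely many zeros.\<close>

lemma measurable_count_zeros:
  fixes F :: "'w \<Rightarrow> 'e::euclidean_space \<Rightarrow> 'b::euclidean_space"
  assumes meas: "\<And>y. y \<in> E \<Longrightarrow> (\<lambda>w. F w y) \<in> borel_measurable M"
    and cont: "\<And>w. w \<in> space M \<Longrightarrow> continuous_on E (F w)" and E: "fsigma_in euclidean E"
  shows "(\<lambda>w. emeasure (count_space UNIV) {y\<in>E. F w y = 0}) \<in> borel_measurable M"
proof -
  obtain \<B> :: "'e set set" where \<B>: "countable \<B>" "topological_basis \<B>"
    using ex_countable_basis by auto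
  define hit where "hit B = {w\<in>space M. \<exists>y\<in>E \<inter> B. F w y = 0}" for B
  define CC where "CC = {C. finite C \<and> C \<subseteq> \<B> \<and> disjoint C}"
  have cCC: "countable CC"
    by (rule countable_subset[OF _ countable_Collect_finite_subset[OF \<B>(1)]]) (auto simp: CC_def)
  have hit: "hit B \<in> sets M" if "B \<in> \<B>" for B
    unfolding hit_def
  proof (rule sets_hit_fsigma)
    have "open B" using \<B>(2) that topological_basis_open by blast
    then have "fsigma_in euclidean B"
      by (simp add: open_imp_fsigma_in metrizable_space_euclidean)
    then show "fsigma_in euclidean (E \<inter> B)" using E fsigma_in_Int by blast
  next
    show "(\<lambda>w. F w y) \<in> borel_measurable M" if "y \<in> E \<inter> B" for y using meas that by blast
    show "continuous_on (E \<inter> B) (F w)" if "w \<in> space M" for w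
      by (rule continuous_on_subset[OF cont[OF that]]) blast
  qed
  have eq: "emeasure (count_space UNIV) {y\<in>E. F w y = 0} = (SUP C\<in>CC. \<Sum>B\<in>C. indicator (hit B) w)"
    if w: "w \<in> space M" for w
  proof (rule antisym)
    let ?Z = "{y\<in>E. F w y = 0}"
    let ?S = "(SUP C\<in>CC. \<Sum>B\<in>C. indicator (hit B) w) :: ennreal"
    have fin: "of_nat (card Z) \<le> ?S" if Z: "finite Z" "Z \<subseteq> ?Z" for Z
    proof -
      obtain d where d: "d > 0" "\<And>x y. x \<in> Z \<Longrightarrow> y \<in> Z \<Longrightarrow> x \<noteq> y \<Longrightarrow> d \<le> dist x y"
      proof -
        have "\<exists>d>0. \<forall>x\<in>Z. \<forall>y\<in>Z. x \<noteq> y \<longrightarrow> d \<le> dist x y"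
        \<comment> \<open>The element 1 keeps the minimum defined when \<open>Z\<close> has at most
          one point.\<close>
        proof (intro exI[of _ "Min (insert 1 ((\<lambda>(x, y). dist x y) ` {(x, y). x \<in> Z \<and> y \<in> Z \<and> x \<noteq> y}))"] conjI ballI impI)
          have f: "finite ((\<lambda>(x, y). dist x y) ` {(x, y). x \<in> Z \<and> y \<in> Z \<and> x \<noteq> y})"
            by (rule finite_imageI, rule finite_subset[of _ "Z \<times> Z"]) (use Z in auto)
          show "0 < Min (insert 1 ((\<lambda>(x, y). dist x y) ` {(x, y). x \<in> Z \<and> y \<in> Z \<and> x \<noteq> y}))"
            using f by (subst Min_gr_iff) auto
          show "Min (insert 1 ((\<lambda>(x, y). dist x y) ` {(x, y). x \<in> Z \<and> y \<in> Z \<and> x \<noteq> y})) \<le> dist x y"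
            if "x \<in> Z" "y \<in> Z" "x \<noteq> y" for x y
            using f that by (intro Min_le) force+
        qed
        then show ?thesis using that by blast
      qed
      have "\<exists>B\<in>\<B>. y \<in> B \<and> B \<subseteq> ball y (d/2)" for y
        using topological_basisE[OF \<B>(2), of "ball y (d/2)" y] d(1) by (metis centre_in_ball half_gt_zero open_ball)
      then obtain B where B: "\<And>y. B y \<in> \<B> \<and> y \<in> B y \<and> B y \<subseteq> ball y (d/2)" by metis
      have dj: "B x \<inter> B y = {}" if "x \<in> Z" "y \<in> Z" "x \<noteq> y" for x y
      proof (rule ccontr)
        assume "B x \<inter> B y \<noteq> {}"
        then obtain z where "z \<in> ball x (d/2)" "z \<in> ball y (d/2)" using B by blast
        then have "dist x y < d" by (metis dist_commute dist_triangle_half_l mem_ball)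
        then show False using d(2)[OF that] by simp
      qed
      have injB: "inj_on B Z" using dj B by (metis disjoint_iff inj_onI)
      have "B ` Z \<in> CC" unfolding CC_def disjoint_def using Z B dj by blast
      then have "(\<Sum>B\<in>B ` Z. indicator (hit B) w) \<le> ?S" by (rule SUP_upper)
      also have "(\<Sum>B\<in>B ` Z. indicator (hit B) w) = (\<Sum>y\<in>Z. 1::ennreal)"
        unfolding sum.reindex[OF injB] o_def
        using B Z w by (intro sum.cong) (auto simp: hit_def indicator_def)
      finally show ?thesis by simp
    qed
    show "emeasure (count_space UNIV) ?Z \<le> ?S"
    proof (cases "finite ?Z")
      case True
      then show ?thesis using fin[of ?Z] by simp
    next
      case False
      have "of_nat n \<le> ?S" for n
      proof -
        obtain Z where "finite Z" "card Z = n" "Z \<subseteq> ?Z"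
          using infinite_arbitrarily_large[OF False, of n] by blast
        then show ?thesis using fin[of Z] by simp
      qed
      then have "?S = \<top>"
        by (metis ennreal_Ex_less_of_nat less_top not_less)
      then show ?thesis by (metis top_greatest)
    qed
    show "?S \<le> emeasure (count_space UNIV) ?Z"
    proof (rule SUP_least)
      fix C assume C: "C \<in> CC"
      define C' where "C' = {B\<in>C. w \<in> hit B}"
      \<comment> \<open>Choosing one zero in each member that is hit embeds these members into the
        zero set, because the members are disjoint.\<close>
      have "\<forall>B\<in>C'. \<exists>y. y \<in> E \<inter> B \<and> F w y = 0" by (auto simp: C'_def hit_def)
      then obtain y where "\<forall>B\<in>C'. y B \<in> E \<inter> B \<and> F w (y B) = 0" by (rule bchoice[THEN exE])
      then have y: "y B \<in> E \<inter> B \<and> F w (y B) = 0" if "B \<in> C'" for B using that by (rule bspec)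
      have dC: "B \<inter> B' = {}" if "B \<in> C" "B' \<in> C" "B \<noteq> B'" for B B'
        using C that by (auto simp: CC_def dest: disjointD)
      have inj: "inj_on y C'"
      proof (rule inj_onI, rule ccontr)
        fix B B' assume B: "B \<in> C'" "B' \<in> C'" "y B = y B'" "B \<noteq> B'"
        then have "B \<inter> B' = {}" by (intro dC) (auto simp: C'_def)
        moreover have "y B \<in> B" "y B' \<in> B'" using y[OF B(1)] y[OF B(2)] by blast+
        ultimately show False using B(3) by auto
      qed
      have finC: "finite C" "finite C'" using C by (auto simp: CC_def C'_def)
      have "(\<Sum>B\<in>C. indicator (hit B) w) = (of_nat (card C') :: ennreal)"
        unfolding C'_def using finC by (simp add: indicator_def sum.If_cases Int_def)
      also have "\<dots> = emeasure (count_space UNIV) (y ` C')"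
        using finC inj by (simp add: card_image)
      also have "\<dots> \<le> emeasure (count_space UNIV) ?Z"
        using y by (intro emeasure_mono) auto
      finally show "(\<Sum>B\<in>C. indicator (hit B) w) \<le> emeasure (count_space UNIV) ?Z" .
    qed
  qed
  have "(\<lambda>w. SUP C\<in>CC. \<Sum>B\<in>C. indicator (hit B) w :: ennreal) \<in> borel_measurable M"
  proof (rule borel_measurable_SUP[OF cCC])
    fix C assume "C \<in> CC"
    then show "(\<lambda>w. \<Sum>B\<in>C. indicator (hit B) w :: ennreal) \<in> borel_measurable M"
      using hit by (intro borel_measurable_sum borel_measurable_indicator) (auto simp: CC_def)
  qed
  then show ?thesis by (subst measurable_cong[OF eq])
qed

subsection \<open>Zeros of random linear systems in Euclidean space\<close>

text \<open>A product measure is determined by boxes, where the claim is translation invariance in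
  each factor. The restriction to \<open>J\<close> keeps the shifted functions in the extensional
  product space.\<close>

lemma nn_integral_PiM_lborel_shift:
  fixes c :: "'j \<Rightarrow> real"
  assumes J: "finite J" and f: "f \<in> borel_measurable (Pi\<^sub>M J (\<lambda>_. lborel :: real measure))"
  shows "(\<integral>\<^sup>+\<theta>. f (\<lambda>j\<in>J. \<theta> j + c j) \<partial>Pi\<^sub>M J (\<lambda>_. lborel)) = (\<integral>\<^sup>+\<theta>. f \<theta> \<partial>Pi\<^sub>M J (\<lambda>_. lborel))"
proof -
  interpret product_sigma_finite "\<lambda>_::'j. lborel :: real measure" ..
  let ?M = "Pi\<^sub>M J (\<lambda>_. lborel :: real measure)"
  let ?T = "\<lambda>\<theta>. \<lambda>j\<in>J. \<theta> j + c j"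
  have T: "?T \<in> measurable ?M ?M"
    by (intro measurable_restrict) (auto intro!: borel_measurable_add measurable_component_singleton[THEN measurable_compose])
  have "distr ?M ?M ?T = ?M"
  proof (rule PiM_eqI[OF J])
    fix A :: "'j \<Rightarrow> real set" assume A: "\<And>i. i \<in> J \<Longrightarrow> A i \<in> sets lborel"
    have pre: "(+) (c i) -` A i \<in> sets borel" if "i \<in> J" for i
      using measurable_sets[of "(+) (c i)" borel borel "A i"] A[OF that] by simp
    have "emeasure (distr ?M ?M ?T) (Pi\<^sub>E J A) = emeasure ?M (?T -` Pi\<^sub>E J A \<inter> space ?M)"
      using T A J by (intro emeasure_distr sets_PiM_I_finite) auto
    also have "?T -` Pi\<^sub>E J A \<inter> space ?M = Pi\<^sub>E J (\<lambda>i. (+) (c i) -` A i)"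
      by (auto simp: space_PiM PiE_iff extensional_def add.commute)
    also have "emeasure ?M \<dots> = (\<Prod>i\<in>J. emeasure lborel ((+) (c i) -` A i))"
      using J pre by (intro emeasure_PiM) auto
    also have "\<dots> = (\<Prod>i\<in>J. emeasure lborel (A i))"
    proof (rule prod.cong)
      fix i assume i: "i \<in> J"
      have "emeasure lborel (A i) = emeasure (distr lborel borel ((+) (c i))) (A i)"
        by (simp add: lborel_distr_plus)
      also have "\<dots> = emeasure lborel ((+) (c i) -` A i)"
        using A[OF i] by (subst emeasure_distr) auto
      finally show "emeasure lborel ((+) (c i) -` A i) = emeasure lborel (A i)" by simp
    qed simp
    finally show "emeasure (distr ?M ?M ?T) (Pi\<^sub>E J A) = (\<Prod>i\<in>J. emeasure lborel (A i))" .
  qed simp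
  then have "(\<integral>\<^sup>+\<theta>. f \<theta> \<partial>?M) = (\<integral>\<^sup>+\<theta>. f \<theta> \<partial>distr ?M ?M ?T)" by simp
  also have "\<dots> = (\<integral>\<^sup>+\<theta>. f (?T \<theta>) \<partial>?M)" by (rule nn_integral_distr[OF T]) (use f in simp)
  finally show ?thesis by simp
qed

text \<open>Since \<open>K y = 0\<close>, the change of \<open>R\<close> is multiplied by
  \<open>K (y + h)\<close>, which is of order \<open>norm h\<close>, so continuity of
  \<open>R\<close> already makes this term negligible. In
  \<open>nn_integral_zero_count_shift\<close> this differentiates an expression containing an
  inverse operator, at the point where its argument vanishes, without differentiating the
  inverse.\<close>

lemma has_derivative_blinfun_mult_zero:
  fixes R :: "'a::real_normed_vector \<Rightarrow> ('b::real_normed_vector \<Rightarrow>\<^sub>L 'c::real_normed_vector)"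
  assumes R: "isCont R y" and K: "(K has_derivative blinfun_apply K') (at y)" and 0: "K y = 0"
  shows "((\<lambda>x. R x (K x)) has_derivative blinfun_apply (R y o\<^sub>L K')) (at y)"
  unfolding has_derivative_at
proof
  show "bounded_linear (blinfun_apply (R y o\<^sub>L K'))" by (rule blinfun.bounded_linear_right)
  have k: "((\<lambda>h. norm (K (y + h) - K' h) / norm h) \<longlongrightarrow> 0) (at 0)"
    using K 0 unfolding has_derivative_at by simp
  have r: "((\<lambda>h. norm (R (y + h) - R y)) \<longlongrightarrow> 0) (at 0)"
    using R unfolding isCont_iff by (simp add: LIM_zero tendsto_norm_zero)
  have "((\<lambda>h. norm (R y) * (norm (K (y + h) - K' h) / norm h) + norm (R (y + h) - R y) * (norm (K (y + h) - K' h) / norm h + norm K')) \<longlongrightarrow> norm (R y) * 0 + 0 * (0 + norm K')) (at 0)"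
    by (intro tendsto_intros k r)
  then have lim: "((\<lambda>h. norm (R y) * (norm (K (y + h) - K' h) / norm h) + norm (R (y + h) - R y) * (norm (K (y + h) - K' h) / norm h + norm K')) \<longlongrightarrow> 0) (at 0)"
    by simp
  have bound: "norm (norm (R (y + h) (K (y + h)) - R y (K y) - (R y o\<^sub>L K') h) / norm h) \<le>
      norm (R y) * (norm (K (y + h) - K' h) / norm h) + norm (R (y + h) - R y) * (norm (K (y + h) - K' h) / norm h + norm K')"
    if h: "h \<noteq> 0" for h
  proof -
    have "R (y + h) (K (y + h)) - R y (K y) - (R y o\<^sub>L K') h =
        R y (K (y + h) - K' h) + (R (y + h) - R y) (K (y + h))"
      by (simp add: 0 blinfun.diff_right blinfun.diff_left blinfun.zero_right)
    then have "norm (R (y + h) (K (y + h)) - R y (K y) - (R y o\<^sub>L K') h)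
      \<le> norm (R y (K (y + h) - K' h)) + norm ((R (y + h) - R y) (K (y + h)))"
      by (metis norm_triangle_ineq)
    also have "\<dots> \<le> norm (R y) * norm (K (y + h) - K' h) + norm (R (y + h) - R y) * norm (K (y + h))"
      by (intro add_mono norm_blinfun)
    also have "norm (K (y + h)) \<le> norm (K (y + h) - K' h) + norm (K' h)"
      by (metis add.commute diff_add_cancel norm_triangle_ineq)
    also have "norm (K' h) \<le> norm K' * norm h" by (rule norm_blinfun)
    finally have "norm (R (y + h) (K (y + h)) - R y (K y) - (R y o\<^sub>L K') h)
      \<le> norm (R y) * norm (K (y + h) - K' h) + norm (R (y + h) - R y) * (norm (K (y + h) - K' h) + norm K' * norm h)"
      by (simp add: mult_left_mono)
    then have "norm (R (y + h) (K (y + h)) - R y (K y) - (R y o\<^sub>L K') h) / norm h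
      \<le> (norm (R y) * norm (K (y + h) - K' h) + norm (R (y + h) - R y) * (norm (K (y + h) - K' h) + norm K' * norm h)) / norm h"
      by (simp add: divide_right_mono)
    then show ?thesis using h by (simp add: field_simps)
  qed
  show "((\<lambda>h. norm (R (y + h) (K (y + h)) - R y (K y) - blinfun_apply (R y o\<^sub>L K') h) / norm h) \<longlongrightarrow> 0) (at 0)"
    by (rule Lim_null_comparison[OF _ lim]) (use bound in \<open>auto simp: eventually_at intro!: exI[of _ 1]\<close>)
qed

text \<open>Cramer's rule writes the entries of the inverse as quotients of polynomials in the
  entries of \<open>L y\<close>, which makes continuity visible; in finite dimension it suffices to
  check it on each vector.\<close>

lemma continuous_inverse_blinfun:
  fixes L :: "'a::t2_space \<Rightarrow> (real^'n) \<Rightarrow>\<^sub>L (real^'n)"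
  assumes L: "continuous_on S L" and inv: "\<And>y z. y \<in> S \<Longrightarrow> L y z = 0 \<Longrightarrow> z = 0"
  obtains R :: "'a \<Rightarrow> (real^'n) \<Rightarrow>\<^sub>L (real^'n)" where "continuous_on S R"
    "\<And>y z. y \<in> S \<Longrightarrow> R y (L y z) = z" "\<And>y z. y \<in> S \<Longrightarrow> L y (R y z) = z"
proof -
  define A where "A y = matrix (blinfun_apply (L y))" for y
  have LA: "L y z = A y *v z" for y z
    unfolding A_def by (simp add: matrix_works bounded_linear.linear blinfun.bounded_linear_right)
  have nz: "det (A y) \<noteq> 0" if "y \<in> S" for y
    using inv[OF that] unfolding LA by (metis matrix_left_invertible_ker invertible_det_nz invertible_left_inverse)
  have "\<exists>B. \<forall>y\<in>S. A y ** B y = mat 1 \<and> B y ** A y = mat 1"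
    using nz by (intro bchoice ballI) (simp flip: invertible_def add: invertible_det_nz)
  then obtain B where B: "A y ** B y = mat 1" "B y ** A y = mat 1" if "y \<in> S" for y
    by (elim exE) blast
  define R where "R y = Blinfun (\<lambda>v. B y *v v)" for y
  have R: "R y v = B y *v v" for y v
    unfolding R_def by (simp add: bounded_linear_Blinfun_apply matrix_vector_mul_bounded_linear)
  have inv1: "A y *v (B y *v v) = v" "B y *v (A y *v v) = v" if "y \<in> S" for y v
    using B[OF that] by (simp_all add: matrix_vector_mul_assoc)
  have Aij: "continuous_on S (\<lambda>y. A y $ i $ j)" for i j
    unfolding A_def matrix_def using L by (auto intro!: continuous_intros)
  have "continuous_on S (\<lambda>y. R y v)" for v
  proof -
    have "R y v = (\<chi> k. det (\<chi> i j. if j = k then v $ i else A y $ i $ j) / det (A y))" if "y \<in> S" for y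
      using cramer[OF nz[OF that], of "R y v" v] inv1[OF that] by (simp add: R)
    moreover have "continuous_on S (\<lambda>y. (\<chi> k. det (\<chi> i j. if j = k then v $ i else A y $ i $ j) / det (A y)) :: real^'n)"
    proof (rule continuous_on_vec_lambda)
      fix k
      have "continuous_on S (\<lambda>y. if j = k then v $ i else A y $ i $ j)" for i j
        using Aij by (cases "j = k") auto
      then have "continuous_on S (\<lambda>y. det (\<chi> i j. if j = k then v $ i else A y $ i $ j))"
        unfolding det_def vec_lambda_beta
        by (intro continuous_on_sum continuous_on_mult continuous_on_const continuous_on_prod)
      moreover have "continuous_on S (\<lambda>y. det (A y))"
        unfolding det_def by (intro continuous_on_sum continuous_on_mult continuous_on_const continuous_on_prod Aij)
      ultimately show "continuous_on S (\<lambda>y. det (\<chi> i j. if j = k then v $ i else A y $ i $ j) / det (A y))"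
        using nz by (intro continuous_on_divide) auto
    qed
    ultimately show ?thesis by (metis (no_types, lifting) continuous_on_cong)
  qed
  then have "continuous_on S R" by (intro continuous_on_blinfun_componentwise)
  then show ?thesis using that[of R] inv1 by (simp add: R LA)
qed

lemma borel_measurable_det: "(det :: real^'n^'n \<Rightarrow> real) \<in> borel_measurable borel"
  by (rule borel_measurable_continuous_onI) (unfold det_def, intro continuous_intros)

text \<open>
  Writing \<open>A(y) \<theta> = (\<Sum>j\<in>J. \<theta> j *\<^sub>R a j y)\<close>, first average over shifts of \<open>\<theta>\<close> by \<open>B z\<close>, where
  \<open>(B z) j = b j \<bullet> z\<close> and \<open>z\<close> runs through the unit cube: for fixed \<open>\<theta>\<close>, the equation
  \<open>A(y) (\<theta> + B z) = s\<close> reads \<open>z = (A(y) B)\<^sup>-\<^sup>1 (s - A(y) \<theta>)\<close>, and the area formula turns the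
  count of its solutions into an integral over \<open>y\<close>. After exchanging the integrals, translating
  \<open>\<theta>\<close> by \<open>\<tau>(y)\<close> reduces the level \<open>s\<close> to the level \<open>0\<close>.
\<close>

lemma nn_integral_zero_count_shift:
  fixes a :: "'j \<Rightarrow> real^'n::{finite,wellorder} \<Rightarrow> real^'n::{finite,wellorder}"
    and a' :: "'j \<Rightarrow> real^'n::{finite,wellorder} \<Rightarrow> ((real^'n::{finite,wellorder}) \<Rightarrow>\<^sub>L (real^'n::{finite,wellorder}))"
    and b :: "'j \<Rightarrow> real^'n::{finite,wellorder}" and \<tau> :: "'j \<Rightarrow> real^'n::{finite,wellorder} \<Rightarrow> real"
    and p :: "('j \<Rightarrow> real) \<Rightarrow> ennreal" and \<kappa> :: ennreal
    and M :: "('j \<Rightarrow> real) measure"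
  assumes M_def: "M = Pi\<^sub>M J (\<lambda>_. lborel :: real measure)"
    and J: "finite J" and Om: "open Om" and E: "fsigma_in euclidean E" "E \<subseteq> Om"
    and der: "\<And>j y. j \<in> J \<Longrightarrow> y \<in> Om \<Longrightarrow> (a j has_derivative a' j y) (at y)"
    and cont: "\<And>j. j \<in> J \<Longrightarrow> continuous_on Om (a' j)"
    and inv: "\<And>y z. y \<in> Om \<Longrightarrow> (\<Sum>j\<in>J. (b j \<bullet> z) *\<^sub>R a j y) = 0 \<Longrightarrow> z = 0"
    and p: "p \<in> borel_measurable M"
    and tau: "\<And>y. y \<in> E \<Longrightarrow> (\<Sum>j\<in>J. \<tau> j y *\<^sub>R a j y) = s"
      "\<And>y. y \<in> E \<Longrightarrow> (\<Sum>j\<in>J. \<tau> j y *\<^sub>R a' j y) = 0"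
    and shift: "\<And>\<theta> y. \<theta> \<in> space M \<Longrightarrow> y \<in> E \<Longrightarrow> (\<Sum>j\<in>J. \<theta> j *\<^sub>R a j y) = 0 \<Longrightarrow>
        p (\<lambda>j\<in>J. \<theta> j + \<tau> j y) = \<kappa> * p \<theta>"
  shows "(\<integral>\<^sup>+\<theta>. p \<theta> * emeasure (count_space UNIV) {y\<in>E. (\<Sum>j\<in>J. \<theta> j *\<^sub>R a j y) = s} \<partial>M)
    = \<kappa> * (\<integral>\<^sup>+\<theta>. p \<theta> * emeasure (count_space UNIV) {y\<in>E. (\<Sum>j\<in>J. \<theta> j *\<^sub>R a j y) = 0} \<partial>M)"
proof -
  interpret product_sigma_finite "\<lambda>_::'j. lborel :: real measure" ..
  interpret finite_product_sigma_finite "\<lambda>_::'j. lborel :: real measure" J by standard (rule J)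
  interpret M: sigma_finite_measure M unfolding M_def by (rule sigma_finite_measure_axioms)
  interpret pair_sigma_finite M "lborel :: (real^'n::_) measure" ..
  have Eb[measurable]: "E \<in> sets borel" by (rule fsigma_in_imp_borel[OF E(1)])
  have comp[measurable]: "(\<lambda>\<theta>. \<theta> j) \<in> borel_measurable M" if "j \<in> J" for j
    unfolding M_def using that measurable_component_singleton[of j J "\<lambda>_. lborel :: real measure"] by simp
  have conta: "continuous_on Om (a j)" if "j \<in> J" for j
    by (rule has_derivative_continuous_on) (rule has_derivative_at_withinI, rule der[OF that])
  define L where "L y = Blinfun (\<lambda>z. \<Sum>j\<in>J. (b j \<bullet> z) *\<^sub>R a j y)" for y
  have L: "L y z = (\<Sum>j\<in>J. (b j \<bullet> z) *\<^sub>R a j y)" for y z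
  proof -
    have "linear (\<lambda>z. \<Sum>j\<in>J. (b j \<bullet> z) *\<^sub>R a j y)"
      by (rule linearI) (simp_all add: inner_add_right scaleR_add_left sum.distrib scaleR_sum_right)
    then show ?thesis unfolding L_def by (simp add: bounded_linear_Blinfun_apply linear_conv_bounded_linear)
  qed
  have contL: "continuous_on Om L"
    by (rule continuous_on_blinfun_componentwise) (auto simp: L intro!: continuous_intros conta)
  have invL: "z = 0" if "y \<in> Om" "L y z = 0" for y z using inv that by (simp add: L)
  \<comment> \<open>\<open>L y\<close> is the operator \<open>A(y) B\<close> of the preceding text
    and \<open>R y\<close> is its inverse.\<close>
  obtain R :: "real^'n::_ \<Rightarrow> (real^'n::_) \<Rightarrow>\<^sub>L (real^'n::_)" where contR: "continuous_on Om R" and R: "\<And>y z. y \<in> Om \<Longrightarrow> R y (L y z) = z" "\<And>y z. y \<in> Om \<Longrightarrow> L y (R y z) = z"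
    by (rule continuous_inverse_blinfun[OF contL]) (erule (1) invL, rule that)
  define comb where "comb \<theta> z = (\<lambda>j\<in>J. \<theta> j + b j \<bullet> z)" for \<theta> :: "'j \<Rightarrow> real" and z
  define AA where "AA \<theta> y = (\<Sum>j\<in>J. \<theta> j *\<^sub>R a j y)" for \<theta> :: "'j \<Rightarrow> real" and y
  define N where "N s \<theta> = emeasure (count_space UNIV) {y\<in>E. AA \<theta> y = s}" for s \<theta>
  \<comment> \<open>This is the shift that makes \<open>y\<close> a solution: for \<open>y\<close>
    in \<open>E\<close>, the coefficients \<open>comb \<theta> z\<close> solve the equation at
    \<open>y\<close> exactly when \<open>z = G s \<theta> y\<close>.\<close>
  define G where "G s \<theta> y = R y (s - AA \<theta> y)" for s \<theta> y
  define box where "box = (cbox 0 One :: (real^'n::_) set)"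
  have box[measurable]: "box \<in> sets borel" unfolding box_def by simp
  have box1: "emeasure lborel box = 1" unfolding box_def
    by (subst emeasure_lborel_cbox) auto
  have combJ: "AA (comb \<theta> z) y = AA \<theta> y + L y z" for \<theta> z y
    unfolding AA_def comb_def L by (simp add: scaleR_add_left sum.distrib)
  have combm: "(\<lambda>x. comb (f x) (g x)) \<in> measurable K M" if "f \<in> measurable K M" "g \<in> borel_measurable K" for f g and K :: "'q measure"
  proof -
    have "(\<lambda>x. f x j) \<in> borel_measurable K" if "j \<in> J" for j
      using measurable_compose[OF \<open>f \<in> measurable K M\<close> comp[OF that]] .
    then show ?thesis
      unfolding comb_def M_def using that(2) by (intro measurable_restrict) simp
  qed
  have Nm: "N s \<in> borel_measurable M" for s
  proof -
    have "(\<lambda>\<theta>. emeasure (count_space UNIV) {y\<in>E. AA \<theta> y - s = 0}) \<in> borel_measurable M"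
    proof (rule measurable_count_zeros[OF _ _ E(1)])
      show "(\<lambda>\<theta>. AA \<theta> y - s) \<in> borel_measurable M" for y unfolding AA_def by measurable
      show "continuous_on E (\<lambda>y. AA \<theta> y - s)" for \<theta>
        unfolding AA_def by (intro continuous_intros continuous_on_subset[OF conta E(2)])
    qed
    then show ?thesis unfolding N_def by simp
  qed
  \<comment> \<open>\<open>G s \<theta> y\<close> is affine in \<open>\<theta>\<close>, and the
    matrix of its derivative in \<open>y\<close> is linear in the shifted coefficients. The
    functions \<open>r\<close>, \<open>rs\<close> and \<open>m\<close> are the data of these
    expressions at \<open>y\<close>, set to 0 outside \<open>E\<close> so that the integrand below
    is jointly measurable in \<open>\<theta>\<close> and \<open>y\<close>.\<close>
  define r where "r j y = (if y \<in> E then R y (a j y) else 0)" for j y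
  define rs where "rs s y = (if y \<in> E then R y s else 0)" for s y
  define m where "m j y = (if y \<in> E then - matrix (R y o\<^sub>L a' j y) else 0)" for j y
  have contE: "continuous_on E R" "\<And>j. j \<in> J \<Longrightarrow> continuous_on E (a j)" "\<And>j. j \<in> J \<Longrightarrow> continuous_on E (a' j)"
    using continuous_on_subset[OF contR E(2)] continuous_on_subset[OF conta E(2)] continuous_on_subset[OF cont E(2)] by auto
  have rm[measurable]: "r j \<in> borel_measurable borel" if "j \<in> J" for j
    unfolding r_def by (rule borel_measurable_continuous_on_if) (use contE that Eb in \<open>auto intro!: continuous_intros\<close>)
  have rsm[measurable]: "rs s \<in> borel_measurable borel" for s
    unfolding rs_def by (rule borel_measurable_continuous_on_if) (use contE Eb in \<open>auto intro!: continuous_intros\<close>)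
  have mm[measurable]: "m j \<in> borel_measurable borel" if "j \<in> J" for j
    unfolding m_def
  proof (rule borel_measurable_continuous_on_if)
    show "continuous_on E (\<lambda>y. - matrix (R y o\<^sub>L a' j y))"
      unfolding matrix_def using contE(1) contE(3)[OF that]
      by (intro continuous_on_minus continuous_on_vec_lambda) (auto intro!: continuous_intros)
  qed (use Eb in auto)
  define G' where "G' s \<theta> y = rs s y - (\<Sum>j\<in>J. \<theta> j *\<^sub>R r j y)" for s \<theta> y
  have G'G: "G' s \<theta> y = G s \<theta> y" if "y \<in> E" for s \<theta> y
    using that unfolding G'_def G_def rs_def r_def AA_def
    by (simp add: blinfun.diff_right blinfun.sum_right blinfun.scaleR_right)
  \<comment> \<open>The Kac-Rice integrand: the required shift lies in the cube, the density is
    taken at the shifted coefficients, and the determinant is the Jacobian of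
    \<open>G s \<theta>\<close> at \<open>y\<close>.\<close>
  define Ph where "Ph s \<theta> y = indicator box (G' s \<theta> y) * p (comb \<theta> (G' s \<theta> y)) *
     ennreal \<bar>det (\<Sum>j\<in>J. comb \<theta> (G' s \<theta> y) j *\<^sub>R m j y)\<bar> * indicator E y" for s \<theta> y
  have Phm: "(\<lambda>x. Ph s (fst x) (snd x)) \<in> borel_measurable (M \<Otimes>\<^sub>M lborel)" for s
  proof -
    let ?K = "M \<Otimes>\<^sub>M (lborel :: (real^'n::_) measure)"
    have f: "(\<lambda>x. fst x j) \<in> borel_measurable ?K" if "j \<in> J" for j
      using measurable_compose[OF measurable_fst comp[OF that]] .
    have g: "(\<lambda>x. G' s (fst x) (snd x)) \<in> borel_measurable ?K"
      unfolding G'_def using f rm rsm by (intro borel_measurable_diff borel_measurable_sum borel_measurable_scaleR) (auto intro: measurable_compose[OF measurable_snd])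
    have c: "(\<lambda>x. comb (fst x) (G' s (fst x) (snd x))) \<in> measurable ?K M"
      by (rule combm[OF measurable_fst g])
    have c2: "(\<lambda>x. comb (fst x) (G' s (fst x) (snd x)) j) \<in> borel_measurable ?K" if "j \<in> J" for j
      using measurable_compose[OF c comp[OF that]] .
    have d: "(\<lambda>x. det (\<Sum>j\<in>J. comb (fst x) (G' s (fst x) (snd x)) j *\<^sub>R m j (snd x))) \<in> borel_measurable ?K"
    proof (rule measurable_compose[OF _ borel_measurable_det])
      show "(\<lambda>x. \<Sum>j\<in>J. comb (fst x) (G' s (fst x) (snd x)) j *\<^sub>R m j (snd x)) \<in> borel_measurable ?K"
        using c2 mm by (intro borel_measurable_sum borel_measurable_scaleR) (auto intro: measurable_compose[OF measurable_snd])
    qed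
    have i1: "(\<lambda>x. indicator box (G' s (fst x) (snd x)) :: ennreal) \<in> borel_measurable ?K"
      by (rule measurable_compose[OF g]) simp
    have i2: "(\<lambda>x. indicator E (snd x) :: ennreal) \<in> borel_measurable ?K"
      by (rule measurable_compose[OF measurable_snd]) simp
    show ?thesis unfolding Ph_def
      using i1 i2 d measurable_compose[OF c p] by simp
  qed
  have formula: "(\<integral>\<^sup>+\<theta>. p \<theta> * N s \<theta> \<partial>M) = (\<integral>\<^sup>+y. (\<integral>\<^sup>+\<theta>. Ph s \<theta> y \<partial>M) \<partial>lborel)" for s
  proof -
    \<comment> \<open>The cube has measure 1, so averaging over \<open>z\<close> changes nothing;
      translation invariance then moves the shift by \<open>z\<close> into the coefficients.\<close>
    have pN: "(\<lambda>\<theta>. p \<theta> * N s \<theta>) \<in> borel_measurable M" using p Nm by simp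
    have "(\<integral>\<^sup>+\<theta>. p \<theta> * N s \<theta> \<partial>M) = (\<integral>\<^sup>+z. (\<integral>\<^sup>+\<theta>. p \<theta> * N s \<theta> \<partial>M) * indicator box z \<partial>lborel)"
      by (subst nn_integral_cmult_indicator) (auto simp: box1)
    also have "\<dots> = (\<integral>\<^sup>+z. (\<integral>\<^sup>+\<theta>. p (comb \<theta> z) * N s (comb \<theta> z) * indicator box z \<partial>M) \<partial>lborel)"
    proof (rule nn_integral_cong)
      fix z :: "real^'n::_"
      have "(\<lambda>\<theta>. comb \<theta> z) \<in> measurable M M" by (rule combm) simp_all
      then have pN2: "(\<lambda>\<theta>. p (comb \<theta> z) * N s (comb \<theta> z)) \<in> borel_measurable M"
        by (rule measurable_compose[OF _ pN])
      have "(\<integral>\<^sup>+\<theta>. p \<theta> * N s \<theta> \<partial>M) = (\<integral>\<^sup>+\<theta>. p (comb \<theta> z) * N s (comb \<theta> z) \<partial>M)"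
        using nn_integral_PiM_lborel_shift[OF J pN[unfolded M_def], of "\<lambda>j. b j \<bullet> z"]
        unfolding comb_def M_def by simp
      then show "(\<integral>\<^sup>+\<theta>. p \<theta> * N s \<theta> \<partial>M) * indicator box z = (\<integral>\<^sup>+\<theta>. p (comb \<theta> z) * N s (comb \<theta> z) * indicator box z \<partial>M)"
        using pN2 by (simp add: nn_integral_multc)
    qed
    also have "\<dots> = (\<integral>\<^sup>+\<theta>. (\<integral>\<^sup>+z. p (comb \<theta> z) * N s (comb \<theta> z) * indicator box z \<partial>lborel) \<partial>M)"
    proof (rule Fubini')
      have "(\<lambda>x. comb (fst x) (snd x)) \<in> measurable (M \<Otimes>\<^sub>M (lborel :: (real^'n::_) measure)) M" by (rule combm) simp_all
      from measurable_compose[OF this pN] measurable_compose[OF measurable_snd, of "indicator box" lborel borel M]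
      show "(\<lambda>(\<theta>, z). p (comb \<theta> z) * N s (comb \<theta> z) * indicator box z) \<in> borel_measurable (M \<Otimes>\<^sub>M lborel)"
        by (simp add: case_prod_beta')
    qed
    also have "\<dots> = (\<integral>\<^sup>+\<theta>. (\<integral>\<^sup>+y. Ph s \<theta> y \<partial>lborel) \<partial>M)"
    proof (rule nn_integral_cong)
      fix \<theta> assume th: "\<theta> \<in> space M"
      define D where "D y = R y o\<^sub>L (- (\<Sum>j\<in>J. (\<theta> j + b j \<bullet> G s \<theta> y) *\<^sub>R a' j y))" for y
      have cG: "continuous_on Om (G s \<theta>)" unfolding G_def AA_def
        by (intro continuous_intros contR conta)
      have cD: "continuous_on Om D" unfolding D_def
        by (intro bounded_bilinear.continuous_on[OF bounded_bilinear_blinfun_compose] continuous_intros contR cG cont)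
      have derG: "(G s \<theta> has_derivative D y) (at y)" if y: "y \<in> Om" for y
      proof -
        \<comment> \<open>With the value \<open>z0\<close> at \<open>y\<close> frozen,
          \<open>G s \<theta> x = z0 + R x (K x)\<close> for \<open>x\<close> in \<open>Om\<close>,
          and \<open>K y = 0\<close>. So the derivative at \<open>y\<close> is that of
          \<open>K\<close> followed by \<open>R y\<close>.\<close>
        define z0 where "z0 = G s \<theta> y"
        define K where "K x = s - AA \<theta> x - (\<Sum>j\<in>J. (b j \<bullet> z0) *\<^sub>R a j x)" for x
        have K0: "K y = 0" unfolding K_def z0_def L[symmetric] G_def using R(2)[OF y] by simp
        have "(K has_derivative (\<lambda>h. 0 - (\<Sum>j\<in>J. \<theta> j *\<^sub>R a' j y h) - (\<Sum>j\<in>J. (b j \<bullet> z0) *\<^sub>R a' j y h))) (at y)"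
          unfolding K_def AA_def
          by (intro has_derivative_diff has_derivative_const has_derivative_sum has_derivative_scaleR_right der y)
        also have "(\<lambda>h. 0 - (\<Sum>j\<in>J. \<theta> j *\<^sub>R a' j y h) - (\<Sum>j\<in>J. (b j \<bullet> z0) *\<^sub>R a' j y h)) =
          blinfun_apply (- (\<Sum>j\<in>J. (\<theta> j + b j \<bullet> z0) *\<^sub>R a' j y))"
          by (simp add: fun_eq_iff blinfun.minus_left blinfun.diff_left blinfun.sum_left blinfun.scaleR_left scaleR_add_left sum.distrib)
        finally have K': "(K has_derivative \<dots>) (at y)" .
        have "isCont R y" using contR Om y by (simp add: continuous_on_eq_continuous_at)
        from has_derivative_add[OF has_derivative_const[of z0] has_derivative_blinfun_mult_zero[OF this K' K0]]
        have 1: "((\<lambda>x. z0 + R x (K x)) has_derivative D y) (at y)"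
          unfolding D_def z0_def[symmetric] by (simp only: add_0)
        have 2: "z0 + R x (K x) = G s \<theta> x" if x: "x \<in> Om" for x
          unfolding K_def L[symmetric] G_def by (simp add: blinfun.diff_right R(1)[OF x])
        show ?thesis by (rule has_derivative_transform_within_open[OF 1 Om y]) (rule 2)
      qed
      define h where "h z = indicator box z * p (comb \<theta> z)" for z
      have "(\<lambda>z. comb \<theta> z) \<in> measurable borel M" by (rule combm) (simp_all add: th)
      from measurable_compose[OF this p] have "(\<lambda>z. p (comb \<theta> z)) \<in> borel_measurable borel" .
      then have hm: "h \<in> borel_measurable borel" unfolding h_def by simp
      have cnt: "N s (comb \<theta> z) = emeasure (count_space UNIV) {y\<in>E. G s \<theta> y = z}" for z
      proof -
        have "AA (comb \<theta> z) y = s \<longleftrightarrow> G s \<theta> y = z" if "y \<in> E" for y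
        proof -
          have y: "y \<in> Om" using that E(2) by auto
          have "AA (comb \<theta> z) y = s \<longleftrightarrow> L y z = s - AA \<theta> y" unfolding combJ by (auto simp: algebra_simps)
          also have "\<dots> \<longleftrightarrow> G s \<theta> y = z" unfolding G_def using R[OF y] by metis
          finally show ?thesis .
        qed
        then have "{y\<in>E. AA (comb \<theta> z) y = s} = {y\<in>E. G s \<theta> y = z}" by blast
        then show ?thesis unfolding N_def by simp
      qed
      have "(\<integral>\<^sup>+z. p (comb \<theta> z) * N s (comb \<theta> z) * indicator box z \<partial>lborel) =
         (\<integral>\<^sup>+z. h z * emeasure (count_space UNIV) {y\<in>E. G s \<theta> y = z} \<partial>lborel)"
        unfolding h_def cnt by (intro nn_integral_cong) (simp add: mult_ac)
      also have "\<dots> = (\<integral>\<^sup>+y. h (G s \<theta> y) * ennreal \<bar>det (matrix (D y))\<bar> * indicator E y \<partial>lborel)"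
        by (rule nn_area[OF Om Eb E(2) derG cD hm])
      also have "\<dots> = (\<integral>\<^sup>+y. Ph s \<theta> y \<partial>lborel)"
      proof (rule nn_integral_cong)
        fix y
        have "matrix (D y) = (\<Sum>j\<in>J. comb \<theta> (G' s \<theta> y) j *\<^sub>R m j y)" if y: "y \<in> E"
          using y unfolding D_def m_def G'G[OF y] comb_def
          by (simp add: vec_eq_iff matrix_def blinfun.minus_left blinfun.minus_right blinfun.sum_left blinfun.sum_right blinfun.scaleR_left blinfun.scaleR_right sum_negf)
        then show "h (G s \<theta> y) * ennreal \<bar>det (matrix (D y))\<bar> * indicator E y = Ph s \<theta> y"
          unfolding Ph_def h_def using G'G[of y s \<theta>] by (cases "y \<in> E") simp_all
      qed
      finally show "(\<integral>\<^sup>+z. p (comb \<theta> z) * N s (comb \<theta> z) * indicator box z \<partial>lborel) = (\<integral>\<^sup>+y. Ph s \<theta> y \<partial>lborel)" .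
    qed
    also have "\<dots> = (\<integral>\<^sup>+y. (\<integral>\<^sup>+\<theta>. Ph s \<theta> y \<partial>M) \<partial>lborel)"
      by (rule Fubini'[symmetric]) (use Phm in \<open>simp add: case_prod_beta'\<close>)
    finally show ?thesis .
  qed
  have Phm1: "(\<lambda>\<theta>. Ph s \<theta> y) \<in> borel_measurable M" for s y
  proof -
    have "(\<lambda>\<theta>. (\<theta>, y)) \<in> measurable M (M \<Otimes>\<^sub>M lborel)" by simp
    from measurable_compose[OF this Phm] show ?thesis by simp
  qed
  \<comment> \<open>Adding \<open>\<tau>(y)\<close> to \<open>\<theta>\<close> raises
    \<open>A(y) \<theta>\<close> by \<open>s\<close>, so the shift required for level
    \<open>s\<close> becomes the one for level 0. The second condition on \<open>\<tau>\<close>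
    keeps the Jacobian, and since the coefficients \<open>comb \<theta> z\<close> solve the
    homogeneous equation at \<open>y\<close>, the hypothesis \<open>shift\<close> yields the factor
    \<open>\<kappa>\<close>.\<close>
  have tr: "Ph s (\<lambda>j\<in>J. \<theta> j + \<tau> j y) y = \<kappa> * Ph 0 \<theta> y" if th: "\<theta> \<in> space M" for \<theta> y
  proof (cases "y \<in> E")
    case True
    then have y: "y \<in> Om" using E(2) by auto
    let ?th = "\<lambda>j\<in>J. \<theta> j + \<tau> j y"
    have A1: "AA ?th y = AA \<theta> y + s"
      unfolding AA_def using tau(1)[OF True] by (simp add: scaleR_add_left sum.distrib)
    then have G1: "G' s ?th y = G' 0 \<theta> y" unfolding G'G[OF True] G_def by (simp add: algebra_simps)
    define z where "z = G' 0 \<theta> y"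
    have A0: "AA (comb \<theta> z) y = 0" unfolding combJ z_def G'G[OF True] G_def by (simp add: R(2)[OF y])
    have c1: "comb ?th z = (\<lambda>j\<in>J. comb \<theta> z j + \<tau> j y)" unfolding comb_def by (auto simp: fun_eq_iff)
    have "comb \<theta> z \<in> space M" unfolding comb_def M_def by (simp add: space_PiM)
    then have p1: "p (comb ?th z) = \<kappa> * p (comb \<theta> z)"
      unfolding c1 using shift[OF _ True] A0 unfolding AA_def by blast
    have "(\<Sum>j\<in>J. \<tau> j y *\<^sub>R m j y) = - matrix (R y o\<^sub>L (\<Sum>j\<in>J. \<tau> j y *\<^sub>R a' j y))"
      unfolding m_def using True
      by (simp add: vec_eq_iff matrix_def blinfun.sum_left blinfun.sum_right blinfun.scaleR_left blinfun.scaleR_right sum_negf)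
    also have "\<dots> = 0" unfolding tau(2)[OF True] by (simp add: vec_eq_iff matrix_def)
    finally have m0: "(\<Sum>j\<in>J. \<tau> j y *\<^sub>R m j y) = 0" .
    have "(\<Sum>j\<in>J. comb ?th z j *\<^sub>R m j y) = (\<Sum>j\<in>J. comb \<theta> z j *\<^sub>R m j y)"
      unfolding c1 using m0 by (simp add: scaleR_add_left sum.distrib)
    then show ?thesis unfolding Ph_def G1 z_def[symmetric] p1 by (simp add: mult_ac)
  qed (simp add: Ph_def)
  have "(\<integral>\<^sup>+\<theta>. p \<theta> * N s \<theta> \<partial>M) = (\<integral>\<^sup>+y. (\<integral>\<^sup>+\<theta>. Ph s \<theta> y \<partial>M) \<partial>lborel)" by (rule formula)
  also have "\<dots> = (\<integral>\<^sup>+y. (\<integral>\<^sup>+\<theta>. \<kappa> * Ph 0 \<theta> y \<partial>M) \<partial>lborel)"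
  proof (rule nn_integral_cong)
    \<comment> \<open>With \<open>y\<close> outermost, \<open>\<tau> j y\<close> is constant in the
      inner integral, so translation invariance applies although the shift depends on
      \<open>y\<close>.\<close>
    fix y
    have "(\<integral>\<^sup>+\<theta>. Ph s \<theta> y \<partial>M) = (\<integral>\<^sup>+\<theta>. Ph s (\<lambda>j\<in>J. \<theta> j + \<tau> j y) y \<partial>M)"
      using nn_integral_PiM_lborel_shift[OF J Phm1[unfolded M_def], of s "\<lambda>j. \<tau> j y"] by (simp add: M_def)
    also have "\<dots> = (\<integral>\<^sup>+\<theta>. \<kappa> * Ph 0 \<theta> y \<partial>M)" by (rule nn_integral_cong) (rule tr)
    finally show "(\<integral>\<^sup>+\<theta>. Ph s \<theta> y \<partial>M) = (\<integral>\<^sup>+\<theta>. \<kappa> * Ph 0 \<theta> y \<partial>M)" .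
  qed
  also have "\<dots> = (\<integral>\<^sup>+y. \<kappa> * (\<integral>\<^sup>+\<theta>. Ph 0 \<theta> y \<partial>M) \<partial>lborel)"
    by (simp add: nn_integral_cmult Phm1)
  also have "\<dots> = \<kappa> * (\<integral>\<^sup>+y. (\<integral>\<^sup>+\<theta>. Ph 0 \<theta> y \<partial>M) \<partial>lborel)"
  proof (rule nn_integral_cmult)
    have "(\<lambda>x. Ph 0 (snd x) (fst x)) \<in> borel_measurable (lborel \<Otimes>\<^sub>M M)"
      using measurable_compose[OF measurable_pair_swap' Phm[of 0]] by (simp add: case_prod_beta')
    then show "(\<lambda>y. \<integral>\<^sup>+\<theta>. Ph 0 \<theta> y \<partial>M) \<in> borel_measurable lborel"
      by (intro M.borel_measurable_nn_integral) (simp add: case_prod_beta')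
  qed
  also have "\<dots> = \<kappa> * (\<integral>\<^sup>+\<theta>. p \<theta> * N 0 \<theta> \<partial>M)" by (simp only: formula)
  finally show ?thesis unfolding N_def AA_def .
qed

subsection \<open>Parametrizations of hypersurfaces\<close>

text \<open>The derivative is a continuous map into bounded linear operators, the form in which the
  inverse function theorem and \<open>nn_area\<close> take it. Derivatives are those in the whole
  space, so \<open>S\<close> is meant to be open.\<close>

definition C1_on :: "('e::real_normed_vector \<Rightarrow> 'b::real_normed_vector) \<Rightarrow> 'e set \<Rightarrow> bool" where
  "C1_on f S \<longleftrightarrow> (\<exists>f'. (\<forall>x\<in>S. (f has_derivative blinfun_apply (f' x)) (at x)) \<and> continuous_on S f')"

lemma C1_onI:
  "(\<And>x. x \<in> S \<Longrightarrow> (f has_derivative blinfun_apply (f' x)) (at x)) \<Longrightarrow> continuous_on S f' \<Longrightarrow> C1_on f S"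
  unfolding C1_on_def by blast

lemma C1_onE:
  assumes "C1_on f S"
  obtains f' where "\<And>x. x \<in> S \<Longrightarrow> (f has_derivative blinfun_apply (f' x)) (at x)" "continuous_on S f'"
  using assms unfolding C1_on_def by blast

lemma C1_on_subset: "C1_on f S \<Longrightarrow> T \<subseteq> S \<Longrightarrow> C1_on f T"
  unfolding C1_on_def by (meson continuous_on_subset subsetD)

lemma C1_on_continuous: "C1_on f S \<Longrightarrow> continuous_on S f"
  unfolding C1_on_def by (meson continuous_at_imp_continuous_on has_derivative_continuous)

lemma C1_on_cong:
  assumes "C1_on f S" "open S" "\<And>x. x \<in> S \<Longrightarrow> g x = f x"
  shows "C1_on g S"
proof -
  obtain f' where f': "\<And>x. x \<in> S \<Longrightarrow> (f has_derivative blinfun_apply (f' x)) (at x)" "continuous_on S f'"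
    using assms(1) by (rule C1_onE) (rule that)
  have "(g has_derivative blinfun_apply (f' x)) (at x)" if "x \<in> S" for x
    by (rule has_derivative_transform_within_open[OF f'(1)[OF that] assms(2) that]) (simp add: assms(3))
  then show ?thesis using f'(2) by (rule C1_onI)
qed

lemma C1_on_compose:
  assumes f: "C1_on f S" and g: "C1_on g T" and sub: "f ` S \<subseteq> T"
  shows "C1_on (g \<circ> f) S"
proof -
  obtain f' where f': "\<And>x. x \<in> S \<Longrightarrow> (f has_derivative blinfun_apply (f' x)) (at x)" "continuous_on S f'"
    using f by (rule C1_onE) (rule that)
  obtain g' where g': "\<And>x. x \<in> T \<Longrightarrow> (g has_derivative blinfun_apply (g' x)) (at x)" "continuous_on T g'"
    using g by (rule C1_onE) (rule that)
  show ?thesis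
  proof (rule C1_onI)
    show "((g \<circ> f) has_derivative blinfun_apply (g' (f x) o\<^sub>L f' x)) (at x)" if "x \<in> S" for x
    proof -
      have "(g has_derivative blinfun_apply (g' (f x))) (at (f x))" using g'(1) sub that by blast
      from diff_chain_at[OF f'(1)[OF that] this] show ?thesis
        by (simp add: o_def[of "blinfun_apply _"] flip: blinfun_apply_blinfun_compose)
    qed
    have "continuous_on S (\<lambda>x. g' (f x))"
      using continuous_on_compose2[OF g'(2) C1_on_continuous[OF f] sub] .
    then show "continuous_on S (\<lambda>x. g' (f x) o\<^sub>L f' x)"
      by (rule bounded_bilinear.continuous_on[OF bounded_bilinear_blinfun_compose _ f'(2)])
  qed
qed

text \<open>\<open>Ck_on\<close> at order 1 gives continuity of each directional derivative; in
  finite dimension this is continuity in the operator norm.\<close>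

lemma smooth_on_imp_C1_on:
  fixes f :: "'e::euclidean_space \<Rightarrow> 'b::real_normed_vector"
  assumes "smooth_on f S"
  shows "C1_on f S"
proof (rule C1_onI)
  have "Ck_on (Suc 0) f S" using assms unfolding smooth_on_def by blast
  then have d: "\<And>x. x \<in> S \<Longrightarrow> f differentiable (at x)"
    and c: "\<And>v. continuous_on S (\<lambda>x. frechet_derivative f (at x) v)" by auto
  have bl: "blinfun_apply (Blinfun (frechet_derivative f (at x))) = frechet_derivative f (at x)" if "x \<in> S" for x
    using d[OF that] by (simp add: bounded_linear_Blinfun_apply frechet_derivative_works has_derivative_bounded_linear)
  show "(f has_derivative blinfun_apply (Blinfun (frechet_derivative f (at x)))) (at x)" if "x \<in> S" for x
    using d[OF that] bl[OF that] by (simp add: frechet_derivative_works)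
  have "continuous_on S (\<lambda>x. blinfun_apply (Blinfun (frechet_derivative f (at x))) v)" for v
    by (rule continuous_on_cong[THEN iffD1, OF refl _ c[of v]]) (simp add: bl)
  then show "continuous_on S (\<lambda>x. Blinfun (frechet_derivative f (at x)))"
    by (intro continuous_on_blinfun_componentwise)
qed

text \<open>The map \<open>H y = y + (f y - y \<bullet> b) b\<close> replaces the \<open>b\<close>-coordinate by the value of \<open>f\<close>, so its local
  inverse straightens the level sets of \<open>f\<close>.\<close>

lemma C1_level_set_straightening:
  fixes f :: "'e::euclidean_space \<Rightarrow> real"
  assumes "open V" and f: "C1_on f V" and y0: "y0 \<in> V"
    and D: "(f has_derivative D) (at y0)" and "D v \<noteq> 0"
  obtains b U W and H k :: "'e \<Rightarrow> 'e" where "b \<in> Basis" "open U" "U \<subseteq> V" "y0 \<in> U" "open W" "C1_on k W" "k ` W = U"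
    "continuous_on U H" "\<And>w. w \<in> W \<Longrightarrow> H (k w) = w"
    "\<And>w. w \<in> W \<Longrightarrow> f (k w) = w \<bullet> b"
proof -
  obtain f' where f': "\<And>x. x \<in> V \<Longrightarrow> (f has_derivative blinfun_apply (f' x)) (at x)" "continuous_on V f'"
    using f by (rule C1_onE) (rule that)
  have Df: "D = blinfun_apply (f' y0)" using has_derivative_unique[OF D f'(1)[OF y0]] .
  obtain b where b: "b \<in> Basis" "f' y0 b \<noteq> 0"
  proof (rule ccontr)
    assume n: "\<not> thesis"
    have "f' y0 v = (\<Sum>i\<in>Basis. (v \<bullet> i) * f' y0 i)"
      by (subst euclidean_representation[of v, symmetric]) (simp add: blinfun.sum_right blinfun.scaleR_right)
    also have "\<dots> = 0" using n that by (intro sum.neutral) auto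
    finally show False using \<open>D v \<noteq> 0\<close> Df by simp
  qed
  define H where "H y = y + (f y - y \<bullet> b) *\<^sub>R b" for y
  define H' where "H' y = id_blinfun + (blinfun_scaleR_left b o\<^sub>L (f' y - blinfun_inner_left b))" for y
  have H'v: "H' y w = w + (f' y w - w \<bullet> b) *\<^sub>R b" for y w
    unfolding H'_def by (simp add: blinfun.add_left blinfun.diff_left inner_commute)
  \<comment> \<open>The explicit inverse of \<open>H' y\<close>: the part of \<open>H' y w\<close>
    orthogonal to \<open>b\<close> is that of \<open>w\<close>, its \<open>b\<close>-coordinate is
    \<open>f' y w\<close>, and the two determine \<open>w \<bullet> b\<close> when
    \<open>f' y b \<noteq> 0\<close>. The formula makes the derivative of the inverse map visibly
    continuous.\<close>
  define Q where "Q y w = (w - (w \<bullet> b) *\<^sub>R b) + ((w \<bullet> b - f' y (w - (w \<bullet> b) *\<^sub>R b)) / f' y b) *\<^sub>R b" for y w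
  have bb: "b \<bullet> b = 1" using b(1) by simp
  have Q: "Q y (H' y w) = w" if "f' y b \<noteq> 0" for y w
  proof -
    have i: "H' y w \<bullet> b = f' y w" unfolding H'v by (simp add: inner_add_left bb)
    have P: "H' y w - (H' y w \<bullet> b) *\<^sub>R b = w - (w \<bullet> b) *\<^sub>R b"
      unfolding i by (simp add: H'v algebra_simps)
    show ?thesis unfolding Q_def P unfolding i using that
      by (simp add: blinfun.diff_right blinfun.scaleR_right)
  qed
  have blQ: "bounded_linear (Q y)" for y
    unfolding Q_def linear_conv_bounded_linear[symmetric]
    by (rule linearI) (simp_all add: inner_add_left blinfun.add_right blinfun.diff_right blinfun.scaleR_right algebra_simps add_divide_distrib diff_divide_distrib)
  have derH: "(H has_derivative blinfun_apply (H' y)) (at y)" if "y \<in> V" for y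
    unfolding H_def H'v
    by (auto intro!: derivative_eq_intros f'(1)[OF that] simp: algebra_simps)
  have contH': "continuous_on V H'"
    unfolding H'_def
    by (intro continuous_intros bounded_bilinear.continuous_on[OF bounded_bilinear_blinfun_compose] f'(2))
  have inv0: "Blinfun (Q y0) o\<^sub>L H' y0 = id_blinfun"
    by (rule blinfun_eqI) (simp add: bounded_linear_Blinfun_apply[OF blQ] Q[OF b(2)])
  obtain U W k k' where U: "open U" "U \<subseteq> V" "y0 \<in> U" "open W" "homeomorphism U W H k"
    "\<And>y. y \<in> W \<Longrightarrow> (k has_derivative (k' y)) (at y)"
    "\<And>y. y \<in> W \<Longrightarrow> k' y = inv (blinfun_apply (H' (k y)))"
    "\<And>y. y \<in> W \<Longrightarrow> bij (blinfun_apply (H' (k y)))"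
    using inverse_function_theorem[OF \<open>open V\<close> derH contH' y0 inv0] by metis
  have kW: "k ` W = U" and kc: "continuous_on W k" and Hk: "\<And>w. w \<in> W \<Longrightarrow> H (k w) = w"
    using U(5) by (auto simp: homeomorphism_def)
  \<comment> \<open>Bijectivity of the derivative on all of \<open>W\<close> forces this: otherwise
    \<open>b\<close> would lie in the kernel of \<open>H' (k w)\<close>.\<close>
  have nz: "f' (k w) b \<noteq> 0" if "w \<in> W" for w
  proof
    assume "f' (k w) b = 0"
    then have "H' (k w) b = 0" unfolding H'v by (simp add: bb)
    then have "H' (k w) b = H' (k w) 0" by (simp add: blinfun.zero_right)
    then have "b = 0" using U(8)[OF that] by (meson bij_is_inj injD)
    then show False using bb by simp
  qed
  have k'Q: "k' w = Q (k w)" if "w \<in> W" for w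
    unfolding U(7)[OF that]
    by (rule inv_unique_comp[symmetric] | rule ext)+ (metis Q[OF nz[OF that]] U(8)[OF that] bij_inv_eq_iff)
  have C1k: "C1_on k W"
  proof (rule C1_onI)
    show "(k has_derivative blinfun_apply (Blinfun (Q (k w)))) (at w)" if "w \<in> W" for w
      using U(6)[OF that] unfolding k'Q[OF that] by (simp add: bounded_linear_Blinfun_apply[OF blQ])
    have c: "continuous_on W (\<lambda>w. f' (k w))"
      using continuous_on_compose2[OF f'(2) kc] kW U(2) by auto
    show "continuous_on W (\<lambda>w. Blinfun (Q (k w)))"
    proof (rule continuous_on_blinfun_componentwise)
      fix i :: 'e assume "i \<in> Basis"
      show "continuous_on W (\<lambda>w. blinfun_apply (Blinfun (Q (k w))) i)"
        unfolding bounded_linear_Blinfun_apply[OF blQ] Q_def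
        by (intro continuous_intros c) (use nz in auto)
    qed
  qed
  have "f (k w) = w \<bullet> b" if "w \<in> W" for w
  proof -
    have "H (k w) \<bullet> b = f (k w)" unfolding H_def by (simp add: inner_add_left bb)
    then show ?thesis using Hk[OF that] by simp
  qed
  moreover have "continuous_on U H" using U(5) by (simp add: homeomorphism_def)
  ultimately show ?thesis using that[OF b(1) U(1-4) C1k kW] Hk by blast
qed

lemma ex_linear_parametrization_hyperplane:
  fixes b :: "'e::euclidean_space"
  assumes b: "b \<in> Basis" and dim: "DIM('e) > 1"
  obtains i :: "(real^('e hyper)) \<Rightarrow>\<^sub>L 'e" and i' where "continuous_on UNIV i'" "\<And>z. i' (blinfun_apply i z) = z" "range (blinfun_apply i) = {w. w \<bullet> b = 0}"
proof -
  have "card (Basis - {b}) = CARD('e hyper)" using b CARD_hyper[OF dim] by simp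
  then obtain \<beta> :: "'e hyper \<Rightarrow> 'e" where \<beta>: "bij_betw \<beta> UNIV (Basis - {b})"
    by (metis finite_same_card_bij finite_Basis finite_Diff finite)
  have \<beta>B: "\<beta> j \<in> Basis" "\<beta> j \<noteq> b" for j using \<beta> by (auto simp: bij_betw_def)
  have \<beta>\<beta>: "\<beta> i \<bullet> \<beta> j = (if i = j then 1 else 0)" for i j
    using \<beta>B \<beta> by (auto simp: inner_Basis bij_betw_def dest: injD)
  define i where "i = Blinfun (\<lambda>z. \<Sum>j\<in>UNIV. (z $ j) *\<^sub>R \<beta> j)"
  have i: "i z = (\<Sum>j\<in>UNIV. (z $ j) *\<^sub>R \<beta> j)" for z
  proof -
    have "linear (\<lambda>z. \<Sum>j\<in>UNIV. (z $ j) *\<^sub>R \<beta> j)"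
      by (rule linearI) (simp_all add: scaleR_add_left sum.distrib scaleR_sum_right)
    then show ?thesis unfolding i_def by (simp add: bounded_linear_Blinfun_apply linear_conv_bounded_linear)
  qed
  have comp: "i z \<bullet> \<beta> j = z $ j" for z j
    unfolding i by (simp add: inner_sum_left \<beta>\<beta> if_distrib cong: if_cong)
  have "continuous_on UNIV (\<lambda>w. \<chi> j. w \<bullet> \<beta> j)" by (intro continuous_intros)
  moreover have "(\<chi> j. i z \<bullet> \<beta> j) = z" for z by (simp add: comp)
  moreover have "range i = {w. w \<bullet> b = 0}"
  proof safe
    show "i z \<bullet> b = 0" for z
      unfolding i using \<beta>B b by (simp add: inner_sum_left inner_Basis)
    fix w assume w: "w \<bullet> b = 0"
    have "w = (\<Sum>c\<in>Basis. (w \<bullet> c) *\<^sub>R c)" by (simp add: euclidean_representation)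
    also have "\<dots> = (\<Sum>c\<in>Basis - {b}. (w \<bullet> c) *\<^sub>R c)" using w b by (simp add: sum.remove)
    also have "\<dots> = (\<Sum>j\<in>UNIV. (w \<bullet> \<beta> j) *\<^sub>R \<beta> j)"
      using sum.reindex_bij_betw[OF \<beta>, of "\<lambda>c. (w \<bullet> c) *\<^sub>R c"] by simp
    also have "\<dots> = i (\<chi> j. w \<bullet> \<beta> j)" unfolding i by simp
    finally show "w \<in> range i" by blast
  qed
  ultimately show ?thesis by (rule that)
qed

definition C1_on_open ::
    "('a::topological_space set \<times> ('a \<Rightarrow> 'e::euclidean_space)) set \<Rightarrow> ('a \<Rightarrow> real) \<Rightarrow> 'a set \<Rightarrow> bool" where
  "C1_on_open A g V \<longleftrightarrow> (\<forall>(D, \<phi>)\<in>A. C1_on (g \<circ> inv_into D \<phi>) (\<phi> ` (D \<inter> V)))"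

text \<open>The first-order counterpart of \<open>smooth_funs\<close>, without its normalization by
  0 outside \<open>S\<close>, so that it applies directly to functions given on the whole
  manifold.\<close>

definition C1_along ::
    "('a::topological_space set \<times> ('a \<Rightarrow> 'e::euclidean_space)) set \<Rightarrow> 'a set \<Rightarrow> ('a \<Rightarrow> real) \<Rightarrow> bool" where
  "C1_along A S f \<longleftrightarrow> (\<forall>x\<in>S. \<exists>V g. open V \<and> x \<in> V \<and> C1_on_open A g V \<and> (\<forall>y\<in>V \<inter> S. g y = f y))"

lemma smooth_on_open_imp_C1: "smooth_on_open A g V \<Longrightarrow> C1_on_open A g V"
  unfolding smooth_on_open_def C1_on_open_def by (auto intro: smooth_on_imp_C1_on)

text \<open>No smooth structure on \<open>S\<close> is constructed. What is later used of one is the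
  last clause: functions with local C1 extensions to the manifold become C1 in the parameter. The
  extension \<open>g\<close> is controlled only on \<open>V\<close>, hence the restriction to its
  preimage.\<close>

definition parametrization ::
    "('a::topological_space set \<times> ('a \<Rightarrow> 'e::euclidean_space)) set \<Rightarrow> 'a set \<Rightarrow> ('n::euclidean_space) set \<Rightarrow> ('n \<Rightarrow> 'a) \<Rightarrow> bool" where
  "parametrization A S Om \<psi> \<longleftrightarrow> open Om \<and> openin (top_of_set S) (\<psi> ` Om) \<and> (\<exists>\<gamma>. homeomorphism Om (\<psi> ` Om) \<psi> \<gamma>) \<and>
     (\<forall>g V. open V \<and> C1_on_open A g V \<longrightarrow> C1_on (g \<circ> \<psi>) (Om \<inter> \<psi> -` V))"

text \<open>The implicit function theorem in a chart: after straightening, the zero set of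
  \<open>q\<close> is the hyperplane where the \<open>b\<close>-coordinate vanishes, and that
  hyperplane is identified with \<open>real^('e hyper)\<close>.\<close>

lemma ex_parametrization_level_set:
  fixes A :: "('a::{t2_space,second_countable_topology} set \<times> ('a \<Rightarrow> 'e::euclidean_space)) set"
    and q :: "'a \<Rightarrow> real"
  assumes A: "smooth_atlas A" and dim: "DIM('e) > 1"
    and q: "\<And>D \<phi>. (D, \<phi>) \<in> A \<Longrightarrow> C1_on (q \<circ> inv_into D \<phi>) (\<phi> ` D)"
    and reg: "\<And>x D \<phi> d. q x = 0 \<Longrightarrow> (D, \<phi>) \<in> A \<Longrightarrow> x \<in> D \<Longrightarrow>
        (q \<circ> inv_into D \<phi> has_derivative d) (at (\<phi> x)) \<Longrightarrow> \<exists>v. d v \<noteq> 0"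
    and S: "S = {x. q x = 0}" and x: "x \<in> S"
  obtains Om :: "(real^('e hyper)) set" and \<psi> where "parametrization A S Om \<psi>" "x \<in> \<psi> ` Om"
proof -
  obtain D \<phi> where D: "(D, \<phi>) \<in> A" "x \<in> D"
  proof -
    have "x \<in> (\<Union>(D, \<phi>)\<in>A. D)" using A unfolding smooth_atlas_def by simp
    then show ?thesis using that by auto
  qed
  have Dh: "open D" "open (\<phi> ` D)" "homeomorphism D (\<phi> ` D) \<phi> (inv_into D \<phi>)"
    using A D(1) unfolding smooth_atlas_def by auto
  let ?\<phi>i = "inv_into D \<phi>"
  let ?f = "q \<circ> ?\<phi>i"
  have \<phi>i: "\<And>y. y \<in> D \<Longrightarrow> ?\<phi>i (\<phi> y) = y" "\<And>z. z \<in> \<phi> ` D \<Longrightarrow> \<phi> (?\<phi>i z) = z" "\<And>z. z \<in> \<phi> ` D \<Longrightarrow> ?\<phi>i z \<in> D"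
    "continuous_on D \<phi>" "continuous_on (\<phi> ` D) ?\<phi>i"
    using Dh(3) unfolding homeomorphism_def by auto
  have y0: "\<phi> x \<in> \<phi> ` D" using D(2) by simp
  obtain f' where f': "(?f has_derivative blinfun_apply f') (at (\<phi> x))"
    using q[OF D(1)] y0 by (meson C1_onE)
  obtain v where v: "blinfun_apply f' v \<noteq> 0" using reg[OF _ D f'] x S by auto
  obtain b U W and H k :: "'e \<Rightarrow> 'e" where k: "b \<in> Basis" "open U" "U \<subseteq> \<phi> ` D" "\<phi> x \<in> U" "open W" "C1_on k W" "k ` W = U"
    "continuous_on U H" and Hk: "\<And>w. w \<in> W \<Longrightarrow> H (k w) = w" and fk:
    "\<And>w. w \<in> W \<Longrightarrow> ?f (k w) = w \<bullet> b"
    using C1_level_set_straightening[OF Dh(2) q[OF D(1)] y0 f' v] by metis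
  obtain i :: "(real^('e hyper)) \<Rightarrow>\<^sub>L 'e" and i' where i: "continuous_on UNIV i'" "range (blinfun_apply i) = {w. w \<bullet> b = 0}" and i'i: "\<And>z. i' (blinfun_apply i z) = z"
    using ex_linear_parametrization_hyperplane[OF k(1) dim] by metis
  define Om where "Om = blinfun_apply i -` W"
  define \<psi> where "\<psi> = ?\<phi>i \<circ> (k \<circ> blinfun_apply i)"
  have Omo: "open Om" unfolding Om_def
    by (rule open_vimage[OF k(5)]) (intro continuous_intros)
  have ki: "C1_on (k \<circ> blinfun_apply i) Om"
  proof (rule C1_on_compose[OF _ k(6)])
    show "C1_on (blinfun_apply i) Om"
      by (rule C1_onI[of _ _ "\<lambda>_. i"]) (auto intro: bounded_linear_imp_has_derivative blinfun.bounded_linear_right)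
  qed (auto simp: Om_def)
  have kiU: "(k \<circ> blinfun_apply i) z \<in> U" if "z \<in> Om" for z using that k(7) by (auto simp: Om_def)
  have \<psi>D: "\<psi> z \<in> D" "\<phi> (\<psi> z) = (k \<circ> blinfun_apply i) z" if "z \<in> Om" for z
    using kiU[OF that] k(3) \<phi>i(2,3) by (auto simp: \<psi>_def)
  have c\<psi>: "continuous_on Om \<psi>" unfolding \<psi>_def
    by (rule continuous_on_compose[OF C1_on_continuous[OF ki]])
      (rule continuous_on_subset[OF \<phi>i(5)], use kiU k(3) in blast)
  \<comment> \<open>Every zero of \<open>q\<close> in the straightened neighbourhood is reached, so
    the image is the intersection of \<open>S\<close> with an open set.\<close>
  have img: "\<psi> ` Om = S \<inter> (D \<inter> \<phi> -` U)"
  proof (intro equalityI subsetI)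
    fix u assume "u \<in> \<psi> ` Om"
    then obtain z where z: "z \<in> Om" "u = \<psi> z" by blast
    have "q u = ?f (k (i z))" unfolding z(2) \<psi>_def by simp
    also have "\<dots> = i z \<bullet> b" using z(1) fk by (simp add: Om_def)
    also have "\<dots> = 0" using i(2) by auto
    finally show "u \<in> S \<inter> (D \<inter> \<phi> -` U)" using \<psi>D[OF z(1)] kiU[OF z(1)] z(2) S by simp
  next
    fix u assume u: "u \<in> S \<inter> (D \<inter> \<phi> -` U)"
    then obtain w where w: "w \<in> W" "\<phi> u = k w" using k(7) by (metis IntD2 image_iff vimageD)
    have uu: "u = ?\<phi>i (k w)" using u \<phi>i(1) w(2) by (metis IntD1 IntD2)
    have "w \<bullet> b = ?f (k w)" using fk w(1) by simp
    also have "\<dots> = 0" using uu u S by simp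
    finally obtain z where "w = i z" using i(2) by (metis (mono_tags, lifting) mem_Collect_eq rangeE)
    then show "u \<in> \<psi> ` Om" using w uu by (auto simp: \<psi>_def Om_def)
  qed
  have Vo: "open (D \<inter> \<phi> -` U)"
    using continuous_open_preimage[OF \<phi>i(4) Dh(1) k(2)] .
  have c\<gamma>: "continuous_on (\<psi> ` Om) (i' \<circ> (H \<circ> \<phi>))"
  proof (intro continuous_on_compose)
    show "continuous_on (\<psi> ` Om) \<phi>" by (rule continuous_on_subset[OF \<phi>i(4)]) (use \<psi>D in blast)
    show "continuous_on (\<phi> ` \<psi> ` Om) H" by (rule continuous_on_subset[OF k(8)]) (use \<psi>D kiU in auto)
    show "continuous_on ((H \<circ> \<phi>) ` \<psi> ` Om) i'" by (rule continuous_on_subset[OF i(1)]) simp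
  qed
  have \<gamma>\<psi>: "(i' \<circ> (H \<circ> \<phi>)) (\<psi> z) = z" if "z \<in> Om" for z
    using \<psi>D(2)[OF that] that by (simp add: Om_def Hk i'i)
  have hom: "homeomorphism Om (\<psi> ` Om) \<psi> (i' \<circ> (H \<circ> \<phi>))"
    using c\<psi> c\<gamma> \<gamma>\<psi> by (intro homeomorphismI) (auto simp: image_iff)
  have "parametrization A S Om \<psi>"
    unfolding parametrization_def
  proof (intro conjI allI impI)
    show "openin (top_of_set S) (\<psi> ` Om)" unfolding img using Vo by (rule openin_open_Int)
    fix g V assume g: "open V \<and> C1_on_open A g V"
    then have "C1_on (g \<circ> ?\<phi>i) (\<phi> ` (D \<inter> V))"
      using D(1) unfolding C1_on_open_def by auto
    moreover have "(k \<circ> blinfun_apply i) ` (Om \<inter> \<psi> -` V) \<subseteq> \<phi> ` (D \<inter> V)"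
    proof
      fix u assume "u \<in> (k \<circ> blinfun_apply i) ` (Om \<inter> \<psi> -` V)"
      then obtain z where z: "z \<in> Om" "\<psi> z \<in> V" "u = (k \<circ> blinfun_apply i) z" by blast
      then show "u \<in> \<phi> ` (D \<inter> V)" using \<psi>D[OF z(1)] by (metis IntI imageI)
    qed
    ultimately have "C1_on ((g \<circ> ?\<phi>i) \<circ> (k \<circ> blinfun_apply i)) (Om \<inter> \<psi> -` V)"
      by (intro C1_on_compose[OF C1_on_subset[OF ki]]) auto
    then show "C1_on (g \<circ> \<psi>) (Om \<inter> \<psi> -` V)" unfolding \<psi>_def by (simp add: comp_assoc)
  qed (use Omo hom in auto)
  moreover have "x \<in> \<psi> ` Om" unfolding img using x D(2) k(4) by simp
  ultimately show ?thesis by (rule that)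
qed

lemma parametrization_restrict:
  assumes P: "parametrization A S Om \<psi>" and T: "open T" "T \<subseteq> Om"
  shows "parametrization A S T \<psi>"
proof -
  obtain \<gamma> where \<gamma>: "homeomorphism Om (\<psi> ` Om) \<psi> \<gamma>" using P unfolding parametrization_def by blast
  have img: "\<psi> ` T = \<psi> ` Om \<inter> \<gamma> -` T"
  proof (intro equalityI subsetI)
    fix u assume "u \<in> \<psi> ` T"
    then obtain z where "z \<in> T" "u = \<psi> z" by blast
    then show "u \<in> \<psi> ` Om \<inter> \<gamma> -` T" using \<gamma> T(2) by (auto simp: homeomorphism_def)
  next
    fix u assume "u \<in> \<psi> ` Om \<inter> \<gamma> -` T"
    then show "u \<in> \<psi> ` T" using \<gamma> unfolding homeomorphism_def by (metis IntD1 IntD2 imageI vimageD)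
  qed
  have "openin (top_of_set (\<psi> ` Om)) (\<psi> ` T)"
    unfolding img using \<gamma> T(1) by (intro continuous_openin_preimage_gen) (simp_all add: homeomorphism_def)
  then have "openin (top_of_set S) (\<psi> ` T)"
    using P openin_trans unfolding parametrization_def by blast
  moreover have "homeomorphism T (\<psi> ` T) \<psi> \<gamma>"
    by (rule homeomorphism_of_subsets[OF \<gamma> T(2)]) (auto simp: T(2) image_mono)
  moreover have "C1_on (g \<circ> \<psi>) (T \<inter> \<psi> -` V)" if "open V \<and> C1_on_open A g V" for g V
    by (rule C1_on_subset[of _ "Om \<inter> \<psi> -` V"]) (use P that T(2) in \<open>auto simp: parametrization_def\<close>)
  ultimately show ?thesis using T(1) unfolding parametrization_def by blast
qed

lemma parametrization_continuous: "parametrization A S Om \<psi> \<Longrightarrow> continuous_on Om \<psi>"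
  and parametrization_inj: "parametrization A S Om \<psi> \<Longrightarrow> inj_on \<psi> Om"
  and parametrization_open: "parametrization A S Om \<psi> \<Longrightarrow> open Om"
  and parametrization_openin: "parametrization A S Om \<psi> \<Longrightarrow> openin (top_of_set S) (\<psi> ` Om)"
  unfolding parametrization_def homeomorphism_def by (auto intro: inj_on_inverseI)

lemma parametrization_subset: "parametrization A S Om \<psi> \<Longrightarrow> \<psi> ` Om \<subseteq> S"
  using parametrization_openin openin_imp_subset by blast

text \<open>Induction on the finite family: each new function has a C1 extension near
  \<open>x\<close>, and the parameter domain is shrunk to the preimage of the neighbourhood on which
  that extension lives.\<close>

lemma ex_parametrization_C1:
  assumes par: "\<exists>Om \<psi>. parametrization A S (Om :: ('n::euclidean_space) set) \<psi> \<and> x \<in> \<psi> ` Om"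
    and x: "x \<in> S" and F: "finite F" "\<forall>f\<in>F. C1_along A S f"
  shows "\<exists>Om \<psi>. parametrization A S (Om :: 'n set) \<psi> \<and> x \<in> \<psi> ` Om \<and> (\<forall>f\<in>F. C1_on (f \<circ> \<psi>) Om)"
  using F
proof (induction F rule: finite_induct)
  case empty
  then show ?case using par by simp
next
  case (insert f F)
  then obtain Om \<psi> where P: "parametrization A S (Om :: 'n set) \<psi>" "x \<in> \<psi> ` Om" "\<forall>f\<in>F. C1_on (f \<circ> \<psi>) Om"
    using insert.IH insert.prems by blast
  have f: "C1_along A S f" using insert.prems by simp
  from f[unfolded C1_along_def, THEN bspec, OF x]
  obtain V g where g: "open V" "x \<in> V" "C1_on_open A g V" "\<forall>y\<in>V \<inter> S. g y = f y"
    by (elim exE conjE) (rule that)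
  define T where "T = Om \<inter> \<psi> -` V"
  have To: "open T" unfolding T_def
    using continuous_open_preimage[OF parametrization_continuous parametrization_open] P(1) g(1) by blast
  have PT: "parametrization A S T \<psi>" by (rule parametrization_restrict[OF P(1) To]) (simp add: T_def)
  have gT: "C1_on (g \<circ> \<psi>) T" using P(1) g unfolding parametrization_def T_def by blast
  have fg: "f (\<psi> y) = g (\<psi> y)" if "y \<in> T" for y
  proof -
    have "\<psi> y \<in> S" using parametrization_subset[OF PT] that by blast
    moreover have "\<psi> y \<in> V" using that by (simp add: T_def)
    ultimately show ?thesis using g(4) by simp
  qed
  have "C1_on (f \<circ> \<psi>) T"
    by (rule C1_on_cong[OF gT To]) (simp add: fg)
  moreover have "C1_on (f' \<circ> \<psi>) T" if "f' \<in> F" for f'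
    using P(3) that by (auto intro: C1_on_subset simp: T_def)
  moreover have "x \<in> \<psi> ` T" using P(2) g(2) by (auto simp: T_def)
  ultimately show ?case using PT by blast
qed

lemma emeasure_count_space_image:
  assumes "inj_on f B"
  shows "emeasure (count_space UNIV) (f ` B) = emeasure (count_space UNIV) B"
  using assms by (simp add: emeasure_count_space card_image finite_image_iff)

lemma C1_on_vec:
  fixes f :: "'e::euclidean_space \<Rightarrow> real^'n"
  assumes "\<And>i. C1_on (\<lambda>x. f x $ i) S"
  shows "C1_on f S"
proof -
  have "\<forall>i. \<exists>d. (\<forall>x\<in>S. ((\<lambda>x. f x $ i) has_derivative blinfun_apply (d x)) (at x)) \<and> continuous_on S d"
    using assms unfolding C1_on_def by blast
  then obtain d where d: "\<And>i x. x \<in> S \<Longrightarrow> ((\<lambda>x. f x $ i) has_derivative blinfun_apply (d i x)) (at x)"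
    "\<And>i. continuous_on S (d i)" by (rule choice[THEN exE]) blast
  define D where "D x = Blinfun (\<lambda>v. \<chi> i. blinfun_apply (d i x) v)" for x
  have D: "blinfun_apply (D x) = (\<lambda>v. \<chi> i. blinfun_apply (d i x) v)" for x
  proof -
    have "linear (\<lambda>v. \<chi> i. blinfun_apply (d i x) v)"
      by (rule linearI) (simp_all add: vec_eq_iff blinfun.add_right blinfun.scaleR_right)
    then show ?thesis unfolding D_def by (simp add: bounded_linear_Blinfun_apply linear_conv_bounded_linear)
  qed
  show ?thesis
  proof (rule C1_onI)
    show "(f has_derivative blinfun_apply (D x)) (at x)" if "x \<in> S" for x
      unfolding D by (subst has_derivative_componentwise_within)
        (auto simp: Basis_vec_def inner_axis intro: d(1)[OF that])
    show "continuous_on S D"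
      by (rule continuous_on_blinfun_componentwise) (simp add: D, intro continuous_on_vec_lambda continuous_intros d(2))
  qed
qed


text \<open>The quadratic form of this matrix at \<open>z\<close> is the sum of the squares of
  \<open>v j \<bullet> z\<close>, so a vector in its kernel is orthogonal to all
  \<open>v j\<close>.\<close>

lemma spanning_Gram_det:
  fixes v :: "'j \<Rightarrow> real^'n"
  assumes "\<And>z. (\<And>j. j \<in> J \<Longrightarrow> v j \<bullet> z = 0) \<Longrightarrow> z = 0" and "finite J"
  shows "det (\<chi> i k. \<Sum>j\<in>J. v j $ i * v j $ k) \<noteq> 0"
proof -
  let ?M = "\<chi> i k. \<Sum>j\<in>J. v j $ i * v j $ k"
  have Mz: "?M *v z = (\<Sum>j\<in>J. (v j \<bullet> z) *\<^sub>R v j)" for z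
    by (simp add: vec_eq_iff matrix_vector_mult_def inner_vec_def sum_distrib_left sum_distrib_right mult_ac)
       (rule allI, rule sum.swap)
  have "z = 0" if "?M *v z = 0" for z
  proof -
    have "(\<Sum>j\<in>J. (v j \<bullet> z)\<^sup>2) = z \<bullet> (?M *v z)"
      unfolding Mz by (simp add: inner_sum_right power2_eq_square inner_commute)
    also have "\<dots> = 0" by (simp add: that)
    finally have "v j \<bullet> z = 0" if "j \<in> J" for j
      using that assms(2) by (simp add: sum_nonneg_eq_0_iff)
    then show ?thesis by (rule assms(1))
  qed
  then have "\<exists>B. B ** ?M = mat 1" unfolding matrix_left_invertible_ker by blast
  then show ?thesis unfolding invertible_det_nz[symmetric] invertible_left_inverse .
qed

subsection \<open>Zeros of random linear systems on a submanifold\<close>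

text \<open>By the Lindelof property countably many images of parametrizations cover
  \<open>S\<close>. Each point of \<open>U\<close> is assigned to the first image that contains it;
  in the parameters the pieces are differences of two open sets, hence F-sigma. \<open>Q\<close>
  stands for any further property that the local parametrizations can be given.\<close>

lemma ex_patches:
  fixes A :: "('a::{t2_space,second_countable_topology} set \<times> ('a \<Rightarrow> 'e::euclidean_space)) set"
    and Q :: "('n::euclidean_space) set \<Rightarrow> ('n \<Rightarrow> 'a) \<Rightarrow> bool"
  assumes par: "\<And>x. x \<in> S \<Longrightarrow> \<exists>Om \<psi>. parametrization A S Om \<psi> \<and> x \<in> \<psi> ` Om \<and> Q Om \<psi>"
    and S: "S \<noteq> {}" and U: "openin (top_of_set S) U"
  obtains Om \<psi> E where "\<And>n::nat. parametrization A S (Om n) (\<psi> n)" "\<And>n. Q (Om n) (\<psi> n)"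
    "\<And>n. fsigma_in euclidean (E n)" "\<And>n. E n \<subseteq> Om n"
    "disjoint_family (\<lambda>n. \<psi> n ` E n)" "U = (\<Union>n. \<psi> n ` E n)"
proof -
  have "\<exists>O'. \<forall>x\<in>S. parametrization A S (fst (O' x)) (snd (O' x)) \<and> x \<in> snd (O' x) ` fst (O' x) \<and> Q (fst (O' x)) (snd (O' x))"
  proof (rule bchoice, rule ballI)
    fix x assume "x \<in> S"
    from par[OF this] obtain Om \<psi> where "parametrization A S Om \<psi> \<and> x \<in> \<psi> ` Om \<and> Q Om \<psi>" by (elim exE)
    then show "\<exists>y. parametrization A S (fst y) (snd y) \<and> x \<in> snd y ` fst y \<and> Q (fst y) (snd y)"
      by (intro exI[of _ "(Om, \<psi>)"]) simp
  qed
  then obtain O' where O': "\<forall>x\<in>S. parametrization A S (fst (O' x)) (snd (O' x)) \<and> x \<in> snd (O' x) ` fst (O' x) \<and> Q (fst (O' x)) (snd (O' x))"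
    by (elim exE)
  define P where "P x = snd (O' x) ` fst (O' x)" for x
  have Pop: "openin (top_of_set S) B" if "B \<in> P ` S" for B
    using that O' parametrization_openin unfolding P_def by blast
  obtain F' where F': "F' \<subseteq> P ` S" "countable F'" "\<Union>F' = \<Union>(P ` S)"
    by (rule Lindelof_openin[of "P ` S" S, OF Pop])
  have "\<exists>Y. countable Y \<and> Y \<subseteq> S \<and> F' = P ` Y"
    by (rule iffD1[OF countable_subset_image conjI[OF F'(2,1)]])
  then obtain Y where Y: "countable Y" "Y \<subseteq> S" "F' = P ` Y" by (elim exE conjE)
  have PS: "\<Union>(P ` S) = S"
  proof
    show "\<Union>(P ` S) \<subseteq> S" using Pop openin_imp_subset by blast
    show "S \<subseteq> \<Union>(P ` S)" using O' unfolding P_def by blast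
  qed
  have Yne: "Y \<noteq> {}" using PS F'(3) Y(3) S by auto
  define x where "x n = from_nat_into Y n" for n
  have xY: "x n \<in> S" for n unfolding x_def using from_nat_into[OF Yne] Y(2) by blast
  have rx: "range x = Y" unfolding x_def using range_from_nat_into[OF Yne Y(1)] .
  define Om where "Om n = fst (O' (x n))" for n
  define \<psi> where "\<psi> n = snd (O' (x n))" for n
  have par': "parametrization A S (Om n) (\<psi> n)" "Q (Om n) (\<psi> n)" for n
    using O' xY unfolding Om_def \<psi>_def by blast+
  have Px: "P (x n) = \<psi> n ` Om n" for n unfolding P_def Om_def \<psi>_def ..
  have cov: "(\<Union>n. \<psi> n ` Om n) = S"
    using PS F'(3) Y(3) unfolding rx[symmetric] by (auto simp flip: Px)
  obtain V where V: "open V" "U = S \<inter> V" using U by (auto simp: openin_open)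
  have "\<forall>n. \<exists>T. open T \<and> \<psi> n ` Om n = S \<inter> T"
    using parametrization_openin[OF par'(1)] by (simp add: openin_open)
  then obtain T where T: "\<forall>n. open (T n) \<and> \<psi> n ` Om n = S \<inter> T n" by (rule choice[THEN exE])
  define E where "E n = (Om n \<inter> \<psi> n -` V) - (Om n \<inter> \<psi> n -` (\<Union>k<n. T k))" for n
  have \<psi>S: "\<psi> n y \<in> S" if "y \<in> Om n" for n y using parametrization_subset[OF par'(1)] that by blast
  have "fsigma_in euclidean (E n)" for n
    unfolding E_def
  proof (rule fsigma_in_diff)
    have o: "open (Om n \<inter> \<psi> n -` B)" if "open B" for B
      using continuous_open_preimage[OF parametrization_continuous parametrization_open that] par'(1) by blast
    show "fsigma_in euclidean (Om n \<inter> \<psi> n -` V)"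
      using o[OF V(1)] by (simp add: open_imp_fsigma_in metrizable_space_euclidean)
    have "open (\<Union>k<n. T k)" using T by blast
    from o[OF this] show "gdelta_in euclidean (Om n \<inter> \<psi> n -` (\<Union>k<n. T k))"
      by (simp add: open_imp_gdelta_in)
  qed
  moreover have "E n \<subseteq> Om n" for n unfolding E_def by blast
  moreover have ET: "u \<in> \<psi> n ` E n \<longleftrightarrow> u \<in> U \<and> u \<in> T n \<and> (\<forall>k<n. u \<notin> T k)" for u n
  proof
    assume "u \<in> \<psi> n ` E n"
    then obtain y where y: "y \<in> E n" "u = \<psi> n y" by blast
    then show "u \<in> U \<and> u \<in> T n \<and> (\<forall>k<n. u \<notin> T k)"
      using T \<psi>S[of y n] V(2) unfolding E_def by blast
  next
    assume u: "u \<in> U \<and> u \<in> T n \<and> (\<forall>k<n. u \<notin> T k)"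
    then have "u \<in> \<psi> n ` Om n" using T V(2) by blast
    then obtain y where "y \<in> Om n" "u = \<psi> n y" by blast
    then show "u \<in> \<psi> n ` E n" using u V(2) unfolding E_def by blast
  qed
  have "disjoint_family (\<lambda>n. \<psi> n ` E n)"
    unfolding disjoint_family_on_def
  proof (intro ballI impI)
    fix m n :: nat assume "m \<noteq> n"
    then consider "m < n" | "n < m" by linarith
    then show "\<psi> m ` E m \<inter> \<psi> n ` E n = {}" using ET by cases blast+
  qed
  moreover have "U = (\<Union>n. \<psi> n ` E n)"
  proof (intro equalityI subsetI)
    fix u assume u: "u \<in> U"
    then have "u \<in> S" using V(2) by blast
    then have ex: "\<exists>n. u \<in> T n" using cov T by blast
    define n where "n = (LEAST n. u \<in> T n)"
    have "u \<in> T n" unfolding n_def using ex by (rule LeastI_ex)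
    moreover have "u \<notin> T k" if "k < n" for k using that unfolding n_def by (rule not_less_Least)
    ultimately have "u \<in> \<psi> n ` E n" using ET u by blast
    then show "u \<in> (\<Union>n. \<psi> n ` E n)" by blast
  qed (use ET in blast)
  ultimately show ?thesis using that par' by blast
qed

lemma emeasure_count_patches:
  assumes inj: "\<And>n::nat. inj_on (\<psi> n) (E n)" and disj: "disjoint_family (\<lambda>n. \<psi> n ` E n)"
    and U: "U = (\<Union>n. \<psi> n ` E n)"
  shows "emeasure (count_space UNIV) {x\<in>U. Z x} = (\<Sum>n. emeasure (count_space UNIV) {y\<in>E n. Z (\<psi> n y)})"
proof -
  have "{x\<in>U. Z x} = (\<Union>n. \<psi> n ` {y\<in>E n. Z (\<psi> n y)})" unfolding U by auto
  also have "emeasure (count_space UNIV) \<dots> = (\<Sum>n. emeasure (count_space UNIV) (\<psi> n ` {y\<in>E n. Z (\<psi> n y)}))"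
  proof (rule suminf_emeasure[symmetric])
    show "disjoint_family (\<lambda>n. \<psi> n ` {y\<in>E n. Z (\<psi> n y)})"
      using disj unfolding disjoint_family_on_def by blast
  qed simp
  also have "\<dots> = (\<Sum>n. emeasure (count_space UNIV) {y\<in>E n. Z (\<psi> n y)})"
    by (intro suminf_cong emeasure_count_space_image inj_on_subset[OF inj]) auto
  finally show ?thesis .
qed

lemma inner_supported:
  fixes s w :: "real^'m"
  assumes R: "\<And>i. i \<notin> R \<Longrightarrow> s $ i = 0"
  shows "s \<bullet> w = (\<Sum>r\<in>R. s $ r * w $ r)"
proof -
  have "s \<bullet> w = (\<Sum>r\<in>UNIV. s $ r * w $ r)" by (simp add: inner_vec_def)
  also have "\<dots> = (\<Sum>r\<in>R. s $ r * w $ r)" by (rule sum.mono_neutral_right) (use R in auto)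
  finally show ?thesis .
qed

text \<open>The setting shared by both inequalities: a system of \<open>CARD('n)\<close> equations
  on a set \<open>S\<close> of that dimension, linear in random coefficients, where the coefficient
  of index \<open>j\<close> multiplies \<open>v j\<close>. The assumption \<open>span\<close> says
  that at every point the coefficients reach all right-hand sides, the nondegeneracy on which the
  Kac-Rice argument rests.\<close>

locale spanning_fields =
  fixes A :: "('a::{t2_space,second_countable_topology} set \<times> ('a \<Rightarrow> 'e::euclidean_space)) set"
    and S :: "'a set" and J :: "'j set" and v :: "'j \<Rightarrow> 'a \<Rightarrow> real^'n::{finite,wellorder}"
  assumes parametrized: "\<And>x. x \<in> S \<Longrightarrow> \<exists>(Om :: (real^'n::{finite,wellorder}) set) \<psi>. parametrization A S Om \<psi> \<and> x \<in> \<psi> ` Om"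
    and finite_J: "finite J"
    and smooth: "\<And>j i. j \<in> J \<Longrightarrow> C1_along A S (\<lambda>x. v j x $ i)"
    and span: "\<And>x z. x \<in> S \<Longrightarrow> (\<And>j. j \<in> J \<Longrightarrow> v j x \<bullet> z = 0) \<Longrightarrow> z = 0"
begin

text \<open>The constant directions \<open>b\<close> needed for
  \<open>nn_integral_zero_count_shift\<close> are the values of \<open>v\<close> at the centre
  \<open>x\<close>. At \<open>x\<close> the operator is the Gram matrix of a spanning family, hence
  invertible, and by continuity of the determinant it stays so on a smaller domain.\<close>

lemma ex_good_parametrization:
  assumes x: "x \<in> S"
  shows "\<exists>(Om :: (real^'n::_) set) \<psi>. parametrization A S Om \<psi> \<and> x \<in> \<psi> ` Om \<and>
    (\<forall>j\<in>J. C1_on (v j \<circ> \<psi>) Om) \<and> (\<exists>b :: 'j \<Rightarrow> real^'n::_. \<forall>y\<in>Om. \<forall>z. (\<Sum>j\<in>J. (b j \<bullet> z) *\<^sub>R v j (\<psi> y)) = 0 \<longrightarrow> z = 0)"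
proof -
  define F where "F = (\<lambda>(j, i). \<lambda>x. v j x $ i) ` (J \<times> UNIV)"
  have "finite F" unfolding F_def using finite_J by simp
  moreover have "\<forall>f\<in>F. C1_along A S f" unfolding F_def using smooth by auto
  ultimately obtain Om :: "(real^'n::_) set" and \<psi> where P: "parametrization A S Om \<psi>" "x \<in> \<psi> ` Om"
    and FC: "\<forall>f\<in>F. C1_on (f \<circ> \<psi>) Om"
    using ex_parametrization_C1[OF parametrized[OF x] x] by metis
  have C: "C1_on (v j \<circ> \<psi>) Om" if j: "j \<in> J" for j
  proof (rule C1_on_vec)
    fix i
    have "(\<lambda>x. v j x $ i) \<in> F" unfolding F_def using j by force
    then have "C1_on ((\<lambda>x. v j x $ i) \<circ> \<psi>) Om" using FC by blast
    then show "C1_on (\<lambda>y. (v j \<circ> \<psi>) y $ i) Om" by (simp add: o_def)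
  qed
  define B where "B y = (\<chi> i k. \<Sum>j\<in>J. v j (\<psi> y) $ i * v j x $ k)" for y
  have cB: "continuous_on Om (\<lambda>y. det (B y))"
  proof -
    have "continuous_on Om (\<lambda>y. v j (\<psi> y))" if "j \<in> J" for j
      using C1_on_continuous[OF C[OF that]] by (simp add: o_def)
    then have "continuous_on Om (\<lambda>y. B y $ i $ k)" for i k
      unfolding B_def vec_lambda_beta by (intro continuous_intros)
    then show ?thesis
      unfolding det_def by (intro continuous_on_sum continuous_on_mult continuous_on_const continuous_on_prod)
  qed
  define T where "T = Om \<inter> (\<lambda>y. det (B y)) -` (- {0})"
  have To: "open T" unfolding T_def
    by (rule continuous_open_preimage[OF cB parametrization_open[OF P(1)] open_Compl[OF closed_singleton]])
  have PT: "parametrization A S T \<psi>" by (rule parametrization_restrict[OF P(1) To]) (simp add: T_def)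
  obtain y0 where y0: "y0 \<in> Om" "x = \<psi> y0" using P(2) by blast
  have "det (B y0) \<noteq> 0" unfolding B_def y0(2)[symmetric] by (rule spanning_Gram_det[OF span[OF x] finite_J])
  then have xT: "x \<in> \<psi> ` T" using y0 by (auto simp: T_def)
  have "z = 0" if y: "y \<in> T" and z: "(\<Sum>j\<in>J. (v j x \<bullet> z) *\<^sub>R v j (\<psi> y)) = 0" for y z
  proof -
    have "B y *v z = (\<Sum>j\<in>J. (v j x \<bullet> z) *\<^sub>R v j (\<psi> y))"
      unfolding B_def
      by (simp add: vec_eq_iff matrix_vector_mult_def inner_vec_def sum_distrib_left sum_distrib_right mult_ac)
         (rule allI, rule sum.swap)
    then have Bz: "B y *v z = 0" using z by simp
    have "invertible (B y)" using y by (simp add: T_def invertible_det_nz)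
    then show "z = 0" unfolding invertible_left_inverse matrix_left_invertible_ker using Bz by blast
  qed
  then show ?thesis
    using PT xT C1_on_subset[OF C, of _ T]
    by (intro exI[of _ T] exI[of _ \<psi>] conjI ballI exI[of _ "\<lambda>j. v j x"]) (auto simp: T_def)
qed

lemma measurable_count_linear_zeros:
  fixes c :: "'j \<Rightarrow> 'w \<Rightarrow> real" and s :: "'w \<Rightarrow> real^'n::_"
  assumes U: "openin (top_of_set S) U"
    and c: "\<And>j. j \<in> J \<Longrightarrow> c j \<in> borel_measurable K" and s: "s \<in> borel_measurable K"
  shows "(\<lambda>w. emeasure (count_space UNIV) {x\<in>U. (\<Sum>j\<in>J. c j w *\<^sub>R v j x) = s w}) \<in> borel_measurable K"
proof (cases "S = {}")
  case True
  then have "U = {}" using U openin_imp_subset by blast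
  then show ?thesis by simp
next
  case False
  obtain Om :: "nat \<Rightarrow> (real^'n::_) set" and \<psi> E where P: "\<And>n::nat. parametrization A S (Om n) (\<psi> n)"
    "\<And>n. (\<forall>j\<in>J. C1_on (v j \<circ> \<psi> n) (Om n)) \<and> (\<exists>b :: 'j \<Rightarrow> real^'n::_. \<forall>y\<in>Om n. \<forall>z. (\<Sum>j\<in>J. (b j \<bullet> z) *\<^sub>R v j (\<psi> n y)) = 0 \<longrightarrow> z = 0)"
    "\<And>n. fsigma_in euclidean (E n)" "\<And>n. E n \<subseteq> Om n"
    "disjoint_family (\<lambda>n. \<psi> n ` E n)" "U = (\<Union>n. \<psi> n ` E n)"
    by (rule ex_patches[OF ex_good_parametrization False U]) (assumption | rule that)+
  have inj: "inj_on (\<psi> n) (E n)" for n using parametrization_inj[OF P(1)] P(4) inj_on_subset by blast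
  have "(\<lambda>w. emeasure (count_space UNIV) {y\<in>E n. (\<Sum>j\<in>J. c j w *\<^sub>R v j (\<psi> n y)) - s w = 0}) \<in> borel_measurable K" for n
  proof (rule measurable_count_zeros[OF _ _ P(3)])
    show "(\<lambda>w. (\<Sum>j\<in>J. c j w *\<^sub>R v j (\<psi> n y)) - s w) \<in> borel_measurable K" for y
      using c s by simp
    have "continuous_on (E n) (\<lambda>y. v j (\<psi> n y))" if "j \<in> J" for j
      using C1_on_continuous[of "v j \<circ> \<psi> n" "Om n"] P(2)[of n] that continuous_on_subset[OF _ P(4)] by (simp add: o_def)
    then show "continuous_on (E n) (\<lambda>y. (\<Sum>j\<in>J. c j w *\<^sub>R v j (\<psi> n y)) - s w)" for w
      by (intro continuous_intros)
  qed
  then show ?thesis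
    unfolding emeasure_count_patches[OF inj P(5,6)] by (simp add: borel_measurable_suminf)
qed

text \<open>The matrix applied to \<open>s\<close> here is the Gram matrix of the rows. A row in
  \<open>R\<close> has norm 1 and is orthogonal to every other row because no coefficient enters
  both, so the matrix fixes each vector supported in \<open>R\<close>.\<close>

lemma Gram_fixed:
  fixes s :: "real^'n::_"
  assumes x: "x \<in> S" and R: "\<And>i. i \<notin> R \<Longrightarrow> s $ i = 0"
    and unit: "\<And>x r. x \<in> S \<Longrightarrow> r \<in> R \<Longrightarrow> (\<Sum>j\<in>J. (v j x $ r)\<^sup>2) = 1"
    and orth: "\<And>j r i. j \<in> J \<Longrightarrow> r \<in> R \<Longrightarrow> i \<noteq> r \<Longrightarrow> (\<forall>x\<in>S. v j x $ i = 0) \<or> (\<forall>x\<in>S. v j x $ r = 0)"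
  shows "(\<Sum>j\<in>J. (s \<bullet> v j x) *\<^sub>R v j x) = s"
proof -
  have sin: "s \<bullet> w = (\<Sum>r\<in>R. s $ r * w $ r)" for w by (rule inner_supported) (rule R)
  show ?thesis
proof (rule vec_eq_iff[THEN iffD2], rule allI)
  fix i
  have "(\<Sum>j\<in>J. (s \<bullet> v j x) *\<^sub>R v j x) $ i = (\<Sum>r\<in>R. s $ r * (\<Sum>j\<in>J. v j x $ r * v j x $ i))"
    unfolding sin by (simp add: sum_distrib_right sum_distrib_left mult.assoc) (rule sum.swap)
  also have "\<dots> = (\<Sum>r\<in>R. if r = i then s $ i else 0)"
  proof (rule sum.cong)
    fix r assume r: "r \<in> R"
    show "s $ r * (\<Sum>j\<in>J. v j x $ r * v j x $ i) = (if r = i then s $ i else 0)"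
    proof (cases "r = i")
      case True
      then show ?thesis using unit[OF x r] by (simp add: power2_eq_square)
    next
      case False
      have "(\<Sum>j\<in>J. v j x $ r * v j x $ i) = 0"
        using orth[OF _ r] False x by (intro sum.neutral ballI) fastforce
      then show ?thesis using False by simp
    qed
  qed simp
  also have "\<dots> = s $ i" using R[of i] by simp
  finally show "(\<Sum>j\<in>J. (s \<bullet> v j x) *\<^sub>R v j x) $ i = s $ i" .
qed
qed

text \<open>The choice \<open>\<tau> j = s \<bullet> v j\<close> meets the conditions of
  \<open>nn_integral_zero_count_shift\<close> on each patch with the same factor
  \<open>\<kappa>\<close>, and the patches are summed. That the row norms are constant along
  \<open>S\<close> is what keeps the Jacobian unchanged.\<close>

lemma nn_integral_linear_zeros_shift:
  fixes p :: "('j \<Rightarrow> real) \<Rightarrow> ennreal" and s :: "real^'n::_" and R :: "'n set"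
  assumes U: "openin (top_of_set S) U"
    and M: "M = Pi\<^sub>M J (\<lambda>_. lborel :: real measure)" and p: "p \<in> borel_measurable M"
    and R: "\<And>i. i \<notin> R \<Longrightarrow> s $ i = 0"
    and unit: "\<And>x r. x \<in> S \<Longrightarrow> r \<in> R \<Longrightarrow> (\<Sum>j\<in>J. (v j x $ r)\<^sup>2) = 1"
    and orth: "\<And>j r i. j \<in> J \<Longrightarrow> r \<in> R \<Longrightarrow> i \<noteq> r \<Longrightarrow> (\<forall>x\<in>S. v j x $ i = 0) \<or> (\<forall>x\<in>S. v j x $ r = 0)"
    and shift: "\<And>\<theta> x. \<theta> \<in> space M \<Longrightarrow> x \<in> S \<Longrightarrow> (\<Sum>j\<in>J. \<theta> j *\<^sub>R v j x) = 0 \<Longrightarrow>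
        p (\<lambda>j\<in>J. \<theta> j + s \<bullet> v j x) = \<kappa> * p \<theta>"
  shows "(\<integral>\<^sup>+\<theta>. p \<theta> * emeasure (count_space UNIV) {x\<in>U. (\<Sum>j\<in>J. \<theta> j *\<^sub>R v j x) = s} \<partial>M)
    = \<kappa> * (\<integral>\<^sup>+\<theta>. p \<theta> * emeasure (count_space UNIV) {x\<in>U. (\<Sum>j\<in>J. \<theta> j *\<^sub>R v j x) = 0} \<partial>M)"
proof (cases "S = {}")
  case True
  then have "U = {}" using U openin_imp_subset by blast
  then show ?thesis by simp
next
  case False
  obtain Om :: "nat \<Rightarrow> (real^'n::_) set" and \<psi> E where P: "\<And>n::nat. parametrization A S (Om n) (\<psi> n)"
    "\<And>n. (\<forall>j\<in>J. C1_on (v j \<circ> \<psi> n) (Om n)) \<and> (\<exists>b :: 'j \<Rightarrow> real^'n::_. \<forall>y\<in>Om n. \<forall>z. (\<Sum>j\<in>J. (b j \<bullet> z) *\<^sub>R v j (\<psi> n y)) = 0 \<longrightarrow> z = 0)"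
    "\<And>n. fsigma_in euclidean (E n)" "\<And>n. E n \<subseteq> Om n"
    "disjoint_family (\<lambda>n. \<psi> n ` E n)" "U = (\<Union>n. \<psi> n ` E n)"
    by (rule ex_patches[OF ex_good_parametrization False U]) (assumption | rule that)+
  have inj: "inj_on (\<psi> n) (E n)" for n using parametrization_inj[OF P(1)] P(4) inj_on_subset by blast
  have comp: "(\<lambda>\<theta>. \<theta> j) \<in> borel_measurable M" if "j \<in> J" for j
    unfolding M using that measurable_component_singleton[of j J "\<lambda>_. lborel :: real measure"] by simp
  have \<psi>S: "\<psi> n y \<in> S" if "y \<in> Om n" for n y using parametrization_subset[OF P(1)] that by blast
  have patch: "(\<integral>\<^sup>+\<theta>. p \<theta> * emeasure (count_space UNIV) {y\<in>E n. (\<Sum>j\<in>J. \<theta> j *\<^sub>R v j (\<psi> n y)) = s} \<partial>M)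
    = \<kappa> * (\<integral>\<^sup>+\<theta>. p \<theta> * emeasure (count_space UNIV) {y\<in>E n. (\<Sum>j\<in>J. \<theta> j *\<^sub>R v j (\<psi> n y)) = 0} \<partial>M)" for n
  proof -
    have "\<forall>j\<in>J. \<exists>d. (\<forall>y\<in>Om n. (v j \<circ> \<psi> n has_derivative blinfun_apply (d y)) (at y)) \<and> continuous_on (Om n) d"
      using P(2)[of n] unfolding C1_on_def by blast
    then obtain d where d: "\<forall>j\<in>J. (\<forall>y\<in>Om n. (v j \<circ> \<psi> n has_derivative blinfun_apply (d j y)) (at y)) \<and> continuous_on (Om n) (d j)"
      by (rule bchoice[THEN exE])
    obtain b :: "'j \<Rightarrow> real^'n::_" where b: "\<forall>y\<in>Om n. \<forall>z. (\<Sum>j\<in>J. (b j \<bullet> z) *\<^sub>R v j (\<psi> n y)) = 0 \<longrightarrow> z = 0"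
      using P(2)[of n] by blast
    have On: "open (Om n)" by (rule parametrization_open[OF P(1)])
    have der: "((\<lambda>y. v j (\<psi> n y)) has_derivative blinfun_apply (d j y)) (at y)" if "j \<in> J" "y \<in> Om n" for j y
      using d that by (simp add: o_def)
    have dcomp: "((\<lambda>y. v j (\<psi> n y) $ i) has_derivative (\<lambda>h. blinfun_apply (d j y) h $ i)) (at y)" if "j \<in> J" "y \<in> Om n" for j y i
      using bounded_linear.has_derivative[OF bounded_linear_vec_nth der[OF that]] .
    have sin: "s \<bullet> w = (\<Sum>r\<in>R. s $ r * w $ r)" for w by (rule inner_supported) (rule R)
    have constant_deriv: "D h = 0" if D: "(f has_derivative D) (at y)" and y: "y \<in> Om n" and c: "\<And>y. y \<in> Om n \<Longrightarrow> f y = (k::real)" for f D y k h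
    proof -
      have "((\<lambda>_. k) has_derivative (\<lambda>_. 0)) (at y)" by simp
      then have "(f has_derivative (\<lambda>_. 0)) (at y)"
        by (rule has_derivative_transform_within_open[OF _ On y]) (simp add: c)
      from has_derivative_unique[OF D this] show ?thesis by simp
    qed
    have tau1: "(\<Sum>j\<in>J. (s \<bullet> v j x) *\<^sub>R v j x) = s" if x: "x \<in> S" for x
      by (rule Gram_fixed[OF x, where R = R], erule R, erule (1) unit, erule (2) orth)
    \<comment> \<open>For a row paired with itself this is the derivative of its constant norm. For
      two different rows each \<open>j\<close> contributes 0: one of its two components is
      identically 0 on \<open>S\<close>, and then its derivative along the patch is 0 too.\<close>
    have tau2: "(\<Sum>j\<in>J. (s \<bullet> v j (\<psi> n y)) *\<^sub>R d j y) = 0" if y: "y \<in> Om n" for y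
    proof (rule blinfun_eqI, rule vec_eq_iff[THEN iffD2], rule allI)
      fix h i
      have "blinfun_apply (\<Sum>j\<in>J. (s \<bullet> v j (\<psi> n y)) *\<^sub>R d j y) h $ i
         = (\<Sum>r\<in>R. s $ r * (\<Sum>j\<in>J. v j (\<psi> n y) $ r * blinfun_apply (d j y) h $ i))"
        unfolding sin by (simp add: blinfun.sum_left blinfun.scaleR_left sum_distrib_right sum_distrib_left mult.assoc) (rule sum.swap)
      also have "\<dots> = 0"
      proof (rule sum.neutral, rule ballI)
        fix r assume r: "r \<in> R"
        have "(\<Sum>j\<in>J. v j (\<psi> n y) $ r * blinfun_apply (d j y) h $ i) = 0"
        proof (cases "r = i")
          case True
          have "((\<lambda>y. \<Sum>j\<in>J. (v j (\<psi> n y) $ r)\<^sup>2) has_derivative (\<lambda>h. \<Sum>j\<in>J. 2 * (blinfun_apply (d j y) h $ r * v j (\<psi> n y) $ r))) (at y)"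
          proof (rule has_derivative_sum)
            fix j assume "j \<in> J"
            from has_derivative_mult[OF dcomp[OF this y, of r] dcomp[OF this y, of r]]
            show "((\<lambda>y. (v j (\<psi> n y) $ r)\<^sup>2) has_derivative (\<lambda>h. 2 * (blinfun_apply (d j y) h $ r * v j (\<psi> n y) $ r))) (at y)"
              by (simp add: power2_eq_square mult.commute)
          qed
          from constant_deriv[OF this y, of 1 h] unit[OF \<psi>S r]
          have "(\<Sum>j\<in>J. 2 * (blinfun_apply (d j y) h $ r * v j (\<psi> n y) $ r)) = 0" by simp
          then have "2 * (\<Sum>j\<in>J. blinfun_apply (d j y) h $ r * v j (\<psi> n y) $ r) = 0" by (simp add: sum_distrib_left)
          then show ?thesis using True by (simp add: mult.commute)
        next
          case False
          have "v j (\<psi> n y) $ r * blinfun_apply (d j y) h $ i = 0" if j: "j \<in> J" for j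
          proof -
            have "(\<forall>x\<in>S. v j x $ i = 0) \<or> (\<forall>x\<in>S. v j x $ r = 0)"
              by (rule orth[OF j r]) (use False in simp)
            then show ?thesis
            proof
              assume "\<forall>x\<in>S. v j x $ i = 0"
              then have "blinfun_apply (d j y) h $ i = 0"
                using constant_deriv[OF dcomp[OF j y, of i] y, of 0] \<psi>S by simp
              then show ?thesis by simp
            qed (use \<psi>S[OF y] in simp)
          qed
          then show ?thesis by (intro sum.neutral ballI)
        qed
        then show "s $ r * (\<Sum>j\<in>J. v j (\<psi> n y) $ r * blinfun_apply (d j y) h $ i) = 0" by simp
      qed
      finally show "blinfun_apply (\<Sum>j\<in>J. (s \<bullet> v j (\<psi> n y)) *\<^sub>R d j y) h $ i = blinfun_apply 0 h $ i" by simp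
    qed
    show ?thesis
    proof (rule nn_integral_zero_count_shift[OF M finite_J On P(3) P(4), where a' = d and b = b and \<tau> = "\<lambda>j y. s \<bullet> v j (\<psi> n y)"])
      show "((\<lambda>y. v j (\<psi> n y)) has_derivative blinfun_apply (d j y)) (at y)" if "j \<in> J" "y \<in> Om n" for j y
        by (rule der[OF that])
      show "continuous_on (Om n) (d j)" if "j \<in> J" for j using d that by blast
      show "z = 0" if "y \<in> Om n" "(\<Sum>j\<in>J. (b j \<bullet> z) *\<^sub>R v j (\<psi> n y)) = 0" for y z using b that by blast
      show "p \<in> borel_measurable M" by (rule p)
      fix y assume "y \<in> E n"
      then have y: "y \<in> Om n" using P(4) by blast
      show "(\<Sum>j\<in>J. (s \<bullet> v j (\<psi> n y)) *\<^sub>R v j (\<psi> n y)) = s" by (rule tau1[OF \<psi>S[OF y]])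
      show "(\<Sum>j\<in>J. (s \<bullet> v j (\<psi> n y)) *\<^sub>R d j y) = 0" by (rule tau2[OF y])
      show "p (\<lambda>j\<in>J. \<theta> j + s \<bullet> v j (\<psi> n y)) = \<kappa> * p \<theta>" if "\<theta> \<in> space M" "(\<Sum>j\<in>J. \<theta> j *\<^sub>R v j (\<psi> n y)) = 0" for \<theta>
        by (rule shift[OF that(1) \<psi>S[OF y] that(2)])
    qed
  qed
  have meas: "(\<lambda>\<theta>. emeasure (count_space UNIV) {y\<in>E n. (\<Sum>j\<in>J. \<theta> j *\<^sub>R v j (\<psi> n y)) = t}) \<in> borel_measurable M" for n t
  proof -
    have "(\<lambda>\<theta>. emeasure (count_space UNIV) {y\<in>E n. (\<Sum>j\<in>J. \<theta> j *\<^sub>R v j (\<psi> n y)) - t = 0}) \<in> borel_measurable M"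
    proof (rule measurable_count_zeros[OF _ _ P(3)])
      show "(\<lambda>\<theta>. (\<Sum>j\<in>J. \<theta> j *\<^sub>R v j (\<psi> n y)) - t) \<in> borel_measurable M" for y
        using comp by simp
      have "continuous_on (E n) (\<lambda>y. v j (\<psi> n y))" if "j \<in> J" for j
        using C1_on_continuous[of "v j \<circ> \<psi> n" "Om n"] P(2)[of n] that continuous_on_subset[OF _ P(4)] by (simp add: o_def)
      then show "continuous_on (E n) (\<lambda>y. (\<Sum>j\<in>J. \<theta> j *\<^sub>R v j (\<psi> n y)) - t)" for \<theta>
        by (intro continuous_intros)
    qed
    then show ?thesis by simp
  qed
  have sum: "(\<integral>\<^sup>+\<theta>. p \<theta> * emeasure (count_space UNIV) {x\<in>U. (\<Sum>j\<in>J. \<theta> j *\<^sub>R v j x) = t} \<partial>M) =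
     (\<Sum>n. \<integral>\<^sup>+\<theta>. p \<theta> * emeasure (count_space UNIV) {y\<in>E n. (\<Sum>j\<in>J. \<theta> j *\<^sub>R v j (\<psi> n y)) = t} \<partial>M)" for t
    unfolding emeasure_count_patches[OF inj P(5,6)] ennreal_suminf_cmult[symmetric]
    by (rule nn_integral_suminf) (use meas p in simp)
  show ?thesis unfolding sum patch by (simp add: ennreal_suminf_cmult)
qed

end

subsection \<open>Gaussian coordinates\<close>

text \<open>These linear functionals are evidently measurable on \<open>path_space\<close>.
  Independence is assumed for fields as variables with values in that space, so it passes to
  coordinates that are measurable functions of the path.\<close>

definition eval_functionals :: "(('x \<Rightarrow> real) \<Rightarrow> real) set" where
  "eval_functionals = span (range (\<lambda>x f. f x))"

lemma scaleR_fun_apply: "(c *\<^sub>R f) x = c *\<^sub>R f x"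
  by (simp add: scaleR_fun_def)

lemma sum_fun_apply: "(\<Sum>i\<in>I. f i) x = (\<Sum>i\<in>I. f i x)"
  for f :: "'i \<Rightarrow> 'a \<Rightarrow> 'b::comm_monoid_add"
  by (induction I rule: infinite_finite_induct) (simp_all add: zero_fun_def)

lemma eval_functional_linear: "L \<in> eval_functionals \<Longrightarrow> linear L"
  unfolding eval_functionals_def
proof (induction rule: span_induct_alt)
  case base
  then show ?case by (rule linearI) (simp_all add: zero_fun_def)
next
  case (step c x y)
  then obtain u where x: "x = (\<lambda>f. f u)" by blast
  show ?case
    by (rule linearI) (simp_all add: x scaleR_fun_apply linear_add[OF step(2), unfolded plus_fun_def] linear_cmul[OF step(2), unfolded scaleR_fun_def real_scaleR_def]
      linear_add[OF step(2)] linear_cmul[OF step(2)] algebra_simps)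
qed

lemma eval_functional_measurable:
  assumes "L \<in> eval_functionals" and X: "\<And>x. (\<lambda>\<omega>. X \<omega> x) \<in> borel_measurable P"
  shows "(\<lambda>\<omega>. L (X \<omega>)) \<in> borel_measurable P"
  using assms(1) unfolding eval_functionals_def
proof (induction rule: span_induct_alt)
  case base
  then show ?case by (simp add: zero_fun_def)
next
  case (step c x y)
  then obtain u where x: "x = (\<lambda>f. f u)" by blast
  show ?case using X[of u] step(2) by (simp add: x scaleR_fun_apply)
qed

lemma eval_functionals_base: "(\<lambda>f. f x) \<in> eval_functionals"
  unfolding eval_functionals_def by (intro span_base rangeI)

lemma subspace_eval_functionals: "subspace eval_functionals"
  unfolding eval_functionals_def by (rule subspace_span)

lemma dual_family_independent:
  fixes v :: "nat \<Rightarrow> 'v::real_vector" and l :: "nat \<Rightarrow> 'v \<Rightarrow> real"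
  assumes lin: "\<And>i. i < k \<Longrightarrow> linear (l i)" and dual: "\<And>i j. i < k \<Longrightarrow> j < k \<Longrightarrow> l i (v j) = (if i = j then 1 else 0)"
  shows "inj_on v {..<k}" "independent (v ` {..<k})"
proof -
  show inj: "inj_on v {..<k}"
  proof (rule inj_onI)
    fix i j assume "i \<in> {..<k}" "j \<in> {..<k}" "v i = v j"
    then show "i = j" using dual[of i i] dual[of i j] by (auto split: if_splits)
  qed
  show "independent (v ` {..<k})"
  proof
    assume "dependent (v ` {..<k})"
    then obtain u w where u: "w \<in> v ` {..<k}" "u w \<noteq> 0" "(\<Sum>w\<in>v ` {..<k}. u w *\<^sub>R w) = 0"
      by (auto simp: dependent_finite)
    then obtain i where i: "i < k" "w = v i" by blast
    have "0 = l i (\<Sum>w\<in>v ` {..<k}. u w *\<^sub>R w)" using u(3) linear_0[OF lin[OF i(1)]] by simp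
    also have "\<dots> = l i (\<Sum>j<k. u (v j) *\<^sub>R v j)" by (simp add: sum.reindex[OF inj] o_def)
    also have "\<dots> = (\<Sum>j<k. u (v j) * l i (v j))"
      using lin[OF i(1)] by (simp add: linear_sum linear_cmul)
    also have "\<dots> = (\<Sum>j<k. if i = j then u (v j) else 0)"
      using dual[OF i(1)] by (intro sum.cong) auto
    also have "\<dots> = u w" using i by simp
    finally show False using u(2) by simp
  qed
qed

text \<open>Gram-Schmidt for the form \<open>B\<close> on functionals, run together with a dual
  family in \<open>F\<close>. A family of maximal length exists because the \<open>v i\<close> are
  independent in a finite dimensional space. If some \<open>f\<close> were not reproduced, its
  remainder would be nonzero at some \<open>x\<close>, and evaluation at \<open>x\<close>, made
  \<open>B\<close>-orthogonal to the \<open>l i\<close> and normalized, would extend the family. In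
  the application \<open>B\<close> is the covariance of \<open>X\<close>.\<close>

lemma ex_orthonormal_functionals:
  fixes F :: "('x \<Rightarrow> real) set" and B :: "(('x \<Rightarrow> real) \<Rightarrow> real) \<Rightarrow> (('x \<Rightarrow> real) \<Rightarrow> real) \<Rightarrow> real"
  assumes F: "finite_dim_subspace F"
    and sym: "\<And>L M. L \<in> eval_functionals \<Longrightarrow> M \<in> eval_functionals \<Longrightarrow> B L M = B M L"
    and add: "\<And>L L' M. L \<in> eval_functionals \<Longrightarrow> L' \<in> eval_functionals \<Longrightarrow> M \<in> eval_functionals \<Longrightarrow> B (L + L') M = B L M + B L' M"
    and scale: "\<And>c L M. L \<in> eval_functionals \<Longrightarrow> M \<in> eval_functionals \<Longrightarrow> B (c *\<^sub>R L) M = c * B L M"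
    and pos: "\<And>L f. L \<in> eval_functionals \<Longrightarrow> f \<in> F \<Longrightarrow> L f \<noteq> 0 \<Longrightarrow> B L L > 0"
  obtains N l v where "\<And>i. i < N \<Longrightarrow> l i \<in> eval_functionals" "\<And>i. i < (N::nat) \<Longrightarrow> v i \<in> F"
    "\<And>i j. i < N \<Longrightarrow> j < N \<Longrightarrow> l i (v j) = (if i = j then 1 else 0)"
    "\<And>i j. i < N \<Longrightarrow> j < N \<Longrightarrow> B (l i) (l j) = (if i = j then 1 else 0)"
    "\<And>f. f \<in> F \<Longrightarrow> f = (\<Sum>i<N. l i f *\<^sub>R v i)"
proof -
  define Good where "Good k \<longleftrightarrow> (\<exists>l v. (\<forall>i<k. l i \<in> eval_functionals) \<and> (\<forall>i<k. v i \<in> F) \<and>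
    (\<forall>i<k. \<forall>j<k. l i (v j) = (if i = j then 1 else 0)) \<and> (\<forall>i<k. \<forall>j<k. B (l i) (l j) = (if i = j then 1 else 0)))" for k :: nat
  have sF: "subspace F" using F by (simp add: finite_dim_subspace_def)
  obtain C where C: "finite C" "F \<subseteq> span C" using F by (auto simp: finite_dim_subspace_def)
  have "k \<le> card C" if "Good k" for k
  proof -
    from that obtain l v where g: "\<forall>i<k. l i \<in> eval_functionals" "\<forall>i<k. v i \<in> F"
      "\<forall>i<k. \<forall>j<k. l i (v j) = (if i = j then 1 else 0)" unfolding Good_def by blast
    have ind1: "inj_on v {..<k}"
      by (rule dual_family_independent(1)[of k l v]) (use g in \<open>auto intro: eval_functional_linear\<close>)
    have ind2: "independent (v ` {..<k})"
      by (rule dual_family_independent(2)[of k l v]) (use g in \<open>auto intro: eval_functional_linear\<close>)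
    have "card (v ` {..<k}) \<le> card C"
      using independent_span_bound[OF C(1) ind2] g(2) C(2) by blast
    then show ?thesis by (simp add: card_image[OF ind1])
  qed
  then have bd: "\<forall>k. Good k \<longrightarrow> k \<le> card C" by blast
  have G0: "Good 0" unfolding Good_def by simp
  define k where "k = (GREATEST k. Good k)"
  have Gk: "Good k" unfolding k_def by (rule GreatestI_nat[of Good, OF G0, of "card C"]) (use bd in blast)
  have k: "k' \<le> k" if "Good k'" for k'
    unfolding k_def by (rule Greatest_le_nat[of Good, OF that, of "card C"]) (use bd in blast)
  from Gk obtain l v where g: "\<forall>i<k. l i \<in> eval_functionals" "\<forall>i<k. v i \<in> F"
    "\<forall>i<k. \<forall>j<k. l i (v j) = (if i = j then 1 else 0)" "\<forall>i<k. \<forall>j<k. B (l i) (l j) = (if i = j then 1 else 0)"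
    unfolding Good_def by (elim exE conjE)
  have l: "l i \<in> eval_functionals" and v: "v i \<in> F" if "i < k" for i using g that by auto
  have lv: "l i (v j) = (if i = j then 1 else 0)" and ll: "B (l i) (l j) = (if i = j then 1 else 0)" if "i < k" "j < k" for i j
    using g that by auto
  have "f = (\<Sum>i<k. l i f *\<^sub>R v i)" if f: "f \<in> F" for f
  proof (rule ccontr)
    assume ne: "f \<noteq> (\<Sum>i<k. l i f *\<^sub>R v i)"
    define g where "g = f - (\<Sum>i<k. l i f *\<^sub>R v i)"
    have gF: "g \<in> F" unfolding g_def using f v by (intro subspace_diff[OF sF] subspace_sum[OF sF] subspace_scale[OF sF]) auto
    have lg: "l i g = 0" if i: "i < k" for i
    proof -
      have lin: "linear (l i)" by (rule eval_functional_linear[OF l[OF i]])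
      have "l i g = l i f - (\<Sum>j<k. l j f * l i (v j))"
        unfolding g_def using lin by (simp add: linear_diff linear_sum linear_cmul)
      also have "(\<Sum>j<k. l j f * l i (v j)) = (\<Sum>j<k. if i = j then l j f else 0)"
        using lv[OF i] by (intro sum.cong) auto
      also have "\<dots> = l i f" using i by simp
      finally show ?thesis by simp
    qed
    have "g \<noteq> 0" using ne unfolding g_def by simp
    then obtain x where x: "g x \<noteq> 0" by (auto simp: fun_eq_iff zero_fun_def)
    define m where "m = (\<lambda>f :: 'x \<Rightarrow> real. f x)"
    have m: "m \<in> eval_functionals" unfolding m_def by (rule eval_functionals_base)
    \<comment> \<open>All \<open>l i\<close> vanish on the remainder \<open>g\<close>, so
      \<open>L0\<close> and evaluation at \<open>x\<close> agree on it. Hence \<open>L0 g\<close> is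
      nonzero, and \<open>pos\<close> allows the normalization by \<open>r\<close>.\<close>
    define L0 where "L0 = m - (\<Sum>i<k. B m (l i) *\<^sub>R l i)"
    have sumE: "(\<Sum>i<k. c i *\<^sub>R l i) \<in> eval_functionals" for c
      using l by (intro subspace_sum[OF subspace_eval_functionals] subspace_scale[OF subspace_eval_functionals]) auto
    have L0: "L0 \<in> eval_functionals" unfolding L0_def
      by (rule subspace_diff[OF subspace_eval_functionals m sumE])
    have B0: "B 0 M = 0" if "M \<in> eval_functionals" for M
      using scale[OF m that, of 0] by simp
    have Bsum: "B (\<Sum>i\<in>I. c i *\<^sub>R l i) M = (\<Sum>i\<in>I. c i * B (l i) M)" if M: "M \<in> eval_functionals" and I: "finite I" "I \<subseteq> {..<k}" for M c I
      using I
    proof (induction I rule: finite_induct)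
      case (insert i I)
      have li: "l i \<in> eval_functionals" using l insert.prems by simp
      have S: "(\<Sum>i\<in>I. c i *\<^sub>R l i) \<in> eval_functionals"
        using l insert.prems by (intro subspace_sum[OF subspace_eval_functionals] subspace_scale[OF subspace_eval_functionals]) auto
      have "B (\<Sum>i\<in>insert i I. c i *\<^sub>R l i) M = B (c i *\<^sub>R l i) M + B (\<Sum>i\<in>I. c i *\<^sub>R l i) M"
        unfolding sum.insert[OF insert.hyps]
        by (rule add[OF subspace_scale[OF subspace_eval_functionals li] S M])
      also have "\<dots> = (\<Sum>i\<in>insert i I. c i * B (l i) M)"
        unfolding scale[OF li M] using insert by simp
      finally show ?case .
    qed (simp add: B0[OF M])
    have BL0: "B L0 (l j) = 0" if j: "j < k" for j
    proof -
      have "B L0 (l j) = B (m + (\<Sum>i<k. (- B m (l i)) *\<^sub>R l i)) (l j)" unfolding L0_def by (simp add: sum_negf)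
      also have "\<dots> = B m (l j) + (\<Sum>i<k. - B m (l i) * B (l i) (l j))"
        unfolding add[OF m sumE l[OF j]] Bsum[OF l[OF j] finite_lessThan order_refl] ..
      also have "(\<Sum>i<k. - B m (l i) * B (l i) (l j)) = (\<Sum>i<k. if i = j then - B m (l j) else 0)"
        using ll j by (intro sum.cong) auto
      also have "\<dots> = - B m (l j)" using j by simp
      finally show ?thesis by simp
    qed
    have L0g: "L0 g = g x" unfolding L0_def m_def
      by (simp add: sum_fun_apply scaleR_fun_apply lg)
    then have pos0: "B L0 L0 > 0" using pos[OF L0 gF] x by simp
    define r where "r = 1 / sqrt (B L0 L0)"
    have r: "r > 0" "r * r * B L0 L0 = 1" using pos0 unfolding r_def by (auto simp: field_simps)
    define L where "L = r *\<^sub>R L0"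
    have LE: "L \<in> eval_functionals" unfolding L_def by (rule subspace_scale[OF subspace_eval_functionals L0])
    have linL: "linear L" by (rule eval_functional_linear[OF LE])
    have Lg: "L g \<noteq> 0" unfolding L_def using r x L0g by (simp add: scaleR_fun_apply)
    have BLL: "B L L = 1"
    proof -
      have "B L L = r * B L0 L" unfolding L_def using scale[OF L0 LE[unfolded L_def]] .
      also have "B L0 L = r * B L0 L0" using sym[OF L0 LE] scale[OF L0 L0] unfolding L_def by simp
      finally show ?thesis using r(2) by simp
    qed
    have BLl: "B L (l j) = 0" "B (l j) L = 0" if "j < k" for j
    proof -
      show "B L (l j) = 0" unfolding L_def using scale[OF L0 l[OF that]] BL0[OF that] by simp
      then show "B (l j) L = 0" using sym[OF LE l[OF that]] by simp
    qed
    define w where "w = (1 / L g) *\<^sub>R g"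
    have wF: "w \<in> F" unfolding w_def by (rule subspace_scale[OF sF gF])
    have Lw: "L w = 1" unfolding w_def using Lg linL by (simp add: linear_cmul)
    have lw: "l i w = 0" if "i < k" for i
      unfolding w_def using lg[OF that] eval_functional_linear[OF l[OF that]] by (simp add: linear_cmul)
    \<comment> \<open>\<open>w\<close> is dual to \<open>L\<close> and killed by the
      \<open>l i\<close>; subtracting multiples of it from the old \<open>v i\<close> makes
      \<open>L\<close> vanish on them and leaves the old pairings as they were.\<close>
    define l' where "l' i = (if i < k then l i else L)" for i
    define v' where "v' i = (if i < k then v i - L (v i) *\<^sub>R w else w)" for i
    have "Good (Suc k)"
      unfolding Good_def
    proof (rule exI[of _ l'], rule exI[of _ v'], intro conjI allI impI)
      show "l' i \<in> eval_functionals" for i unfolding l'_def using l LE by auto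
      show "v' i \<in> F" for i unfolding v'_def using v wF by (auto intro!: subspace_diff[OF sF] subspace_scale[OF sF])
      fix i j assume ij: "i < Suc k" "j < Suc k"
      show "l' i (v' j) = (if i = j then 1 else 0)"
        using ij lv[of i j] lw[of i] Lw linL eval_functional_linear[OF l, of i]
        by (auto simp: l'_def v'_def linear_diff linear_cmul less_Suc_eq)
      show "B (l' i) (l' j) = (if i = j then 1 else 0)"
        using ij ll[of i j] BLl BLL by (auto simp: l'_def less_Suc_eq)
    qed
    then show False using k[of "Suc k"] by simp
  qed
  with l v lv ll show ?thesis by (rule that)
qed

text \<open>Induction on \<open>N\<close>: the remainder of \<open>f N\<close> after expansion in
  the earlier functions is nonzero by independence. Evaluation at a point where it does not vanish,
  made to vanish on the earlier functions and normalized, is the new functional; the old ones are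
  then corrected so as to vanish on \<open>f N\<close>.\<close>

lemma ex_dual_eval_functionals:
  fixes f :: "nat \<Rightarrow> 'x \<Rightarrow> real"
  assumes ind: "\<And>c. (\<Sum>i<N. c i *\<^sub>R f i) = 0 \<Longrightarrow> \<forall>i<N. c i = 0"
  shows "\<exists>l. (\<forall>i<N. l i \<in> eval_functionals) \<and> (\<forall>i<N. \<forall>j<N. l i (f j) = (if i = j then 1 else 0))"
  using ind
proof (induction N)
  case (Suc N)
  have "\<forall>i<N. c i = 0" if c: "(\<Sum>i<N. c i *\<^sub>R f i) = 0" for c
  proof -
    have "\<forall>i<Suc N. (c(N := 0)) i = 0" by (rule Suc.prems) (use c in simp)
    then show ?thesis by (metis fun_upd_other less_SucI nat_neq_iff)
  qed
  from Suc.IH[OF this] obtain l where l: "\<forall>i<N. l i \<in> eval_functionals"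
    and lf: "\<forall>i<N. \<forall>j<N. l i (f j) = (if i = j then 1 else 0)" by blast
  define g where "g = f N - (\<Sum>i<N. l i (f N) *\<^sub>R f i)"
  have "g \<noteq> 0"
  proof
    assume "g = 0"
    then have "(\<Sum>i<Suc N. (if i = N then 1 else - l i (f N)) *\<^sub>R f i) = 0"
      unfolding g_def by (simp add: sum_negf)
    from Suc.prems[OF this] show False by auto
  qed
  then obtain x where x: "g x \<noteq> 0" by (auto simp: fun_eq_iff zero_fun_def)
  define L where "L = (1 / g x) *\<^sub>R ((\<lambda>h. h x) - (\<Sum>i<N. f i x *\<^sub>R l i))"
  have LE: "L \<in> eval_functionals" unfolding L_def
    using l by (intro subspace_scale[OF subspace_eval_functionals] subspace_diff[OF subspace_eval_functionals]
      subspace_sum[OF subspace_eval_functionals] eval_functionals_base) auto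
  have Lh: "L h = (h x - (\<Sum>i<N. f i x * l i h)) / g x" for h
    unfolding L_def by (simp add: scaleR_fun_apply sum_fun_apply)
  have Lf: "L (f j) = 0" if j: "j < N" for j
  proof -
    have "(\<Sum>i<N. f i x * l i (f j)) = (\<Sum>i<N. if i = j then f j x else 0)"
      using lf j by (intro sum.cong) auto
    then show ?thesis unfolding Lh using j by simp
  qed
  have LN: "L (f N) = 1"
  proof -
    have "g x = f N x - (\<Sum>i<N. f i x * l i (f N))"
      unfolding g_def by (simp add: sum_fun_apply scaleR_fun_apply mult.commute)
    then show ?thesis unfolding Lh using x by simp
  qed
  define l' where "l' i = (if i < N then l i - l i (f N) *\<^sub>R L else L)" for i
  have "l' i \<in> eval_functionals" if "i < Suc N" for i
    unfolding l'_def using l LE that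
    by (auto intro!: subspace_diff[OF subspace_eval_functionals] subspace_scale[OF subspace_eval_functionals])
  moreover have "l' i (f j) = (if i = j then 1 else 0)" if "i < Suc N" "j < Suc N" for i j
    using that lf Lf LN by (auto simp: l'_def scaleR_fun_apply less_Suc_eq)
  ultimately show ?case by blast
qed simp

section \<open>From characteristic functions to independent standard normal coordinates\<close>

text \<open>With \<open>g / c\<close> as density, \<open>P\<close> becomes a probability under which
  \<open>Y\<close> has the characteristic function of the standard normal law, so Levy uniqueness
  identifies its law. The constant \<open>c\<close> is the total mass of \<open>g\<close>, as
  \<open>u = 0\<close> shows; if it is 0, then \<open>g\<close> vanishes almost everywhere.\<close>

lemma weighted_std_normal:
  assumes P: "prob_space P" and Y[measurable]: "Y \<in> borel_measurable P" and g[measurable]: "g \<in> borel_measurable P"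
    and g0: "\<And>\<omega>. \<omega> \<in> space P \<Longrightarrow> 0 \<le> g \<omega>" and gK: "\<And>\<omega>. \<omega> \<in> space P \<Longrightarrow> g \<omega> \<le> K"
    and cosE: "\<And>u. (\<integral>\<omega>. g \<omega> * cos (u * Y \<omega>) \<partial>P) = c * exp (- u\<^sup>2 / 2)"
    and sinE: "\<And>u. (\<integral>\<omega>. g \<omega> * sin (u * Y \<omega>) \<partial>P) = 0"
    and B[measurable]: "B \<in> sets borel"
  shows "(\<integral>\<omega>. g \<omega> * indicator B (Y \<omega>) \<partial>P) = c * measure std_normal_distribution B"
proof -
  interpret prob_space P by (rule P)
  have int: "integrable P (\<lambda>\<omega>. g \<omega> * h \<omega>)" if [measurable]: "h \<in> borel_measurable P" and "\<And>\<omega>. \<bar>h \<omega>\<bar> \<le> 1" for h :: "_ \<Rightarrow> real"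
  proof (rule integrable_const_bound[of _ K])
    have "\<bar>g \<omega> * h \<omega>\<bar> \<le> K" if "\<omega> \<in> space P" for \<omega>
      using mult_mono[OF gK[OF that] \<open>\<bar>h \<omega>\<bar> \<le> 1\<close>] g0[OF that] gK[OF that] by (simp add: abs_mult)
    then show "AE \<omega> in P. norm (g \<omega> * h \<omega>) \<le> K" by simp
  qed measurable
  have intg: "integrable P g" using int[of "\<lambda>_. 1"] by simp
  have cE: "(\<integral>\<omega>. g \<omega> \<partial>P) = c" using cosE[of 0] by simp
  have c0: "c \<ge> 0" unfolding cE[symmetric] by (rule integral_nonneg_AE) (use g0 in simp)
  show ?thesis
  proof (cases "c = 0")
    case True
    have "AE \<omega> in P. g \<omega> = 0"
      using integral_nonneg_eq_0_iff_AE[OF intg] g0 cE True by simp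
    then have "(\<integral>\<omega>. g \<omega> * indicator B (Y \<omega>) \<partial>P) = (\<integral>\<omega>. 0 \<partial>P)"
      by (intro integral_cong_AE) auto
    then show ?thesis using True by simp
  next
    case False
    then have c: "c > 0" using c0 by simp
    define Q where "Q = density P (\<lambda>\<omega>. ennreal (g \<omega> / c))"
    have gc: "AE \<omega> in P. 0 \<le> g \<omega> / c" using g0 c by simp
    interpret Q: prob_space Q
    proof (rule prob_spaceI)
      have "emeasure Q (space Q) = (\<integral>\<^sup>+\<omega>. ennreal (g \<omega> / c) \<partial>P)"
        unfolding Q_def by (simp add: emeasure_density cong: nn_integral_cong)
      also have "\<dots> = ennreal (\<integral>\<omega>. g \<omega> / c \<partial>P)"
        by (rule nn_integral_eq_integral) (use intg gc in auto)
      finally show "emeasure Q (space Q) = 1" using cE c by simp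
    qed
    have YQ: "Y \<in> borel_measurable Q" unfolding Q_def by simp
    define \<mu> where "\<mu> = distr Q borel Y"
    have rd: "real_distribution \<mu>" unfolding \<mu>_def by (rule Q.real_distribution_distr) (rule YQ)
    have "char \<mu> u = char std_normal_distribution u" for u
    proof -
      have ie: "integrable P (\<lambda>\<omega>. (g \<omega> / c) *\<^sub>R iexp (u * Y \<omega>))"
      proof (rule integrable_const_bound[of _ "K / c"])
        show "AE \<omega> in P. norm ((g \<omega> / c) *\<^sub>R iexp (u * Y \<omega>)) \<le> K / c"
          using g0 gK c by (intro AE_I2) (simp add: divide_right_mono norm_mult)
      qed measurable
      have "char \<mu> u = (CLINT \<omega>|Q. iexp (u * Y \<omega>))"
        unfolding char_def \<mu>_def by (rule integral_distr) (use YQ in auto)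
      also have "\<dots> = (CLINT \<omega>|P. (g \<omega> / c) *\<^sub>R iexp (u * Y \<omega>))"
        unfolding Q_def by (rule integral_density) (use gc in measurable)
      also have "\<dots> = complex_of_real (exp (- u\<^sup>2 / 2))"
      proof (rule complex_eqI)
        have "Re (CLINT \<omega>|P. (g \<omega> / c) *\<^sub>R iexp (u * Y \<omega>)) = (\<integral>\<omega>. (g \<omega> * cos (u * Y \<omega>)) / c \<partial>P)"
          unfolding integral_Re[OF ie, symmetric] by (simp add: Re_exp)
        then show "Re (CLINT \<omega>|P. (g \<omega> / c) *\<^sub>R iexp (u * Y \<omega>)) = Re (complex_of_real (exp (- u\<^sup>2 / 2)))"
          using cosE[of u] c by simp
        have "Im (CLINT \<omega>|P. (g \<omega> / c) *\<^sub>R iexp (u * Y \<omega>)) = (\<integral>\<omega>. (g \<omega> * sin (u * Y \<omega>)) / c \<partial>P)"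
          unfolding integral_Im[OF ie, symmetric] by (simp add: Im_exp)
        then show "Im (CLINT \<omega>|P. (g \<omega> / c) *\<^sub>R iexp (u * Y \<omega>)) = Im (complex_of_real (exp (- u\<^sup>2 / 2)))"
          using sinE[of u] by simp
      qed
      finally show ?thesis by (simp add: char_std_normal_distribution)
    qed
    then have "\<mu> = std_normal_distribution"
      by (intro Levy_uniqueness rd real_dist_normal_dist ext)
    then have "measure std_normal_distribution B = measure Q (Y -` B \<inter> space Q)"
      unfolding \<mu>_def using measure_distr[OF YQ B] by simp
    also have "\<dots> = (\<integral>\<omega>. indicator (Y -` B \<inter> space Q) \<omega> \<partial>Q)"
      using measurable_sets[OF YQ B] by (simp add: Q.emeasure_eq_measure)
    also have "\<dots> = (\<integral>\<omega>. indicator B (Y \<omega>) \<partial>Q)"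
      by (intro Bochner_Integration.integral_cong) (auto simp: indicator_def)
    also have "\<dots> = (\<integral>\<omega>. (g \<omega> / c) *\<^sub>R indicator B (Y \<omega>) \<partial>P)"
      unfolding Q_def by (rule integral_density) (use gc in measurable)
    finally show ?thesis using c by simp
  qed
qed

text \<open>
  Levy's uniqueness theorem is only available on the line. It is applied to one coordinate at a
  time, with the remaining ones in the nonnegative weights \<open>1 + cos\<close> and \<open>1 + sin\<close> of a linear
  combination or in indicator functions.
\<close>

lemma gaussian_box_of_trig_moments:
  fixes \<xi> :: "nat \<Rightarrow> 'w \<Rightarrow> real"
  assumes P: "prob_space P" and xi: "\<And>i. i < N \<Longrightarrow> \<xi> i \<in> borel_measurable P"
    and cosE: "\<And>a. (\<integral>\<omega>. cos (\<Sum>i<N. a i * \<xi> i \<omega>) \<partial>P) = exp (- (\<Sum>i<N. (a i)\<^sup>2) / 2)"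
    and sinE: "\<And>a. (\<integral>\<omega>. sin (\<Sum>i<N. a i * \<xi> i \<omega>) \<partial>P) = 0"
    and B: "\<And>i. i < (N::nat) \<Longrightarrow> B i \<in> sets borel"
  shows "(\<integral>\<omega>. (\<Prod>i<N. indicator (B i) (\<xi> i \<omega>)) \<partial>P) = (\<Prod>i<N. measure std_normal_distribution (B i))"
proof -
  interpret prob_space P by (rule P)
  \<comment> \<open>Backward induction on \<open>k\<close>: coordinates from \<open>k\<close> on
    enter through indicators, those below \<open>k\<close> still through trigonometric functions. At
    \<open>k = N\<close> these are the hypotheses, at \<open>k = 0\<close> the claim.\<close>
  define H where "H k \<omega> = (\<Prod>i\<in>{k..<N}. indicator (B i) (\<xi> i \<omega>) :: real)" for k \<omega>
  define Z where "Z k a \<omega> = (\<Sum>i<k. a i * \<xi> i \<omega>)" for k and a :: "nat \<Rightarrow> real" and \<omega>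
  define \<pi> where "\<pi> k = (\<Prod>i\<in>{k..<N}. measure std_normal_distribution (B i))" for k
  have indm: "(\<lambda>\<omega>. indicator (B i) (\<xi> i \<omega>) :: real) \<in> borel_measurable P" if "i < N" for i
    using xi[OF that] B[OF that] by measurable
  have Hm[measurable]: "H k \<in> borel_measurable P" for k unfolding H_def using indm by (intro borel_measurable_prod) auto
  have Zm: "Z k a \<in> borel_measurable P" if "k \<le> N" for k a
    unfolding Z_def using xi that by (intro borel_measurable_sum borel_measurable_times) auto
  have H01: "0 \<le> H k \<omega>" "H k \<omega> \<le> 1" for k \<omega>
    unfolding H_def by (auto intro!: prod_nonneg prod_le_1)
  have int: "integrable P (\<lambda>\<omega>. H k \<omega> * f \<omega>)" if [measurable]: "f \<in> borel_measurable P" and "\<And>\<omega>. \<bar>f \<omega>\<bar> \<le> 1" for f :: "_ \<Rightarrow> real" and k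
  proof (rule integrable_const_bound[of _ 1])
    have "\<bar>H k \<omega> * f \<omega>\<bar> \<le> 1" for \<omega>
      using mult_mono[OF H01(2)[of k \<omega>] that(2)[of \<omega>]] H01(1)[of k \<omega>] by (simp add: abs_mult)
    then show "AE \<omega> in P. norm (H k \<omega> * f \<omega>) \<le> 1" by simp
  qed measurable
  have claim: "(\<forall>a. (\<integral>\<omega>. H 0 \<omega> * cos (Z 0 a \<omega>) \<partial>P) = \<pi> 0 * exp (- (\<Sum>i<0. (a i)\<^sup>2) / 2) \<and> (\<integral>\<omega>. H 0 \<omega> * sin (Z 0 a \<omega>) \<partial>P) = 0)"
  proof (rule inc_induct[of 0 N "\<lambda>k. (\<forall>a. (\<integral>\<omega>. H k \<omega> * cos (Z k a \<omega>) \<partial>P) = \<pi> k * exp (- (\<Sum>i<k. (a i)\<^sup>2) / 2) \<and> (\<integral>\<omega>. H k \<omega> * sin (Z k a \<omega>) \<partial>P) = 0)"])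
    show "\<forall>a. (\<integral>\<omega>. H N \<omega> * cos (Z N a \<omega>) \<partial>P) = \<pi> N * exp (- (\<Sum>i<N. (a i)\<^sup>2) / 2) \<and> (\<integral>\<omega>. H N \<omega> * sin (Z N a \<omega>) \<partial>P) = 0"
      unfolding H_def \<pi>_def Z_def by (simp add: cosE sinE)
  next
    fix k assume k: "0 \<le> k" "k < N"
      and IH: "\<forall>a. (\<integral>\<omega>. H (Suc k) \<omega> * cos (Z (Suc k) a \<omega>) \<partial>P) = \<pi> (Suc k) * exp (- (\<Sum>i<Suc k. (a i)\<^sup>2) / 2) \<and> (\<integral>\<omega>. H (Suc k) \<omega> * sin (Z (Suc k) a \<omega>) \<partial>P) = 0"
    have Hk: "H k \<omega> = H (Suc k) \<omega> * indicator (B k) (\<xi> k \<omega>)" for \<omega>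
      unfolding H_def prod.atLeast_Suc_lessThan[OF k(2)] by simp
    have \<pi>k: "\<pi> k = \<pi> (Suc k) * measure std_normal_distribution (B k)"
      unfolding \<pi>_def prod.atLeast_Suc_lessThan[OF k(2)] by simp
    define h where "h = H (Suc k)"
    have [measurable]: "h \<in> borel_measurable P" unfolding h_def by (rule Hm)
    have [measurable]: "\<xi> k \<in> borel_measurable P" by (rule xi[OF k(2)])
    have h01: "0 \<le> h \<omega>" "h \<omega> \<le> 1" for \<omega> unfolding h_def by (rule H01)+
    show "\<forall>a. (\<integral>\<omega>. H k \<omega> * cos (Z k a \<omega>) \<partial>P) = \<pi> k * exp (- (\<Sum>i<k. (a i)\<^sup>2) / 2) \<and> (\<integral>\<omega>. H k \<omega> * sin (Z k a \<omega>) \<partial>P) = 0"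
    proof
      fix a :: "nat \<Rightarrow> real"
      define s where "s = (\<Sum>i<k. (a i)\<^sup>2)"
      have [measurable]: "Z k a \<in> borel_measurable P" by (rule Zm) (use k in simp)
      \<comment> \<open>Giving the \<open>k\<close>-th coefficient the value \<open>u\<close> adds
        \<open>u * \<xi> k\<close> to the phase; if the earlier coefficients are also set to 0,
        coordinate \<open>k\<close> is isolated.\<close>
      have C: "(\<integral>\<omega>. h \<omega> * cos (Z k a \<omega> + u * \<xi> k \<omega>) \<partial>P) = \<pi> (Suc k) * exp (- (s + u\<^sup>2) / 2)"
        and S: "(\<integral>\<omega>. h \<omega> * sin (Z k a \<omega> + u * \<xi> k \<omega>) \<partial>P) = 0" for u
        using IH[rule_format, of "a(k := u)"] unfolding h_def Z_def s_def by simp_all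
      have C0: "(\<integral>\<omega>. h \<omega> * cos (u * \<xi> k \<omega>) \<partial>P) = \<pi> (Suc k) * exp (- u\<^sup>2 / 2)"
        and S0: "(\<integral>\<omega>. h \<omega> * sin (u * \<xi> k \<omega>) \<partial>P) = 0" for u
        using IH[rule_format, of "\<lambda>i. if i = k then u else 0"] unfolding h_def Z_def by simp_all
      have ic: "integrable P (\<lambda>\<omega>. h \<omega> * cos (f \<omega>))" "integrable P (\<lambda>\<omega>. h \<omega> * sin (f \<omega>))" if [measurable]: "f \<in> borel_measurable P" for f
        unfolding h_def by (rule int; simp)+
      have i1: "integrable P h" using ic(1)[of "\<lambda>_. 0"] by simp
      have b1: "(\<integral>\<omega>. h \<omega> * indicator (B k) (\<xi> k \<omega>) \<partial>P) = \<pi> (Suc k) * measure std_normal_distribution (B k)"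
        by (rule weighted_std_normal[OF P _ _ h01 C0 S0 B[OF k(2)]]) simp_all
      \<comment> \<open>Product formulas turn the weight times \<open>cos (u * \<xi> k)\<close> or
        \<open>sin (u * \<xi> k)\<close> into terms with phase \<open>Z k a\<close> plus or minus
        \<open>u * \<xi> k\<close>, which \<open>C\<close> and \<open>S\<close> evaluate. The
        summand 1, present for nonnegativity of the weight, is removed afterwards by subtracting
        \<open>b1\<close>.\<close>
      have b2: "(\<integral>\<omega>. (h \<omega> * (1 + cos (Z k a \<omega>))) * indicator (B k) (\<xi> k \<omega>) \<partial>P) =
          (\<pi> (Suc k) * (1 + exp (- s / 2))) * measure std_normal_distribution (B k)"
      proof (rule weighted_std_normal[OF P, where K = 2])
        fix \<omega>
        have "0 \<le> 1 + cos (Z k a \<omega>)" "1 + cos (Z k a \<omega>) \<le> 2" using cos_ge_minus_one[of "Z k a \<omega>"] cos_le_one[of "Z k a \<omega>"] by linarith+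
        then show "0 \<le> h \<omega> * (1 + cos (Z k a \<omega>))" "h \<omega> * (1 + cos (Z k a \<omega>)) \<le> 2"
          using h01[of \<omega>] mult_mono[OF h01(2)[of \<omega>], of "1 + cos (Z k a \<omega>)" 2] by simp_all
      next
        fix u
        have e: "(h \<omega> * (1 + cos (Z k a \<omega>))) * cos (u * \<xi> k \<omega>) = h \<omega> * cos (u * \<xi> k \<omega>) +
           (1/2) * (h \<omega> * cos (Z k a \<omega> + u * \<xi> k \<omega>) + h \<omega> * cos (Z k a \<omega> + (- u) * \<xi> k \<omega>))" for \<omega>
          by (simp add: cos_add cos_diff algebra_simps)
        have "exp (- (s + u\<^sup>2) / 2) = exp (- s / 2) * exp (- u\<^sup>2 / 2)"
          by (simp add: exp_add[symmetric] diff_divide_distrib add_divide_distrib)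
        then show "(\<integral>\<omega>. (h \<omega> * (1 + cos (Z k a \<omega>))) * cos (u * \<xi> k \<omega>) \<partial>P) = \<pi> (Suc k) * (1 + exp (- s / 2)) * exp (- u\<^sup>2 / 2)"
          unfolding e by (simp add: ic C C0 C[of "- u", simplified] algebra_simps)
        have e: "(h \<omega> * (1 + cos (Z k a \<omega>))) * sin (u * \<xi> k \<omega>) = h \<omega> * sin (u * \<xi> k \<omega>) +
           (1/2) * (h \<omega> * sin (Z k a \<omega> + u * \<xi> k \<omega>) - h \<omega> * sin (Z k a \<omega> + (- u) * \<xi> k \<omega>))" for \<omega>
          by (simp add: sin_add sin_diff algebra_simps)
        show "(\<integral>\<omega>. (h \<omega> * (1 + cos (Z k a \<omega>))) * sin (u * \<xi> k \<omega>) \<partial>P) = 0"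
          unfolding e by (simp add: ic S S0 S[of "- u", simplified])
      qed (simp_all add: B[OF k(2)])
      have b3: "(\<integral>\<omega>. (h \<omega> * (1 + sin (Z k a \<omega>))) * indicator (B k) (\<xi> k \<omega>) \<partial>P) =
          \<pi> (Suc k) * measure std_normal_distribution (B k)"
      proof (rule weighted_std_normal[OF P, where K = 2])
        fix \<omega>
        have "0 \<le> 1 + sin (Z k a \<omega>)" "1 + sin (Z k a \<omega>) \<le> 2" using sin_ge_minus_one[of "Z k a \<omega>"] sin_le_one[of "Z k a \<omega>"] by linarith+
        then show "0 \<le> h \<omega> * (1 + sin (Z k a \<omega>))" "h \<omega> * (1 + sin (Z k a \<omega>)) \<le> 2"
          using h01[of \<omega>] mult_mono[OF h01(2)[of \<omega>], of "1 + sin (Z k a \<omega>)" 2] by simp_all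
      next
        fix u
        have e: "(h \<omega> * (1 + sin (Z k a \<omega>))) * cos (u * \<xi> k \<omega>) = h \<omega> * cos (u * \<xi> k \<omega>) +
           (1/2) * (h \<omega> * sin (Z k a \<omega> + u * \<xi> k \<omega>) + h \<omega> * sin (Z k a \<omega> + (- u) * \<xi> k \<omega>))" for \<omega>
          by (simp add: sin_add sin_diff algebra_simps)
        show "(\<integral>\<omega>. (h \<omega> * (1 + sin (Z k a \<omega>))) * cos (u * \<xi> k \<omega>) \<partial>P) = \<pi> (Suc k) * exp (- u\<^sup>2 / 2)"
          unfolding e by (simp add: ic S C0 S[of "- u", simplified])
        have e: "(h \<omega> * (1 + sin (Z k a \<omega>))) * sin (u * \<xi> k \<omega>) = h \<omega> * sin (u * \<xi> k \<omega>) +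
           (1/2) * (h \<omega> * cos (Z k a \<omega> + (- u) * \<xi> k \<omega>) - h \<omega> * cos (Z k a \<omega> + u * \<xi> k \<omega>))" for \<omega>
          by (simp add: cos_add cos_diff algebra_simps)
        show "(\<integral>\<omega>. (h \<omega> * (1 + sin (Z k a \<omega>))) * sin (u * \<xi> k \<omega>) \<partial>P) = 0"
          unfolding e by (simp add: ic C S0 C[of "- u", simplified])
      qed (simp_all add: B[OF k(2)])
      have bi: "integrable P (\<lambda>\<omega>. h \<omega> * indicator (B k) (\<xi> k \<omega>))"
        unfolding h_def by (rule int) (use indm[OF k(2)] in \<open>auto simp: indicator_def\<close>)
      have ci: "integrable P (\<lambda>\<omega>. h \<omega> * (indicator (B k) (\<xi> k \<omega>) * f (Z k a \<omega>)))"
        if [measurable]: "f \<in> borel_measurable borel" and "\<And>z. \<bar>f z\<bar> \<le> 1" for f :: "real \<Rightarrow> real"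
        unfolding h_def by (rule int) (use indm[OF k(2)] that(2) in \<open>auto simp: indicator_def\<close>)
      have e: "h \<omega> * (1 + f (Z k a \<omega>)) * indicator (B k) (\<xi> k \<omega>) = h \<omega> * indicator (B k) (\<xi> k \<omega>) + h \<omega> * (indicator (B k) (\<xi> k \<omega>) * f (Z k a \<omega>))" for f and \<omega>
        by (simp add: algebra_simps)
      have "(\<integral>\<omega>. h \<omega> * (indicator (B k) (\<xi> k \<omega>) * cos (Z k a \<omega>)) \<partial>P) = \<pi> k * exp (- s / 2)"
      proof -
        have "(\<integral>\<omega>. h \<omega> * indicator (B k) (\<xi> k \<omega>) + h \<omega> * (indicator (B k) (\<xi> k \<omega>) * cos (Z k a \<omega>)) \<partial>P) =
          (\<integral>\<omega>. h \<omega> * indicator (B k) (\<xi> k \<omega>) \<partial>P) + (\<integral>\<omega>. h \<omega> * (indicator (B k) (\<xi> k \<omega>) * cos (Z k a \<omega>)) \<partial>P)"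
          by (rule Bochner_Integration.integral_add[OF bi ci]) simp_all
        with b2[unfolded e] b1 show ?thesis unfolding \<pi>k by (simp add: ring_distribs)
      qed
      moreover have "(\<integral>\<omega>. h \<omega> * (indicator (B k) (\<xi> k \<omega>) * sin (Z k a \<omega>)) \<partial>P) = 0"
      proof -
        have "(\<integral>\<omega>. h \<omega> * indicator (B k) (\<xi> k \<omega>) + h \<omega> * (indicator (B k) (\<xi> k \<omega>) * sin (Z k a \<omega>)) \<partial>P) =
          (\<integral>\<omega>. h \<omega> * indicator (B k) (\<xi> k \<omega>) \<partial>P) + (\<integral>\<omega>. h \<omega> * (indicator (B k) (\<xi> k \<omega>) * sin (Z k a \<omega>)) \<partial>P)"
          by (rule Bochner_Integration.integral_add[OF bi ci]) simp_all
        with b3[unfolded e] b1 show ?thesis by simp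
      qed
      ultimately show "(\<integral>\<omega>. H k \<omega> * cos (Z k a \<omega>) \<partial>P) = \<pi> k * exp (- (\<Sum>i<k. (a i)\<^sup>2) / 2) \<and> (\<integral>\<omega>. H k \<omega> * sin (Z k a \<omega>) \<partial>P) = 0"
        unfolding Hk h_def s_def by (simp add: mult.assoc)
    qed
  qed simp
  then show ?thesis by (simp add: H_def Z_def \<pi>_def atLeast0LessThan)
qed

text \<open>\<open>Y / \<sigma>\<close> is standard normal, so the characteristic function of
  \<open>Y\<close> at 1 is the standard normal one at \<open>\<sigma>\<close>; its real and
  imaginary parts are the first two claims.\<close>

lemma normal_trig_moments:
  assumes P: "prob_space P" and \<sigma>: "\<sigma> > 0"
    and Y: "distributed P lborel Y (\<lambda>y. ennreal (normal_density 0 \<sigma> y))"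
  shows "(\<integral>\<omega>. cos (Y \<omega>) \<partial>P) = exp (- \<sigma>\<^sup>2 / 2)" "(\<integral>\<omega>. sin (Y \<omega>) \<partial>P) = 0"
    "integrable P (\<lambda>\<omega>. (Y \<omega>)\<^sup>2)" "(\<integral>\<omega>. (Y \<omega>)\<^sup>2 \<partial>P) = \<sigma>\<^sup>2"
proof -
  interpret prob_space P by (rule P)
  have Ym[measurable]: "Y \<in> borel_measurable P" using distributed_measurable[OF Y] by simp
  have m: "has_bochner_integral lborel (\<lambda>x. normal_density 0 \<sigma> x * x\<^sup>2) (\<sigma>\<^sup>2)"
    using normal_moment_even[OF \<sigma>, of 0 1] by (simp add: fact_numeral)
  show "integrable P (\<lambda>\<omega>. (Y \<omega>)\<^sup>2)"
    using distributed_integrable[OF Y, of "\<lambda>y. y\<^sup>2"] has_bochner_integral_iff[THEN iffD1, OF m] by simp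
  show "(\<integral>\<omega>. (Y \<omega>)\<^sup>2 \<partial>P) = \<sigma>\<^sup>2"
    using distributed_integral[OF Y, of "\<lambda>y. y\<^sup>2"] has_bochner_integral_iff[THEN iffD1, OF m] by simp
  have "distributed P lborel (\<lambda>\<omega>. 0 + (1 / \<sigma>) * Y \<omega>) (\<lambda>y. ennreal (normal_density (0 + (1 / \<sigma>) * 0) (\<bar>1 / \<sigma>\<bar> * \<sigma>) y))"
    by (rule normal_density_affine[OF Y \<sigma>]) (use \<sigma> in simp)
  then have Z: "distributed P lborel (\<lambda>\<omega>. Y \<omega> / \<sigma>) (\<lambda>y. ennreal (std_normal_density y))"
    using \<sigma> by simp
  then have d: "distr P lborel (\<lambda>\<omega>. Y \<omega> / \<sigma>) = std_normal_distribution"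
    by (rule distributed_distr_eq_density)
  have ie: "integrable P (\<lambda>\<omega>. iexp (Y \<omega>))"
    by (rule integrable_const_bound[of _ 1]) (auto simp: norm_exp_eq_Re)
  have "(CLINT \<omega>|P. iexp (Y \<omega>)) = (CLINT y|distr P lborel (\<lambda>\<omega>. Y \<omega> / \<sigma>). iexp (\<sigma> * y))"
    using \<sigma> by (subst integral_distr) auto
  also have "\<dots> = char std_normal_distribution \<sigma>" unfolding d char_def ..
  finally have c: "(CLINT \<omega>|P. iexp (Y \<omega>)) = complex_of_real (exp (- \<sigma>\<^sup>2 / 2))"
    by (simp add: char_std_normal_distribution)
  show "(\<integral>\<omega>. cos (Y \<omega>) \<partial>P) = exp (- \<sigma>\<^sup>2 / 2)"
    using integral_Re[OF ie] unfolding c by (simp add: Re_exp)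
  show "(\<integral>\<omega>. sin (Y \<omega>) \<partial>P) = 0"
    using integral_Im[OF ie] unfolding c by (simp add: Im_exp)
qed

text \<open>A nontrivial combination of the coordinates \<open>l i (X \<omega>)\<close> is normal by
  hypothesis, and orthonormality for the covariance makes its variance the sum of the squared
  coefficients. So the trigonometric moments are those of independent standard normals. Applied to
  the coefficients \<open>v i x\<close>, the same computation gives the variance of \<open>X\<close>
  at \<open>x\<close>.\<close>

lemma ex_gaussian_coordinates:
  fixes F :: "('a \<Rightarrow> real) set"
  assumes P: "prob_space P" and F: "finite_dim_subspace F" and X: "centered_nondegenerate_gaussian P F X"
    and Xm: "\<And>x. (\<lambda>\<omega>. X \<omega> x) \<in> borel_measurable P"
  obtains N l v where "\<And>i. i < N \<Longrightarrow> l i \<in> eval_functionals" "\<And>i. i < (N::nat) \<Longrightarrow> v i \<in> F"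
    "\<And>f. f \<in> F \<Longrightarrow> f = (\<Sum>i<N. l i f *\<^sub>R v i)"
    "\<forall>B. (\<forall>i<N. B i \<in> sets borel) \<longrightarrow>
       (\<integral>\<omega>. (\<Prod>i<N. indicator (B i) (l i (X \<omega>))) \<partial>P) = (\<Prod>i<N. measure std_normal_distribution (B i))"
    "\<And>x. (\<integral>\<omega>. (X \<omega> x)\<^sup>2 \<partial>P) = (\<Sum>i<N. (v i x)\<^sup>2)"
proof -
  interpret prob_space P by (rule P)
  define B where "B L M = (\<integral>\<omega>. L (X \<omega>) * M (X \<omega>) \<partial>P)" for L M :: "('a \<Rightarrow> real) \<Rightarrow> real"
  have XF: "X \<omega> \<in> F" if "\<omega> \<in> space P" for \<omega> using X that by (simp add: centered_nondegenerate_gaussian_def)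
  have normal: "\<exists>\<sigma>>0. distributed P lborel (\<lambda>\<omega>. L (X \<omega>)) (\<lambda>y. ennreal (normal_density 0 \<sigma> y))"
    if "L \<in> eval_functionals" "f \<in> F" "L f \<noteq> 0" for L f
    using X eval_functional_linear[OF that(1)] that(2,3) unfolding centered_nondegenerate_gaussian_def by blast
  have meas: "(\<lambda>\<omega>. L (X \<omega>)) \<in> borel_measurable P" if "L \<in> eval_functionals" for L
    by (rule eval_functional_measurable[OF that Xm])
  have sq: "integrable P (\<lambda>\<omega>. (L (X \<omega>))\<^sup>2)" if L: "L \<in> eval_functionals" for L
  proof (cases "\<exists>f\<in>F. L f \<noteq> 0")
    case True
    then show ?thesis using normal[OF L] normal_trig_moments(3)[OF P] by blast
  next
    case False
    \<comment> \<open>A functional that vanishes on \<open>F\<close> is not covered by the Gaussian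
      hypothesis, but its value at \<open>X\<close> is 0.\<close>
    then have "integrable P (\<lambda>\<omega>. (L (X \<omega>))\<^sup>2) = integrable P (\<lambda>\<omega>. 0 :: real)"
      using XF by (intro Bochner_Integration.integrable_cong) auto
    then show ?thesis by simp
  qed
  have prod: "integrable P (\<lambda>\<omega>. L (X \<omega>) * M (X \<omega>))" if L: "L \<in> eval_functionals" and M: "M \<in> eval_functionals" for L M
  proof (rule Bochner_Integration.integrable_bound)
    show "integrable P (\<lambda>\<omega>. (L (X \<omega>))\<^sup>2 + (M (X \<omega>))\<^sup>2)" using sq[OF L] sq[OF M] by simp
    show "(\<lambda>\<omega>. L (X \<omega>) * M (X \<omega>)) \<in> borel_measurable P" using meas[OF L] meas[OF M] by simp
    have "\<bar>x * y\<bar> \<le> x\<^sup>2 + y\<^sup>2" for x y :: real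
    proof -
      have "2 * \<bar>x * y\<bar> \<le> x\<^sup>2 + y\<^sup>2"
        using sum_squares_bound[of "\<bar>x\<bar>" "\<bar>y\<bar>"] by (simp add: abs_mult)
      then show ?thesis using abs_ge_zero[of "x * y"] by linarith
    qed
    then show "AE \<omega> in P. norm (L (X \<omega>) * M (X \<omega>)) \<le> norm ((L (X \<omega>))\<^sup>2 + (M (X \<omega>))\<^sup>2)" by simp
  qed
  obtain N l v where l: "\<And>i. i < N \<Longrightarrow> l i \<in> eval_functionals" and v: "\<And>i. i < (N::nat) \<Longrightarrow> v i \<in> F"
    and lv: "\<And>i j. i < N \<Longrightarrow> j < N \<Longrightarrow> l i (v j) = (if i = j then 1 else 0)"
    and ll: "\<And>i j. i < N \<Longrightarrow> j < N \<Longrightarrow> B (l i) (l j) = (if i = j then 1 else 0)"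
    and rep: "\<And>f. f \<in> F \<Longrightarrow> f = (\<Sum>i<N. l i f *\<^sub>R v i)"
  proof (rule ex_orthonormal_functionals[OF F, of B])
    show "B L M = B M L" for L M unfolding B_def by (simp add: mult.commute)
    show "B (L + L') M = B L M + B L' M" if "L \<in> eval_functionals" "L' \<in> eval_functionals" "M \<in> eval_functionals" for L L' M
      unfolding B_def using prod that by (simp add: distrib_right)
    show "B (c *\<^sub>R L) M = c * B L M" for c L M unfolding B_def by (simp add: scaleR_fun_apply mult.assoc)
    show "B L L > 0" if L: "L \<in> eval_functionals" "f \<in> F" "L f \<noteq> 0" for L f
    proof -
      obtain \<sigma> where \<sigma>: "\<sigma> > 0" "distributed P lborel (\<lambda>\<omega>. L (X \<omega>)) (\<lambda>y. ennreal (normal_density 0 \<sigma> y))"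
        using normal[OF L] by blast
      have "B L L = \<sigma>\<^sup>2" unfolding B_def using normal_trig_moments(4)[OF P \<sigma>] by (simp add: power2_eq_square)
      then show ?thesis using \<sigma>(1) by simp
    qed
  qed (rule that)
  define \<xi> where "\<xi> i \<omega> = l i (X \<omega>)" for i \<omega>
  have comb: "(\<integral>\<omega>. (\<Sum>i<N. a i * \<xi> i \<omega>)\<^sup>2 \<partial>P) = (\<Sum>i<N. (a i)\<^sup>2)" for a
  proof -
    have "(\<integral>\<omega>. (\<Sum>i<N. a i * \<xi> i \<omega>)\<^sup>2 \<partial>P) = (\<integral>\<omega>. (\<Sum>i<N. \<Sum>j<N. a i * a j * (l i (X \<omega>) * l j (X \<omega>))) \<partial>P)"
      by (simp add: power2_eq_square sum_product \<xi>_def mult_ac)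
    also have "\<dots> = (\<Sum>i<N. \<Sum>j<N. a i * a j * B (l i) (l j))"
      unfolding B_def using prod l
      by (subst Bochner_Integration.integral_sum, fastforce, intro sum.cong refl,
          subst Bochner_Integration.integral_sum) auto
    also have "\<dots> = (\<Sum>i<N. \<Sum>j<N. if i = j then (a i)\<^sup>2 else 0)"
      by (intro sum.cong refl) (auto simp: ll power2_eq_square)
    finally show ?thesis by simp
  qed
  have trig: "(\<integral>\<omega>. cos (\<Sum>i<N. a i * \<xi> i \<omega>) \<partial>P) = exp (- (\<Sum>i<N. (a i)\<^sup>2) / 2) \<and> (\<integral>\<omega>. sin (\<Sum>i<N. a i * \<xi> i \<omega>) \<partial>P) = 0" for a
  proof (cases "\<forall>i<N. a i = 0")
    case True
    then show ?thesis by (simp add: prob_space)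
  next
    case False
    then obtain k where k: "k < N" "a k \<noteq> 0" by blast
    define L where "L = (\<Sum>i<N. a i *\<^sub>R l i)"
    have Lf: "L f = (\<Sum>i<N. a i * l i f)" for f unfolding L_def by (simp add: sum_fun_apply scaleR_fun_apply)
    have LE: "L \<in> eval_functionals" unfolding L_def
      using l by (intro subspace_sum[OF subspace_eval_functionals] subspace_scale[OF subspace_eval_functionals]) auto
    have "L (v k) = (\<Sum>i<N. if i = k then a i else 0)"
      unfolding Lf using lv k by (intro sum.cong) auto
    then have "L (v k) \<noteq> 0" using k by simp
    from normal[OF LE v[OF k(1)] this] obtain \<sigma> where \<sigma>: "\<sigma> > 0"
      "distributed P lborel (\<lambda>\<omega>. L (X \<omega>)) (\<lambda>y. ennreal (normal_density 0 \<sigma> y))" by blast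
    have "\<sigma>\<^sup>2 = (\<Sum>i<N. (a i)\<^sup>2)"
      using normal_trig_moments(4)[OF P \<sigma>] comb[of a] unfolding Lf \<xi>_def by simp
    then show ?thesis
      using normal_trig_moments(1,2)[OF P \<sigma>] unfolding Lf \<xi>_def by simp
  qed
  have box: "\<forall>C. (\<forall>i<N. C i \<in> sets borel) \<longrightarrow>
      (\<integral>\<omega>. (\<Prod>i<N. indicator (C i) (l i (X \<omega>))) \<partial>P) = (\<Prod>i<N. measure std_normal_distribution (C i))"
    using gaussian_box_of_trig_moments[OF P, of N \<xi>] trig meas[OF l] unfolding \<xi>_def by simp
  have var: "(\<integral>\<omega>. (X \<omega> x)\<^sup>2 \<partial>P) = (\<Sum>i<N. (v i x)\<^sup>2)" for x
  proof -
    have "(\<integral>\<omega>. (X \<omega> x)\<^sup>2 \<partial>P) = (\<integral>\<omega>. (\<Sum>i<N. v i x * \<xi> i \<omega>)\<^sup>2 \<partial>P)"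
    proof (intro Bochner_Integration.integral_cong refl)
      fix \<omega> assume "\<omega> \<in> space P"
      then have "X \<omega> x = (\<Sum>i<N. l i (X \<omega>) *\<^sub>R v i) x" using rep[OF XF] by simp
      then show "(X \<omega> x)\<^sup>2 = (\<Sum>i<N. v i x * \<xi> i \<omega>)\<^sup>2"
        unfolding \<xi>_def by (simp add: sum_fun_apply scaleR_fun_apply mult.commute)
    qed
    then show ?thesis using comb by simp
  qed
  show ?thesis by (rule that[OF l v rep box var])
qed

section \<open>Calculus of C1 functions, and smooth functions in charts\<close>

lemma C1_on_real_mult:
  fixes f g :: "'e::real_normed_vector \<Rightarrow> real"
  assumes "C1_on f S" "C1_on g S"
  shows "C1_on (\<lambda>x. f x * g x) S"
proof -
  obtain f' where f': "\<And>x. x \<in> S \<Longrightarrow> (f has_derivative blinfun_apply (f' x)) (at x)" "continuous_on S f'"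
    using assms(1) by (rule C1_onE) (rule that)
  obtain g' where g': "\<And>x. x \<in> S \<Longrightarrow> (g has_derivative blinfun_apply (g' x)) (at x)" "continuous_on S g'"
    using assms(2) by (rule C1_onE) (rule that)
  show ?thesis
  proof (rule C1_onI)
    show "((\<lambda>x. f x * g x) has_derivative blinfun_apply (f x *\<^sub>R g' x + g x *\<^sub>R f' x)) (at x)" if "x \<in> S" for x
      by (rule has_derivative_eq_rhs[OF has_derivative_mult[OF f'(1)[OF that] g'(1)[OF that]]])
        (simp add: fun_eq_iff blinfun.add_left blinfun.scaleR_left mult.commute)
    show "continuous_on S (\<lambda>x. f x *\<^sub>R g' x + g x *\<^sub>R f' x)"
      by (intro continuous_intros f'(2) g'(2) C1_on_continuous assms)
  qed
qed

lemma C1_on_add: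
  assumes "C1_on f S" "C1_on g S"
  shows "C1_on (\<lambda>x. f x + g x) S"
proof -
  obtain f' where f': "\<And>x. x \<in> S \<Longrightarrow> (f has_derivative blinfun_apply (f' x)) (at x)" "continuous_on S f'"
    using assms(1) by (rule C1_onE) (rule that)
  obtain g' where g': "\<And>x. x \<in> S \<Longrightarrow> (g has_derivative blinfun_apply (g' x)) (at x)" "continuous_on S g'"
    using assms(2) by (rule C1_onE) (rule that)
  show ?thesis
  proof (rule C1_onI)
    show "((\<lambda>x. f x + g x) has_derivative blinfun_apply (f' x + g' x)) (at x)" if "x \<in> S" for x
      by (rule has_derivative_eq_rhs[OF has_derivative_add[OF f'(1)[OF that] g'(1)[OF that]]])
        (simp add: fun_eq_iff blinfun.add_left)
    show "continuous_on S (\<lambda>x. f' x + g' x)" by (intro continuous_intros f'(2) g'(2))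
  qed
qed

lemma C1_on_const: "C1_on (\<lambda>x. c) S"
  by (rule C1_onI[where f' = "\<lambda>_. 0"]) (auto simp: zero_blinfun.rep_eq)

lemma C1_on_sum: "(\<And>i. i \<in> I \<Longrightarrow> C1_on (f i) S) \<Longrightarrow> C1_on (\<lambda>x. \<Sum>i\<in>I. f i x) S"
  by (induction I rule: infinite_finite_induct) (auto intro!: C1_on_const C1_on_add)

lemma C1_on_inverse:
  fixes f :: "'e::real_normed_vector \<Rightarrow> real"
  assumes "C1_on f S" and nz: "\<And>x. x \<in> S \<Longrightarrow> f x \<noteq> 0"
  shows "C1_on (\<lambda>x. inverse (f x)) S"
proof -
  obtain f' where f': "\<And>x. x \<in> S \<Longrightarrow> (f has_derivative blinfun_apply (f' x)) (at x)" "continuous_on S f'"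
    using assms(1) by (rule C1_onE) (rule that)
  show ?thesis
  proof (rule C1_onI)
    show "((\<lambda>x. inverse (f x)) has_derivative blinfun_apply ((- inverse (f x) * inverse (f x)) *\<^sub>R f' x)) (at x)" if "x \<in> S" for x
      by (rule has_derivative_eq_rhs[OF Deriv.has_derivative_inverse[OF nz[OF that] f'(1)[OF that]]])
        (simp add: fun_eq_iff blinfun.scaleR_left blinfun.minus_left mult_ac)
    show "continuous_on S (\<lambda>x. (- inverse (f x) * inverse (f x)) *\<^sub>R f' x)"
      by (intro continuous_intros f'(2) C1_on_continuous assms(1)) (use nz in auto)
  qed
qed

text \<open>Derivatives in the whole space are unique, so the local derivatives fit together to a
  single function, whose continuity is a local matter.\<close>

lemma C1_on_local:
  assumes "open S" and loc: "\<And>x. x \<in> S \<Longrightarrow> \<exists>T. open T \<and> x \<in> T \<and> C1_on f (S \<inter> T)"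
  shows "C1_on f S"
proof -
  define f' where "f' x = Blinfun (frechet_derivative f (at x))" for x
  have d: "f' x = D" if "(f has_derivative blinfun_apply D) (at x)" for x D
    unfolding f'_def frechet_derivative_at[OF that, symmetric] by (simp add: blinfun_apply_inverse)
  show ?thesis
  proof (rule C1_onI)
    fix x assume x: "x \<in> S"
    obtain T where T: "open T" "x \<in> T" "C1_on f (S \<inter> T)" using loc[OF x] by blast
    obtain D where D: "\<And>y. y \<in> S \<inter> T \<Longrightarrow> (f has_derivative blinfun_apply (D y)) (at y)"
      using T(3) by (rule C1_onE) (rule that)
    show "(f has_derivative blinfun_apply (f' x)) (at x)" using D[of x] d[OF D] x T(2) by simp
  next
    show "continuous_on S f'"
    proof (rule continuous_at_imp_continuous_on, rule ballI)
      fix x assume x: "x \<in> S"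
      obtain T where T: "open T" "x \<in> T" "C1_on f (S \<inter> T)" using loc[OF x] by blast
      obtain D where D: "\<And>y. y \<in> S \<inter> T \<Longrightarrow> (f has_derivative blinfun_apply (D y)) (at y)" "continuous_on (S \<inter> T) D"
        using T(3) by (rule C1_onE) (rule that)
      have "continuous_on (S \<inter> T) f'"
        by (rule continuous_on_cong[THEN iffD1, OF refl _ D(2)]) (simp add: d[OF D(1)])
      then show "isCont f' x"
        using continuous_on_eq_continuous_at[of "S \<inter> T" f'] \<open>open S\<close> T(1,2) x by blast
    qed
  qed
qed

lemma smooth_funs_imp_C1_along: "f \<in> smooth_funs A S \<Longrightarrow> C1_along A S f"
  unfolding smooth_funs_def C1_along_def by (fast intro: smooth_on_open_imp_C1)

lemma smooth_funs_UNIV_C1: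
  fixes A :: "('a::{t2_space,second_countable_topology} set \<times> ('a \<Rightarrow> 'e::euclidean_space)) set"
  assumes A: "smooth_atlas A" and f: "f \<in> smooth_funs A UNIV" and D: "(D, \<phi>) \<in> A"
  shows "C1_on (f \<circ> inv_into D \<phi>) (\<phi> ` D)"
proof -
  have Dh: "open D" "open (\<phi> ` D)" "homeomorphism D (\<phi> ` D) \<phi> (inv_into D \<phi>)"
    using A D unfolding smooth_atlas_def by auto
  show ?thesis
  proof (rule C1_on_local[OF Dh(2)])
    fix y assume y: "y \<in> \<phi> ` D"
    obtain V g where g: "open V" "inv_into D \<phi> y \<in> V" "smooth_on_open A g V" "\<forall>z\<in>V \<inter> UNIV. g z = f z"
      using f unfolding smooth_funs_def by blast
    have inv: "inv_into D \<phi> z \<in> D" "\<phi> (inv_into D \<phi> z) = z" if "z \<in> \<phi> ` D" for z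
      using that Dh(3) by (auto simp: homeomorphism_def)
    have o: "open (\<phi> ` D \<inter> inv_into D \<phi> -` V)"
      by (rule continuous_open_preimage[OF _ Dh(2) g(1)]) (use Dh(3) in \<open>simp add: homeomorphism_def\<close>)
    have C: "C1_on (g \<circ> inv_into D \<phi>) (\<phi> ` (D \<inter> V))"
      using smooth_on_open_imp_C1[OF g(3)] D unfolding C1_on_open_def by blast
    have "C1_on (f \<circ> inv_into D \<phi>) (\<phi> ` D \<inter> inv_into D \<phi> -` V)"
    proof (rule C1_on_cong[OF _ o])
      show "C1_on (g \<circ> inv_into D \<phi>) (\<phi> ` D \<inter> inv_into D \<phi> -` V)"
      proof (rule C1_on_subset[OF C], rule subsetI)
        fix z assume "z \<in> \<phi> ` D \<inter> inv_into D \<phi> -` V"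
        then show "z \<in> \<phi> ` (D \<inter> V)" using inv[of z] by (metis IntD1 IntD2 IntI imageI vimageD)
      qed
    qed (use g(4) in auto)
    then show "\<exists>T. open T \<and> y \<in> T \<and> C1_on (f \<circ> inv_into D \<phi>) (\<phi> ` D \<inter> T)"
      using o y g(2) by (intro exI[of _ "\<phi> ` D \<inter> inv_into D \<phi> -` V"]) (simp add: Int_absorb1)
  qed
qed

section \<open>Product Gaussian laws and the ratio of expected counts\<close>

lemma prob_space_std_normal: "prob_space std_normal_distribution"
  by (rule real_distribution.axioms(1)[OF real_dist_normal_dist])

lemma sets_PiM_std_normal: "sets (Pi\<^sub>M K (\<lambda>_. std_normal_distribution)) = sets (Pi\<^sub>M K (\<lambda>_. lborel :: real measure))"
  by (rule sets_PiM_cong) simp_all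

lemma PiM_std_normal_eq_density:
  assumes K: "finite K"
  shows "Pi\<^sub>M K (\<lambda>_. std_normal_distribution) =
    density (Pi\<^sub>M K (\<lambda>_. lborel)) (\<lambda>\<theta>. \<Prod>k\<in>K. ennreal (std_normal_density (\<theta> k)))"
proof -
  interpret L: product_sigma_finite "\<lambda>_. lborel :: real measure" ..
  interpret N: product_sigma_finite "\<lambda>_. std_normal_distribution"
    by (simp add: product_sigma_finite_def prob_space_imp_sigma_finite[OF prob_space_std_normal])
  let ?p = "\<lambda>\<theta>. \<Prod>k\<in>K. ennreal (std_normal_density (\<theta> k))"
  have comp: "(\<lambda>\<theta>. \<theta> k) \<in> borel_measurable (Pi\<^sub>M K (\<lambda>_. lborel :: real measure))" if "k \<in> K" for k
    using measurable_component_singleton[OF that, of "\<lambda>_. lborel :: real measure"] by simp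
  have pm: "?p \<in> borel_measurable (Pi\<^sub>M K (\<lambda>_. lborel))"
    using comp by (intro borel_measurable_prod_ennreal) (auto intro!: measurable_compose[OF comp])
  show ?thesis
  proof (rule N.PiM_eqI[OF K, symmetric])
    show "sets (density (Pi\<^sub>M K (\<lambda>_. lborel)) ?p) = sets (Pi\<^sub>M K (\<lambda>_. std_normal_distribution))"
      by (simp add: sets_PiM_std_normal)
    fix A assume A: "\<And>i. i \<in> K \<Longrightarrow> A i \<in> sets std_normal_distribution"
    have "emeasure (density (Pi\<^sub>M K (\<lambda>_. lborel)) ?p) (Pi\<^sub>E K A) =
       (\<integral>\<^sup>+\<theta>. ?p \<theta> * indicator (Pi\<^sub>E K A) \<theta> \<partial>Pi\<^sub>M K (\<lambda>_. lborel))"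
      by (rule emeasure_density[OF pm]) (use A K in \<open>auto intro!: sets_PiM_I_finite\<close>)
    also have "\<dots> = (\<integral>\<^sup>+\<theta>. (\<Prod>k\<in>K. ennreal (std_normal_density (\<theta> k)) * indicator (A k) (\<theta> k)) \<partial>Pi\<^sub>M K (\<lambda>_. lborel))"
    proof (rule nn_integral_cong)
      fix \<theta> assume "\<theta> \<in> space (Pi\<^sub>M K (\<lambda>_. lborel :: real measure))"
      then have "indicator (Pi\<^sub>E K A) \<theta> = (\<Prod>k\<in>K. indicator (A k) (\<theta> k) :: ennreal)"
        using K by (auto simp: indicator_def space_PiM PiE_iff prod_zero_iff)
      then show "?p \<theta> * indicator (Pi\<^sub>E K A) \<theta> = (\<Prod>k\<in>K. ennreal (std_normal_density (\<theta> k)) * indicator (A k) (\<theta> k))"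
        by (simp add: prod.distrib)
    qed
    also have "\<dots> = (\<Prod>k\<in>K. \<integral>\<^sup>+y. ennreal (std_normal_density y) * indicator (A k) y \<partial>lborel)"
      by (rule L.product_nn_integral_prod[OF K]) (use A in auto)
    also have "\<dots> = (\<Prod>k\<in>K. emeasure std_normal_distribution (A k))"
      by (rule prod.cong) (use A in \<open>auto simp: emeasure_density\<close>)
    finally show "emeasure (density (Pi\<^sub>M K (\<lambda>_. lborel)) ?p) (Pi\<^sub>E K A) = (\<Prod>k\<in>K. emeasure std_normal_distribution (A k))" .
  qed
qed

lemma distr_eq_PiM_std_normal:
  assumes P: "prob_space P" and K: "finite K" and m: "\<And>k. k \<in> K \<Longrightarrow> \<Xi> k \<in> borel_measurable P"
    and box: "\<And>B. (\<And>k. k \<in> K \<Longrightarrow> B k \<in> sets borel) \<Longrightarrow>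
      measure P {\<omega>\<in>space P. \<forall>k\<in>K. \<Xi> k \<omega> \<in> B k} = (\<Prod>k\<in>K. measure std_normal_distribution (B k))"
  shows "distr P (Pi\<^sub>M K (\<lambda>_. lborel)) (\<lambda>\<omega>. \<lambda>k\<in>K. \<Xi> k \<omega>) = Pi\<^sub>M K (\<lambda>_. std_normal_distribution)"
proof -
  interpret prob_space P by (rule P)
  interpret G: prob_space std_normal_distribution by (rule prob_space_std_normal)
  interpret N: product_sigma_finite "\<lambda>_. std_normal_distribution"
    by (simp add: product_sigma_finite_def prob_space_imp_sigma_finite[OF prob_space_std_normal])
  have mm: "(\<lambda>\<omega>. \<lambda>k\<in>K. \<Xi> k \<omega>) \<in> measurable P (Pi\<^sub>M K (\<lambda>_. lborel))"
    by (intro measurable_restrict) (simp add: m)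
  show ?thesis
  proof (rule N.PiM_eqI[OF K])
    show "sets (distr P (Pi\<^sub>M K (\<lambda>_. lborel)) (\<lambda>\<omega>. \<lambda>k\<in>K. \<Xi> k \<omega>)) = sets (Pi\<^sub>M K (\<lambda>_. std_normal_distribution))"
      by (simp add: sets_PiM_std_normal)
    fix A assume A: "\<And>i. i \<in> K \<Longrightarrow> A i \<in> sets std_normal_distribution"
    have "emeasure (distr P (Pi\<^sub>M K (\<lambda>_. lborel)) (\<lambda>\<omega>. \<lambda>k\<in>K. \<Xi> k \<omega>)) (Pi\<^sub>E K A) =
       emeasure P ((\<lambda>\<omega>. \<lambda>k\<in>K. \<Xi> k \<omega>) -` Pi\<^sub>E K A \<inter> space P)"
      by (rule emeasure_distr[OF mm]) (use A K in \<open>auto intro!: sets_PiM_I_finite\<close>)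
    also have "(\<lambda>\<omega>. \<lambda>k\<in>K. \<Xi> k \<omega>) -` Pi\<^sub>E K A \<inter> space P = {\<omega>\<in>space P. \<forall>k\<in>K. \<Xi> k \<omega> \<in> A k}"
      by (auto simp: PiE_iff)
    also have "emeasure P \<dots> = (\<Prod>k\<in>K. emeasure std_normal_distribution (A k))"
      using box[of A] A by (simp add: emeasure_eq_measure G.emeasure_eq_measure prod_ennreal)
    finally show "emeasure (distr P (Pi\<^sub>M K (\<lambda>_. lborel)) (\<lambda>\<omega>. \<lambda>k\<in>K. \<Xi> k \<omega>)) (Pi\<^sub>E K A) = (\<Prod>k\<in>K. emeasure std_normal_distribution (A k))" .
  qed
qed

lemma independent_rv_prob:
  assumes P: "prob_space P" and ind: "independent_rv P M X N Y" and B: "B \<in> sets M" and C: "C \<in> sets N"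
  shows "measure P {\<omega>\<in>space P. X \<omega> \<in> B \<and> Y \<omega> \<in> C} = measure P {\<omega>\<in>space P. X \<omega> \<in> B} * measure P {\<omega>\<in>space P. Y \<omega> \<in> C}"
proof -
  interpret prob_space P by (rule P)
  have "measure P ((X -` B \<inter> space P) \<inter> (Y -` C \<inter> space P)) = measure P (X -` B \<inter> space P) * measure P (Y -` C \<inter> space P)"
    using ind B C unfolding independent_rv_def by (intro indep_setD) auto
  moreover have "(X -` B \<inter> space P) \<inter> (Y -` C \<inter> space P) = {\<omega>\<in>space P. X \<omega> \<in> B \<and> Y \<omega> \<in> C}"
    "X -` B \<inter> space P = {\<omega>\<in>space P. X \<omega> \<in> B}" "Y -` C \<inter> space P = {\<omega>\<in>space P. Y \<omega> \<in> C}" by auto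
  ultimately show ?thesis by simp
qed

text \<open>Independence gives \<open>(c, \<Xi>)\<close> a product law. Fubini then puts the
  variables of \<open>K1\<close> outside, under their Gaussian law, since they will fix the
  right-hand side of the system. Those of \<open>I\<close> and \<open>K0\<close> go inside and are
  written with a density against Lebesgue measure, the form in which they can be translated.\<close>

lemma nn_integral_joint_law:
  fixes c \<Xi> :: "'w \<Rightarrow> 'j \<Rightarrow> real" and I K0 K1 :: "'j set"
  defines "L \<equiv> \<lambda>_::'j. lborel :: real measure"
  assumes P: "prob_space P" and fin: "finite I" "finite K0" "finite K1"
    and disj: "I \<inter> K0 = {}" "K0 \<inter> K1 = {}"
    and c: "c \<in> measurable P (Pi\<^sub>M I L)" and r: "r \<in> borel_measurable (Pi\<^sub>M I L)"
    and cd: "distr P (Pi\<^sub>M I L) c = density (Pi\<^sub>M I L) r"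
    and Xi: "\<Xi> \<in> measurable P (Pi\<^sub>M (K1 \<union> K0) L)"
    and Xid: "distr P (Pi\<^sub>M (K1 \<union> K0) L) \<Xi> = Pi\<^sub>M (K1 \<union> K0) (\<lambda>_. std_normal_distribution)"
    and ind: "\<And>C D. C \<in> sets (Pi\<^sub>M I L) \<Longrightarrow> D \<in> sets (Pi\<^sub>M (K1 \<union> K0) L) \<Longrightarrow>
      measure P {\<omega>\<in>space P. c \<omega> \<in> C \<and> \<Xi> \<omega> \<in> D} = measure P {\<omega>\<in>space P. c \<omega> \<in> C} * measure P {\<omega>\<in>space P. \<Xi> \<omega> \<in> D}"
    and f: "f \<in> borel_measurable (Pi\<^sub>M (I \<union> K0) L \<Otimes>\<^sub>M Pi\<^sub>M K1 L)"
  shows "(\<integral>\<^sup>+\<omega>. f (merge I K0 (c \<omega>, \<Xi> \<omega>), restrict (\<Xi> \<omega>) K1) \<partial>P) =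
    (\<integral>\<^sup>+z. (\<integral>\<^sup>+\<theta>. r (restrict \<theta> I) * (\<Prod>k\<in>K0. ennreal (std_normal_density (\<theta> k))) * f (\<theta>, z) \<partial>Pi\<^sub>M (I \<union> K0) L)
       \<partial>Pi\<^sub>M K1 (\<lambda>_. std_normal_distribution))"
proof -
  interpret prob_space P by (rule P)
  interpret Lp: product_sigma_finite L unfolding L_def ..
  interpret N: product_sigma_finite "\<lambda>_::'j. std_normal_distribution"
    by (simp add: product_sigma_finite_def prob_space_imp_sigma_finite[OF prob_space_std_normal])
  let ?N = "\<lambda>_::'j. std_normal_distribution"
  let ?K = "K1 \<union> K0"
  have sN[measurable_cong]: "sets (Pi\<^sub>M K ?N) = sets (Pi\<^sub>M K L)" for K unfolding L_def by (rule sets_PiM_std_normal)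
  have spN: "space (Pi\<^sub>M K ?N) = space (Pi\<^sub>M K L)" for K by (rule sets_eq_imp_space_eq[OF sN])
  interpret MI: finite_product_sigma_finite L I by standard (rule fin)
  interpret NK1: finite_product_sigma_finite ?N K1 by standard (rule fin)
  interpret NK0: finite_product_sigma_finite ?N K0 by standard (rule fin)
  interpret NK: finite_product_sigma_finite ?N ?K by standard (use fin in simp)
  define g where "g x y = f (merge I K0 (x, y), restrict y K1)" for x y
  define w where "w y = (\<Prod>k\<in>K0. ennreal (std_normal_density (y k)))" for y :: "'j \<Rightarrow> real"
  have mres: "(\<lambda>y. restrict y K1) \<in> measurable (Pi\<^sub>M ?K L) (Pi\<^sub>M K1 L)"
    by (rule measurable_restrict_subset) auto
  have mres0: "(\<lambda>y. restrict y K0) \<in> measurable (Pi\<^sub>M ?K L) (Pi\<^sub>M K0 L)"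
    by (rule measurable_restrict_subset) auto
  have merge_restrict: "merge I K0 (x, restrict y K0) = merge I K0 (x, y)" for x y :: "'j \<Rightarrow> real"
    by (auto simp: merge_def fun_eq_iff)
  have gm: "(\<lambda>(x, y). g x y) \<in> borel_measurable (Pi\<^sub>M I L \<Otimes>\<^sub>M Pi\<^sub>M ?K L)"
  proof -
    have "(\<lambda>p. (fst p, restrict (snd p) K0)) \<in> measurable (Pi\<^sub>M I L \<Otimes>\<^sub>M Pi\<^sub>M ?K L) (Pi\<^sub>M I L \<Otimes>\<^sub>M Pi\<^sub>M K0 L)"
      by (intro measurable_Pair measurable_fst measurable_compose[OF measurable_snd mres0])
    from measurable_compose[OF this measurable_merge]
    have "(\<lambda>p. merge I K0 (fst p, snd p)) \<in> measurable (Pi\<^sub>M I L \<Otimes>\<^sub>M Pi\<^sub>M ?K L) (Pi\<^sub>M (I \<union> K0) L)"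
      by (simp add: merge_restrict)
    from measurable_Pair[OF this measurable_compose[OF measurable_snd mres]]
    show ?thesis unfolding g_def using measurable_compose[OF _ f] by (simp add: case_prod_beta')
  qed
  interpret rP: prob_space "density (Pi\<^sub>M I L) r" unfolding cd[symmetric] by (rule prob_space_distr[OF c])
  have joint: "density (Pi\<^sub>M I L) r \<Otimes>\<^sub>M Pi\<^sub>M ?K ?N = distr P (Pi\<^sub>M I L \<Otimes>\<^sub>M Pi\<^sub>M ?K L) (\<lambda>\<omega>. (c \<omega>, \<Xi> \<omega>))"
  proof (rule pair_measure_eqI)
    show "sigma_finite_measure (density (Pi\<^sub>M I L) r)" ..
    show "sigma_finite_measure (Pi\<^sub>M ?K ?N)" ..
    show "sets (density (Pi\<^sub>M I L) r \<Otimes>\<^sub>M Pi\<^sub>M ?K ?N) = sets (distr P (Pi\<^sub>M I L \<Otimes>\<^sub>M Pi\<^sub>M ?K L) (\<lambda>\<omega>. (c \<omega>, \<Xi> \<omega>)))"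
      by (simp add: sN cong: sets_pair_measure_cong)
    fix C D assume C': "C \<in> sets (density (Pi\<^sub>M I L) r)" and D': "D \<in> sets (Pi\<^sub>M ?K ?N)"
    then have C: "C \<in> sets (Pi\<^sub>M I L)" and D: "D \<in> sets (Pi\<^sub>M ?K L)" by (simp_all add: sN)
    have "emeasure (distr P (Pi\<^sub>M I L \<Otimes>\<^sub>M Pi\<^sub>M ?K L) (\<lambda>\<omega>. (c \<omega>, \<Xi> \<omega>))) (C \<times> D) = emeasure P {\<omega>\<in>space P. c \<omega> \<in> C \<and> \<Xi> \<omega> \<in> D}"
      using C D c Xi by (subst emeasure_distr) (auto intro!: arg_cong[where f = "emeasure P"])
    also have "\<dots> = emeasure P {\<omega>\<in>space P. c \<omega> \<in> C} * emeasure P {\<omega>\<in>space P. \<Xi> \<omega> \<in> D}"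
      unfolding emeasure_eq_measure ind[OF C D] by (simp add: ennreal_mult)
    also have "emeasure P {\<omega>\<in>space P. c \<omega> \<in> C} = emeasure (density (Pi\<^sub>M I L) r) C"
      unfolding cd[symmetric] using c C by (subst emeasure_distr) (auto intro!: arg_cong[where f = "emeasure P"])
    also have "emeasure P {\<omega>\<in>space P. \<Xi> \<omega> \<in> D} = emeasure (Pi\<^sub>M ?K ?N) D"
      unfolding Xid[symmetric] using Xi D by (subst emeasure_distr) (auto intro!: arg_cong[where f = "emeasure P"])
    finally show "emeasure (density (Pi\<^sub>M I L) r) C * emeasure (Pi\<^sub>M ?K ?N) D =
      emeasure (distr P (Pi\<^sub>M I L \<Otimes>\<^sub>M Pi\<^sub>M ?K L) (\<lambda>\<omega>. (c \<omega>, \<Xi> \<omega>))) (C \<times> D)" by simp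
  qed
  have gmN: "(\<lambda>p. g (fst p) (snd p)) \<in> borel_measurable (Pi\<^sub>M I L \<Otimes>\<^sub>M Pi\<^sub>M ?K ?N)"
    using gm unfolding case_prod_beta' by (subst measurable_cong_sets[OF sets_pair_measure_cong[OF refl sN] refl])
  have gmNr: "(\<lambda>p. g (fst p) (snd p)) \<in> borel_measurable (density (Pi\<^sub>M I L) r \<Otimes>\<^sub>M Pi\<^sub>M ?K ?N)"
    using gmN by (subst measurable_cong_sets[OF sets_pair_measure_cong[OF sets_density refl] refl])
  have inner: "(\<integral>\<^sup>+y. g x y \<partial>Pi\<^sub>M ?K ?N) =
     (\<integral>\<^sup>+z. (\<integral>\<^sup>+y. w y * f (merge I K0 (x, y), z) \<partial>Pi\<^sub>M K0 L) \<partial>Pi\<^sub>M K1 ?N)" if x: "x \<in> space (Pi\<^sub>M I L)" for x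
  proof -
    have gx: "g x \<in> borel_measurable (Pi\<^sub>M ?K ?N)"
      using measurable_compose[OF measurable_Pair1'[OF x] gmN] by simp
    have "(\<integral>\<^sup>+y. g x y \<partial>Pi\<^sub>M ?K ?N) = (\<integral>\<^sup>+z. (\<integral>\<^sup>+y. g x (merge K1 K0 (z, y)) \<partial>Pi\<^sub>M K0 ?N) \<partial>Pi\<^sub>M K1 ?N)"
      by (rule N.product_nn_integral_fold[OF _ fin(3,2) gx]) (use disj in blast)
    also have "\<dots> = (\<integral>\<^sup>+z. (\<integral>\<^sup>+y. f (merge I K0 (x, y), z) \<partial>Pi\<^sub>M K0 ?N) \<partial>Pi\<^sub>M K1 ?N)"
    proof (intro nn_integral_cong)
      fix z y assume z: "z \<in> space (Pi\<^sub>M K1 ?N)"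
      have "restrict (merge K1 K0 (z, y)) K1 = z"
        using z by (auto simp: space_PiM PiE_def extensional_def merge_def fun_eq_iff)
      moreover have "merge I K0 (x, merge K1 K0 (z, y)) = merge I K0 (x, y)"
        using disj by (auto simp: merge_def fun_eq_iff)
      ultimately show "g x (merge K1 K0 (z, y)) = f (merge I K0 (x, y), z)" unfolding g_def by simp
    qed
    also have "\<dots> = (\<integral>\<^sup>+z. (\<integral>\<^sup>+y. w y * f (merge I K0 (x, y), z) \<partial>Pi\<^sub>M K0 L) \<partial>Pi\<^sub>M K1 ?N)"
    proof (rule nn_integral_cong)
      fix z assume z: "z \<in> space (Pi\<^sub>M K1 ?N)"
      have wm: "w \<in> borel_measurable (Pi\<^sub>M K0 L)"
        unfolding w_def L_def by (intro borel_measurable_prod_ennreal) measurable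
      have "(\<lambda>y. (merge I K0 (x, y), z)) \<in> measurable (Pi\<^sub>M K0 L) (Pi\<^sub>M (I \<union> K0) L \<Otimes>\<^sub>M Pi\<^sub>M K1 L)"
        by (intro measurable_Pair measurable_const measurable_compose[OF measurable_Pair1'[OF x] measurable_merge])
          (use z spN in simp)
      from measurable_compose[OF this f]
      show "(\<integral>\<^sup>+y. f (merge I K0 (x, y), z) \<partial>Pi\<^sub>M K0 ?N) = (\<integral>\<^sup>+y. w y * f (merge I K0 (x, y), z) \<partial>Pi\<^sub>M K0 L)"
        unfolding PiM_std_normal_eq_density[OF fin(2)] w_def[symmetric] L_def[symmetric]
        by (rule nn_integral_density[OF wm])
    qed
    finally show ?thesis .
  qed
  have wm: "w \<in> borel_measurable (Pi\<^sub>M K0 L)"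
    unfolding w_def L_def by (intro borel_measurable_prod_ennreal) measurable
  define h where "h \<theta> z = r (restrict \<theta> I) * w \<theta> * f (\<theta>, z)" for \<theta> z
  have hm: "(\<lambda>p. h (fst p) (snd p)) \<in> borel_measurable (Pi\<^sub>M (I \<union> K0) L \<Otimes>\<^sub>M Pi\<^sub>M K1 L)"
  proof -
    have "(\<lambda>\<theta>. r (restrict \<theta> I)) \<in> borel_measurable (Pi\<^sub>M (I \<union> K0) L)"
      by (rule measurable_compose[OF measurable_restrict_subset r]) simp
    moreover have "w \<in> borel_measurable (Pi\<^sub>M (I \<union> K0) L)"
      unfolding w_def L_def by (intro borel_measurable_prod_ennreal) measurable
    ultimately show ?thesis unfolding h_def
      using f by (auto intro!: borel_measurable_times_ennreal intro: measurable_compose[OF measurable_fst])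
  qed
  define k where "k x z = (\<integral>\<^sup>+y. w y * f (merge I K0 (x, y), z) \<partial>Pi\<^sub>M K0 L)" for x z
  interpret LK0: finite_product_sigma_finite L K0 by standard (rule fin)
  have km: "(\<lambda>p. k (fst p) (snd p)) \<in> borel_measurable (Pi\<^sub>M I L \<Otimes>\<^sub>M Pi\<^sub>M K1 L)"
  proof -
    have "(\<lambda>q. (merge I K0 (fst (fst q), snd q), snd (fst q))) \<in>
       measurable ((Pi\<^sub>M I L \<Otimes>\<^sub>M Pi\<^sub>M K1 L) \<Otimes>\<^sub>M Pi\<^sub>M K0 L) (Pi\<^sub>M (I \<union> K0) L \<Otimes>\<^sub>M Pi\<^sub>M K1 L)"
      by (intro measurable_Pair measurable_compose[OF _ measurable_merge] measurable_snd
        measurable_compose[OF measurable_fst measurable_fst] measurable_compose[OF measurable_fst measurable_snd])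
    from measurable_compose[OF this f] measurable_compose[OF measurable_snd wm]
    have "(\<lambda>q. w (snd q) * f (merge I K0 (fst (fst q), snd q), snd (fst q))) \<in> borel_measurable ((Pi\<^sub>M I L \<Otimes>\<^sub>M Pi\<^sub>M K1 L) \<Otimes>\<^sub>M Pi\<^sub>M K0 L)"
      by (intro borel_measurable_times_ennreal)
    then show ?thesis unfolding k_def
      by (intro LK0.borel_measurable_nn_integral) (simp add: case_prod_beta')
  qed
  interpret pr: pair_sigma_finite "Pi\<^sub>M I L" "Pi\<^sub>M K1 ?N" ..
  have "(\<integral>\<^sup>+\<omega>. f (merge I K0 (c \<omega>, \<Xi> \<omega>), restrict (\<Xi> \<omega>) K1) \<partial>P) = (\<integral>\<^sup>+\<omega>. g (c \<omega>) (\<Xi> \<omega>) \<partial>P)"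
    unfolding g_def ..
  also have "\<dots> = (\<integral>\<^sup>+p. g (fst p) (snd p) \<partial>distr P (Pi\<^sub>M I L \<Otimes>\<^sub>M Pi\<^sub>M ?K L) (\<lambda>\<omega>. (c \<omega>, \<Xi> \<omega>)))"
    by (subst nn_integral_distr) (use c Xi gm in \<open>auto simp: case_prod_beta'\<close>)
  also have "\<dots> = (\<integral>\<^sup>+x. (\<integral>\<^sup>+y. g x y \<partial>Pi\<^sub>M ?K ?N) \<partial>density (Pi\<^sub>M I L) r)"
    unfolding joint[symmetric] using NK.nn_integral_fst[OF gmNr] by simp
  also have "\<dots> = (\<integral>\<^sup>+x. r x * (\<integral>\<^sup>+y. g x y \<partial>Pi\<^sub>M ?K ?N) \<partial>Pi\<^sub>M I L)"
    by (rule nn_integral_density[OF r]) (intro NK.borel_measurable_nn_integral, use gmN in \<open>simp add: case_prod_beta'\<close>)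
  also have "\<dots> = (\<integral>\<^sup>+x. (\<integral>\<^sup>+z. r x * k x z \<partial>Pi\<^sub>M K1 ?N) \<partial>Pi\<^sub>M I L)"
  proof (rule nn_integral_cong)
    fix x assume x: "x \<in> space (Pi\<^sub>M I L)"
    have "k x \<in> borel_measurable (Pi\<^sub>M K1 L)" using measurable_compose[OF measurable_Pair1'[OF x] km] by simp
    then have "k x \<in> borel_measurable (Pi\<^sub>M K1 ?N)" by (subst measurable_cong_sets[OF sN refl])
    then show "r x * (\<integral>\<^sup>+y. g x y \<partial>Pi\<^sub>M ?K ?N) = (\<integral>\<^sup>+z. r x * k x z \<partial>Pi\<^sub>M K1 ?N)"
      unfolding inner[OF x] k_def[symmetric] by (rule nn_integral_cmult[symmetric])
  qed
  also have "\<dots> = (\<integral>\<^sup>+z. (\<integral>\<^sup>+x. r x * k x z \<partial>Pi\<^sub>M I L) \<partial>Pi\<^sub>M K1 ?N)"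
  proof (rule pr.Fubini'[symmetric])
    have "(\<lambda>p. r (fst p) * k (fst p) (snd p)) \<in> borel_measurable (Pi\<^sub>M I L \<Otimes>\<^sub>M Pi\<^sub>M K1 L)"
      using km measurable_compose[OF measurable_fst r] by (intro borel_measurable_times_ennreal)
    then show "(\<lambda>(x, z). r x * k x z) \<in> borel_measurable (Pi\<^sub>M I L \<Otimes>\<^sub>M Pi\<^sub>M K1 ?N)"
      unfolding case_prod_beta' by (subst measurable_cong_sets[OF sets_pair_measure_cong[OF refl sN] refl])
  qed
  also have "\<dots> = (\<integral>\<^sup>+z. (\<integral>\<^sup>+\<theta>. h \<theta> z \<partial>Pi\<^sub>M (I \<union> K0) L) \<partial>Pi\<^sub>M K1 ?N)"
  proof (rule nn_integral_cong)
    fix z assume "z \<in> space (Pi\<^sub>M K1 ?N)"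
    then have z: "z \<in> space (Pi\<^sub>M K1 L)" by (simp add: spN)
    have hz: "(\<lambda>\<theta>. h \<theta> z) \<in> borel_measurable (Pi\<^sub>M (I \<union> K0) L)"
      using measurable_compose[OF measurable_Pair2'[OF z] hm] by simp
    have "(\<integral>\<^sup>+\<theta>. h \<theta> z \<partial>Pi\<^sub>M (I \<union> K0) L) = (\<integral>\<^sup>+x. (\<integral>\<^sup>+y. h (merge I K0 (x, y)) z \<partial>Pi\<^sub>M K0 L) \<partial>Pi\<^sub>M I L)"
      by (rule Lp.product_nn_integral_fold[OF disj(1) fin(1,2) hz])
    also have "\<dots> = (\<integral>\<^sup>+x. r x * k x z \<partial>Pi\<^sub>M I L)"
    proof (rule nn_integral_cong)
      fix x assume x: "x \<in> space (Pi\<^sub>M I L)"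
      have "restrict (merge I K0 (x, y)) I = x" for y
        using x by (auto simp: space_PiM PiE_def extensional_def merge_def fun_eq_iff)
      moreover have "w (merge I K0 (x, y)) = w y" for y
        unfolding w_def using disj(1) by (intro prod.cong) (auto simp: merge_def)
      ultimately have "(\<integral>\<^sup>+y. h (merge I K0 (x, y)) z \<partial>Pi\<^sub>M K0 L) = (\<integral>\<^sup>+y. r x * (w y * f (merge I K0 (x, y), z)) \<partial>Pi\<^sub>M K0 L)"
        unfolding h_def by (simp add: mult.assoc)
      also have "\<dots> = r x * k x z" unfolding k_def
      proof (rule nn_integral_cmult)
        have "(\<lambda>y. (merge I K0 (x, y), z)) \<in> measurable (Pi\<^sub>M K0 L) (Pi\<^sub>M (I \<union> K0) L \<Otimes>\<^sub>M Pi\<^sub>M K1 L)"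
          by (intro measurable_Pair measurable_const[OF z] measurable_compose[OF measurable_Pair1'[OF x] measurable_merge])
        from measurable_compose[OF this f] wm
        show "(\<lambda>y. w y * f (merge I K0 (x, y), z)) \<in> borel_measurable (Pi\<^sub>M K0 L)" by (intro borel_measurable_times_ennreal)
      qed
      finally show "(\<integral>\<^sup>+y. h (merge I K0 (x, y)) z \<partial>Pi\<^sub>M K0 L) = r x * k x z" .
    qed
    finally show "(\<integral>\<^sup>+x. r x * k x z \<partial>Pi\<^sub>M I L) = (\<integral>\<^sup>+\<theta>. h \<theta> z \<partial>Pi\<^sub>M (I \<union> K0) L)" by simp
  qed
  finally show ?thesis unfolding h_def w_def .
qed

lemma (in prob_space) nn_integral_less_1:
  assumes h: "h \<in> borel_measurable M" and AE: "AE x in M. h x < (1::ennreal)"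
  shows "(\<integral>\<^sup>+x. h x \<partial>M) < 1"
proof -
  have le: "(\<integral>\<^sup>+x. h x \<partial>M) \<le> (\<integral>\<^sup>+x. 1 \<partial>M)"
    by (rule nn_integral_mono_AE) (use AE in auto)
  then have fin: "(\<integral>\<^sup>+x. h x \<partial>M) \<noteq> \<infinity>" using emeasure_space_1 by (auto simp: top_unique)
  have "(\<integral>\<^sup>+x. h x \<partial>M) < (\<integral>\<^sup>+x. 1 \<partial>M)"
  proof (rule nn_integral_less[OF h _ fin])
    show "AE x in M. h x \<le> 1" using AE by auto
    show "\<not> (AE x in M. 1 \<le> h x)"
    proof
      assume "AE x in M. 1 \<le> h x"
      then have "AE x in M. False" using AE by eventually_elim auto
      then show False by simp
    qed
  qed simp
  then show ?thesis using emeasure_space_1 by simp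
qed

lemma std_normal_density_add: "std_normal_density (a + b) = std_normal_density a * exp (- a * b - b\<^sup>2 / 2)"
  by (simp add: std_normal_density_def power2_sum exp_add[symmetric] field_simps)

text \<open>In the exponent the cross term is the sum of \<open>a k * b k\<close>, which vanishes,
  so the shift leaves only the factor \<open>exp (- |b|^2 / 2)\<close>. The orthogonality of
  \<open>a\<close> and \<open>b\<close> will come from the equation at level 0.\<close>

lemma prod_std_normal_shift:
  assumes "finite K" "(\<Sum>k\<in>K. a k * b k) = 0"
  shows "(\<Prod>k\<in>K. ennreal (std_normal_density (a k + b k))) =
    ennreal (exp (- (\<Sum>k\<in>K. (b k)\<^sup>2) / 2)) * (\<Prod>k\<in>K. ennreal (std_normal_density (a k)))"
proof -
  have "(\<Prod>k\<in>K. std_normal_density (a k + b k)) = (\<Prod>k\<in>K. std_normal_density (a k)) * exp (\<Sum>k\<in>K. - a k * b k - (b k)\<^sup>2 / 2)"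
    unfolding std_normal_density_add by (simp add: prod.distrib exp_sum[OF assms(1)])
  also have "(\<Sum>k\<in>K. - a k * b k - (b k)\<^sup>2 / 2) = - (\<Sum>k\<in>K. (b k)\<^sup>2) / 2"
    using assms(2) by (simp add: sum_subtractf sum_negf sum_divide_distrib)
  finally show ?thesis
    by (simp add: prod_ennreal prod_nonneg ennreal_mult' mult.commute)
qed

text \<open>For a fixed value \<open>z\<close> of the variables in \<open>K1\<close> the right-hand
  side \<open>s z\<close> is deterministic, and the shift lemma gives the expected count at level 0
  times \<open>\<kappa> z = exp (- |s z|^2 / 2)\<close>. So \<open>q\<close> is the Gaussian mean of
  \<open>\<kappa>\<close>, less than 1 because \<open>s z\<close> is almost surely nonzero.
  \<open>R\<close> is the set of Gaussian rows; coefficients in \<open>I\<close> do not enter them,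
  so the shift does not touch the arguments of the arbitrary density \<open>r\<close>.\<close>

lemma (in spanning_fields) expected_zeros_ratio:
  fixes c \<Xi> :: "'w \<Rightarrow> 'j \<Rightarrow> real" and I K0 K1 :: "'j set" and s :: "('j \<Rightarrow> real) \<Rightarrow> real^'n::_"
  defines "L \<equiv> \<lambda>_::'j. lborel :: real measure"
  assumes P: "prob_space P" and fin: "finite I" "finite K0" "finite K1"
    and disj: "I \<inter> K0 = {}" "K0 \<inter> K1 = {}" and J: "J = I \<union> K0"
    and c: "c \<in> measurable P (Pi\<^sub>M I L)" and r: "r \<in> borel_measurable (Pi\<^sub>M I L)"
    and cd: "distr P (Pi\<^sub>M I L) c = density (Pi\<^sub>M I L) r"
    and Xi: "\<Xi> \<in> measurable P (Pi\<^sub>M (K1 \<union> K0) L)"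
    and Xid: "distr P (Pi\<^sub>M (K1 \<union> K0) L) \<Xi> = Pi\<^sub>M (K1 \<union> K0) (\<lambda>_. std_normal_distribution)"
    and ind: "\<And>C D. C \<in> sets (Pi\<^sub>M I L) \<Longrightarrow> D \<in> sets (Pi\<^sub>M (K1 \<union> K0) L) \<Longrightarrow>
      measure P {\<omega>\<in>space P. c \<omega> \<in> C \<and> \<Xi> \<omega> \<in> D} = measure P {\<omega>\<in>space P. c \<omega> \<in> C} * measure P {\<omega>\<in>space P. \<Xi> \<omega> \<in> D}"
    and U: "openin (top_of_set S) U"
    and s: "s \<in> borel_measurable (Pi\<^sub>M K1 L)" and R: "\<And>z i. i \<notin> R \<Longrightarrow> s z $ i = 0"
    and unit: "\<And>x i. x \<in> S \<Longrightarrow> i \<in> R \<Longrightarrow> (\<Sum>j\<in>J. (v j x $ i)\<^sup>2) = 1"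
    and orth: "\<And>j i k. j \<in> J \<Longrightarrow> i \<in> R \<Longrightarrow> k \<noteq> i \<Longrightarrow> (\<forall>x\<in>S. v j x $ k = 0) \<or> (\<forall>x\<in>S. v j x $ i = 0)"
    and RI: "\<And>j i x. j \<in> I \<Longrightarrow> i \<in> R \<Longrightarrow> x \<in> S \<Longrightarrow> v j x $ i = 0"
    and s0: "AE z in Pi\<^sub>M K1 (\<lambda>_. std_normal_distribution). s z \<noteq> 0"
  shows "\<exists>q<1. (\<integral>\<^sup>+\<omega>. emeasure (count_space UNIV) {x\<in>U. (\<Sum>j\<in>J. merge I K0 (c \<omega>, \<Xi> \<omega>) j *\<^sub>R v j x) = s (restrict (\<Xi> \<omega>) K1)} \<partial>P) =
    q * (\<integral>\<^sup>+\<omega>. emeasure (count_space UNIV) {x\<in>U. (\<Sum>j\<in>J. merge I K0 (c \<omega>, \<Xi> \<omega>) j *\<^sub>R v j x) = 0} \<partial>P)"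
proof -
  define M where "M = Pi\<^sub>M J L"
  let ?N = "\<lambda>_::'j. std_normal_distribution"
  interpret Q: prob_space "Pi\<^sub>M K1 ?N" by (rule prob_space_PiM) (rule prob_space_std_normal)
  have sN: "sets (Pi\<^sub>M K ?N) = sets (Pi\<^sub>M K L)" for K unfolding L_def by (rule sets_PiM_std_normal)
  define p where "p \<theta> = r (restrict \<theta> I) * (\<Prod>k\<in>K0. ennreal (std_normal_density (\<theta> k)))" for \<theta>
  have comp: "(\<lambda>\<theta>. \<theta> j) \<in> borel_measurable M" if "j \<in> J" for j
    unfolding M_def L_def using that measurable_component_singleton[of j J "\<lambda>_. lborel :: real measure"] by simp
  have pm: "p \<in> borel_measurable M"
  proof -
    have "(\<lambda>\<theta>. r (restrict \<theta> I)) \<in> borel_measurable M"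
      unfolding M_def by (rule measurable_compose[OF measurable_restrict_subset r]) (simp add: J)
    moreover have "(\<lambda>\<theta>. \<Prod>k\<in>K0. ennreal (std_normal_density (\<theta> k))) \<in> borel_measurable M"
      by (intro borel_measurable_prod_ennreal measurable_compose[OF comp]) (auto simp: J)
    ultimately show ?thesis unfolding p_def by (intro borel_measurable_times_ennreal)
  qed
  define cnt where "cnt b \<theta> = emeasure (count_space UNIV) {x\<in>U. (\<Sum>j\<in>J. \<theta> j *\<^sub>R v j x) = b}" for b and \<theta> :: "'j \<Rightarrow> real"
  have cm: "(\<lambda>q. cnt (g (snd q)) (fst q)) \<in> borel_measurable (M \<Otimes>\<^sub>M Pi\<^sub>M K1 L)" if g: "g \<in> borel_measurable (Pi\<^sub>M K1 L)" for g
    unfolding cnt_def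
    by (rule measurable_count_linear_zeros[OF U]) (auto intro: measurable_compose[OF measurable_fst comp] measurable_compose[OF measurable_snd g])
  have joint: "(\<integral>\<^sup>+\<omega>. f (merge I K0 (c \<omega>, \<Xi> \<omega>), restrict (\<Xi> \<omega>) K1) \<partial>P) =
    (\<integral>\<^sup>+z. (\<integral>\<^sup>+\<theta>. r (restrict \<theta> I) * (\<Prod>k\<in>K0. ennreal (std_normal_density (\<theta> k))) * f (\<theta>, z) \<partial>Pi\<^sub>M (I \<union> K0) L)
       \<partial>Pi\<^sub>M K1 ?N)" if fm: "f \<in> borel_measurable (Pi\<^sub>M (I \<union> K0) L \<Otimes>\<^sub>M Pi\<^sub>M K1 L)" for f
    unfolding L_def
    by (rule nn_integral_joint_law[OF P fin disj c[unfolded L_def] r[unfolded L_def] cd[unfolded L_def] Xi[unfolded L_def]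
        Xid[unfolded L_def] _ fm[unfolded L_def]], erule (1) ind[unfolded L_def])
  have law: "(\<integral>\<^sup>+\<omega>. cnt (g (restrict (\<Xi> \<omega>) K1)) (merge I K0 (c \<omega>, \<Xi> \<omega>)) \<partial>P) =
      (\<integral>\<^sup>+z. (\<integral>\<^sup>+\<theta>. p \<theta> * cnt (g z) \<theta> \<partial>M) \<partial>Pi\<^sub>M K1 ?N)" if g: "g \<in> borel_measurable (Pi\<^sub>M K1 L)" for g
    using joint[OF cm[OF g, unfolded M_def J]] unfolding p_def M_def J by (simp only: fst_conv snd_conv)
  define \<kappa> where "\<kappa> z = ennreal (exp (- (s z \<bullet> s z) / 2))" for z
  have shift: "p (\<lambda>j\<in>J. \<theta> j + s z \<bullet> v j x) = \<kappa> z * p \<theta>"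
    if th: "\<theta> \<in> space M" and x: "x \<in> S" and z0: "(\<Sum>j\<in>J. \<theta> j *\<^sub>R v j x) = 0" for \<theta> x z
  proof -
    have sI: "s z \<bullet> v j x = 0" if "j \<in> I" for j
    proof -
      have "s z \<bullet> v j x = (\<Sum>i\<in>R. s z $ i * v j x $ i)" by (rule inner_supported) (rule R)
      then show ?thesis using RI[OF that _ x] by simp
    qed
    have fJ: "finite J" by (rule finite_J)
    \<comment> \<open>Terms with index in \<open>I\<close> vanish, so sums over \<open>K0\<close>
      may be taken over \<open>J\<close>. The first is then the equation at level 0 paired with
      \<open>s z\<close>; the second, further below, is evaluated by
      \<open>Gram_fixed\<close>.\<close>
    have "(\<Sum>k\<in>K0. \<theta> k * (s z \<bullet> v k x)) = (\<Sum>k\<in>J. \<theta> k * (s z \<bullet> v k x))"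
      by (rule sum.mono_neutral_left[OF fJ]) (auto simp: J sI)
    also have "\<dots> = s z \<bullet> (\<Sum>k\<in>J. \<theta> k *\<^sub>R v k x)" by (simp add: inner_sum_right)
    also have "\<dots> = 0" unfolding z0 by simp
    finally have 1: "(\<Sum>k\<in>K0. \<theta> k * (s z \<bullet> v k x)) = 0" .
    have "(\<Sum>k\<in>K0. (s z \<bullet> v k x)\<^sup>2) = (\<Sum>k\<in>J. (s z \<bullet> v k x)\<^sup>2)"
      by (rule sum.mono_neutral_left[OF fJ]) (auto simp: J sI)
    also have "\<dots> = s z \<bullet> (\<Sum>k\<in>J. (s z \<bullet> v k x) *\<^sub>R v k x)" by (simp add: inner_sum_right power2_eq_square)
    also have "(\<Sum>k\<in>J. (s z \<bullet> v k x) *\<^sub>R v k x) = s z"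
      by (rule Gram_fixed[OF x, where R = R], erule R, erule (1) unit, erule (2) orth)
    finally have 2: "(\<Sum>k\<in>K0. (s z \<bullet> v k x)\<^sup>2) = s z \<bullet> s z" .
    have "restrict (\<lambda>j\<in>J. \<theta> j + s z \<bullet> v j x) I = restrict \<theta> I"
      using sI by (auto simp: J fun_eq_iff)
    moreover have "(\<Prod>k\<in>K0. ennreal (std_normal_density ((\<lambda>j\<in>J. \<theta> j + s z \<bullet> v j x) k))) =
       (\<Prod>k\<in>K0. ennreal (std_normal_density (\<theta> k + s z \<bullet> v k x)))"
      by (rule prod.cong) (auto simp: J)
    ultimately show ?thesis
      unfolding p_def \<kappa>_def prod_std_normal_shift[OF fin(2) 1, unfolded 2] by (simp add: mult_ac)
  qed
  define E where "E = (\<integral>\<^sup>+\<theta>. p \<theta> * cnt 0 \<theta> \<partial>M)"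
  have inner: "(\<integral>\<^sup>+\<theta>. p \<theta> * cnt (s z) \<theta> \<partial>M) = \<kappa> z * E" for z
    unfolding cnt_def E_def
    by (rule nn_integral_linear_zeros_shift[OF U M_def[unfolded L_def] pm, where R = R],
      erule R, erule (1) unit, erule (2) orth, erule (2) shift)
  have s': "s \<in> borel_measurable (Pi\<^sub>M K1 ?N)" using s by (subst measurable_cong_sets[OF sN refl])
  have \<kappa>m: "\<kappa> \<in> borel_measurable (Pi\<^sub>M K1 ?N)" unfolding \<kappa>_def using s' by simp
  have "(\<integral>\<^sup>+z. \<kappa> z \<partial>Pi\<^sub>M K1 ?N) < 1"
  proof (rule Q.nn_integral_less_1[OF \<kappa>m])
    show "AE z in Pi\<^sub>M K1 ?N. \<kappa> z < 1"
      using s0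
    proof eventually_elim
      case (elim z)
      then have "exp (- (s z \<bullet> s z) / 2) < 1" by (simp add: inner_gt_zero_iff)
      then show ?case unfolding \<kappa>_def by (simp add: ennreal_less_one_iff)
    qed
  qed
  moreover have "(\<integral>\<^sup>+\<omega>. cnt (s (restrict (\<Xi> \<omega>) K1)) (merge I K0 (c \<omega>, \<Xi> \<omega>)) \<partial>P) = (\<integral>\<^sup>+z. \<kappa> z \<partial>Pi\<^sub>M K1 ?N) * E"
    unfolding law[OF s] inner using \<kappa>m by (rule nn_integral_multc)
  moreover have "(\<integral>\<^sup>+\<omega>. cnt 0 (merge I K0 (c \<omega>, \<Xi> \<omega>)) \<partial>P) = E"
    using law[of "\<lambda>_. 0"] Q.emeasure_space_1 by (simp add: E_def)
  ultimately show ?thesis unfolding cnt_def by blast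
qed

section \<open>Coordinates of an admissible field\<close>

text \<open>A vector valued field is made scalar, so that \<open>eval_functionals\<close>, which act
  on scalar functions, can express coordinates of \<open>W\<close>.\<close>

definition uncurry_field :: "('a \<Rightarrow> nat \<Rightarrow> real) \<Rightarrow> 'a \<times> nat \<Rightarrow> real" where
  "uncurry_field w = (\<lambda>(x, k). w x k)"

text \<open>The coordinates in \<open>has_density_in\<close> are random variables tied to the path
  of \<open>W\<close> only by an almost sure equality. Functionals dual to the basis recompute them
  from the path, so that independence of \<open>W\<close> from other fields passes to them; both
  versions agree almost surely and thus share the density.\<close>

lemma admissible_coordinates:
  fixes W :: "'w \<Rightarrow> 'a::topological_space \<Rightarrow> nat \<Rightarrow> real"
    and A :: "('a set \<times> ('a \<Rightarrow> 'e::euclidean_space)) set"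
  assumes P: "prob_space P" and W: "admissible A S m P W"
  obtains G e \<Lambda> r where "\<And>i. i < (G::nat) \<Longrightarrow> e i \<in> smooth_fields A S m"
    "\<And>x w. x \<in> S \<Longrightarrow> w \<in> Rn m \<Longrightarrow> \<exists>a. \<forall>k. w k = (\<Sum>i<G. a i * e i x k)"
    "\<And>i. i < G \<Longrightarrow> \<Lambda> i \<in> eval_functionals"
    "AE \<omega> in P. \<forall>x k. W \<omega> x k = (\<Sum>i<G. \<Lambda> i (uncurry_field (W \<omega>)) * e i x k)"
    "r \<in> borel_measurable (Pi\<^sub>M {..<G} (\<lambda>_. lborel))"
    "distr P (Pi\<^sub>M {..<G} (\<lambda>_. lborel)) (\<lambda>\<omega>. \<lambda>i\<in>{..<G}. \<Lambda> i (uncurry_field (W \<omega>))) = density (Pi\<^sub>M {..<G} (\<lambda>_. lborel)) r"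
proof -
  interpret prob_space P by (rule P)
  obtain V ip \<rho> where V: "finite_dim_subspace V" "V \<subseteq> smooth_fields A S m" "scalar_product_on V ip"
    "\<forall>x\<in>S. (\<lambda>f. f x) ` V = Rn m" "has_density_in P V ip W \<rho>"
    using W unfolding admissible_def by (elim conjE exE) (rule that)
  have Wm: "W \<in> measurable P path_space" using W by (simp add: admissible_def)
  define G where "G = dim V"
  obtain e c where e: "orthonormal_basis V ip e"
    and Wc: "AE \<omega> in P. W \<omega> = (\<Sum>i<G. c \<omega> i *\<^sub>R e i)"
    and cdist: "distributed P (Pi\<^sub>M {..<G} (\<lambda>_. lborel)) c (\<lambda>y. ennreal (\<rho> (\<Sum>i<G. y i *\<^sub>R e i)))"
    using V(5)[unfolded has_density_in_def, folded G_def] by (elim conjE exE) (rule that)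
  have sV: "subspace V" using V(1) by (simp add: finite_dim_subspace_def)
  have span: "span (e ` {..<G}) = V" and ip: "\<And>i j. i < G \<Longrightarrow> j < G \<Longrightarrow> ip (e i) (e j) = (if i = j then 1 else 0)"
    using e unfolding orthonormal_basis_def G_def by auto
  have eV: "e i \<in> V" if "i < G" for i using span span_base[of "e i" "e ` {..<G}"] that by auto
  have apply_sum: "(\<Sum>i\<in>B. a i *\<^sub>R e i) x k = (\<Sum>i\<in>B. a i * e i x k)" for a B x k
    by (simp add: sum_fun_apply scaleR_fun_apply)
  note sp = V(3)[unfolded scalar_product_on_def]
  have ipadd: "ip (f + g) h = ip f h + ip g h" if "f \<in> V" "g \<in> V" "h \<in> V" for f g h
    by (rule sp[THEN conjunct2, THEN conjunct1, rule_format, OF that])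
  have ipscale: "ip (a *\<^sub>R f) g = a * ip f g" if "f \<in> V" "g \<in> V" for a f g
    by (rule sp[THEN conjunct2, THEN conjunct2, THEN conjunct1, rule_format, OF that])
  have ip0: "ip 0 h = 0" if "h \<in> V" for h
    using ipscale[OF subspace_0[OF sV] that, of 0] by simp
  have ipsum: "ip (\<Sum>i\<in>B. a i *\<^sub>R e i) h = (\<Sum>i\<in>B. a i * ip (e i) h)" if h: "h \<in> V" and B: "finite B" "B \<subseteq> {..<G}" for h B a
    using B
  proof (induction B rule: finite_induct)
    case (insert i B)
    have ei: "e i \<in> V" using eV insert.prems by simp
    have sB: "(\<Sum>i\<in>B. a i *\<^sub>R e i) \<in> V"
      using eV insert.prems by (intro subspace_sum[OF sV] subspace_scale[OF sV]) auto
    show ?case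
      unfolding sum.insert[OF insert.hyps] ipadd[OF subspace_scale[OF sV ei] sB h] ipscale[OF ei h]
      using insert by simp
  qed (simp add: ip0[OF h])
  \<comment> \<open>Pairing with \<open>e j\<close> in the scalar product extracts the coefficient
    \<open>a j\<close>, so orthonormality gives the independence that
    \<open>ex_dual_eval_functionals\<close> asks for.\<close>
  have indep: "\<forall>i<G. a i = 0" if a0: "(\<Sum>i<G. a i *\<^sub>R uncurry_field (e i)) = 0" for a
  proof (intro allI impI)
    fix j assume j: "j < G"
    have "(\<Sum>i<G. a i *\<^sub>R e i) x k = 0" for x k
    proof -
      have "(\<Sum>i<G. a i *\<^sub>R uncurry_field (e i)) (x, k) = 0" unfolding a0 by (simp add: zero_fun_def)
      then show ?thesis unfolding apply_sum by (simp add: sum_fun_apply scaleR_fun_apply uncurry_field_def)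
    qed
    then have z: "(\<Sum>i<G. a i *\<^sub>R e i) = 0" by (simp add: fun_eq_iff zero_fun_def)
    have "0 = ip (\<Sum>i<G. a i *\<^sub>R e i) (e j)" unfolding z using ip0[OF eV[OF j]] by simp
    also have "\<dots> = (\<Sum>i<G. a i * ip (e i) (e j))" by (rule ipsum[OF eV[OF j]]) simp_all
    also have "\<dots> = (\<Sum>i<G. if i = j then a j else 0)" using ip j by (intro sum.cong) auto
    also have "\<dots> = a j" using j by simp
    finally show "a j = 0" by simp
  qed
  have "\<exists>l. (\<forall>i<G. l i \<in> eval_functionals) \<and> (\<forall>i<G. \<forall>j<G. l i (uncurry_field (e j)) = (if i = j then 1 else 0))"
    by (rule ex_dual_eval_functionals) (rule indep)
  then obtain \<Lambda> where \<Lambda>': "\<forall>i<G. \<Lambda> i \<in> eval_functionals" "\<forall>i<G. \<forall>j<G. \<Lambda> i (uncurry_field (e j)) = (if i = j then 1 else 0)"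
    by (elim exE conjE)
  have \<Lambda>: "\<Lambda> i \<in> eval_functionals" if "i < G" for i using \<Lambda>'(1) that by simp
  have \<Lambda>e: "\<Lambda> i (uncurry_field (e j)) = (if i = j then 1 else 0)" if "i < G" "j < G" for i j using \<Lambda>'(2) that by simp
  have \<Lambda>W: "\<Lambda> i (uncurry_field (W \<omega>)) = c \<omega> i" if i: "i < G" and W': "W \<omega> = (\<Sum>i<G. c \<omega> i *\<^sub>R e i)" for i \<omega>
  proof -
    have "uncurry_field (W \<omega>) = (\<Sum>j<G. c \<omega> j *\<^sub>R uncurry_field (e j))"
      unfolding W' by (auto simp: fun_eq_iff uncurry_field_def sum_fun_apply scaleR_fun_apply)
    then have "\<Lambda> i (uncurry_field (W \<omega>)) = (\<Sum>j<G. c \<omega> j * \<Lambda> i (uncurry_field (e j)))"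
      using eval_functional_linear[OF \<Lambda>[OF i]] by (simp add: linear_sum linear_cmul)
    also have "\<dots> = (\<Sum>j<G. if i = j then c \<omega> i else 0)" using \<Lambda>e[OF i] by (intro sum.cong) auto
    finally show ?thesis using i by simp
  qed
  have rep: "AE \<omega> in P. \<forall>x k. W \<omega> x k = (\<Sum>i<G. \<Lambda> i (uncurry_field (W \<omega>)) * e i x k)"
    using Wc
  proof eventually_elim
    case (elim \<omega>)
    have "W \<omega> x k = (\<Sum>i<G. c \<omega> i * e i x k)" for x k
      using arg_cong[OF elim, of "\<lambda>f. f x k"] unfolding apply_sum .
    then show ?case using \<Lambda>W[OF _ elim] by simp
  qed
  have Wcoord: "(\<lambda>\<omega>. uncurry_field (W \<omega>) q) \<in> borel_measurable P" for q
  proof -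
    obtain x k where q: "q = (x, k)" by (cases q)
    have a: "(\<lambda>w. w x) \<in> measurable path_space (borel :: (nat \<Rightarrow> real) measure)"
      unfolding path_space_def by (rule measurable_component_singleton) simp
    have b: "(\<lambda>f :: nat \<Rightarrow> real. f k) \<in> borel_measurable borel"
      by (rule borel_measurable_continuous_onI) (rule continuous_on_product_coordinates)
    from measurable_compose[OF measurable_compose[OF Wm a] b] show ?thesis unfolding q uncurry_field_def by simp
  qed
  have dist: "distr P (Pi\<^sub>M {..<G} (\<lambda>_. lborel)) (\<lambda>\<omega>. \<lambda>i\<in>{..<G}. \<Lambda> i (uncurry_field (W \<omega>))) =
      density (Pi\<^sub>M {..<G} (\<lambda>_. lborel)) (\<lambda>y. ennreal (\<rho> (\<Sum>i<G. y i *\<^sub>R e i)))"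
  proof -
    have cm: "c \<in> measurable P (Pi\<^sub>M {..<G} (\<lambda>_. lborel))" by (rule distributed_measurable[OF cdist])
    have "distr P (Pi\<^sub>M {..<G} (\<lambda>_. lborel)) (\<lambda>\<omega>. \<lambda>i\<in>{..<G}. \<Lambda> i (uncurry_field (W \<omega>))) = distr P (Pi\<^sub>M {..<G} (\<lambda>_. lborel)) c"
    proof (rule distr_cong_AE[OF refl refl])
      show "(\<lambda>\<omega>. \<lambda>i\<in>{..<G}. \<Lambda> i (uncurry_field (W \<omega>))) \<in> measurable P (Pi\<^sub>M {..<G} (\<lambda>_. lborel))"
        by (intro measurable_restrict) (use eval_functional_measurable[OF \<Lambda> Wcoord] in simp)
      show "AE \<omega> in P. (\<lambda>i\<in>{..<G}. \<Lambda> i (uncurry_field (W \<omega>))) = c \<omega>"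
        using Wc AE_space
      proof eventually_elim
        case (elim \<omega>)
        have "c \<omega> \<in> space (Pi\<^sub>M {..<G} (\<lambda>_. lborel :: real measure))" using measurable_space[OF cm elim(2)] .
        then have "c \<omega> \<in> extensional {..<G}" by (simp add: space_PiM PiE_def)
        then show ?case using \<Lambda>W[OF _ elim(1)] by (auto simp: fun_eq_iff extensional_def)
      qed
    qed (rule cm)
    then show ?thesis using distributed_distr_eq_density[OF cdist] by simp
  qed
  have rm: "(\<lambda>y. ennreal (\<rho> (\<Sum>i<G. y i *\<^sub>R e i))) \<in> borel_measurable (Pi\<^sub>M {..<G} (\<lambda>_. lborel))"
    by (rule distributed_borel_measurable[OF cdist])
  have surj: "\<exists>a. \<forall>k. w k = (\<Sum>i<G. a i * e i x k)" if x: "x \<in> S" and w: "w \<in> Rn m" for x w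
  proof -
    obtain f where f: "f \<in> V" "w = f x" using V(4) x w by blast
    then have "f \<in> span (e ` {..<G})" using span by simp
    then have "\<exists>a. f = (\<Sum>i<G. a i *\<^sub>R e i)"
    proof (induction rule: span_induct_alt)
      case base
      show ?case by (rule exI[of _ "\<lambda>_. 0"]) simp
    next
      case (step b y z)
      then obtain j a where ja: "j < G" "y = e j" "z = (\<Sum>i<G. a i *\<^sub>R e i)" by blast
      have "b *\<^sub>R y = (\<Sum>i<G. (if i = j then b else 0) *\<^sub>R e i)"
        using ja(1,2) by (simp add: if_distrib[of "\<lambda>c. c *\<^sub>R _"] cong: if_cong)
      then have "b *\<^sub>R y + z = (\<Sum>i<G. ((if i = j then b else 0) + a i) *\<^sub>R e i)"
        unfolding ja(3) scaleR_add_left sum.distrib by (rule arg_cong)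
      then show ?case by (intro exI[of _ "\<lambda>i. (if i = j then b else 0) + a i"])
    qed
    then obtain a where "f = (\<Sum>i<G. a i *\<^sub>R e i)" by blast
    then have "w k = (\<Sum>i<G. a i * e i x k)" for k unfolding f(2) by (simp add: apply_sum)
    then show ?thesis by blast
  qed
  have "e i \<in> smooth_fields A S m" if "i < G" for i using eV[OF that] V(2) by blast
  then show ?thesis by (rule that[OF _ surj \<Lambda> rep rm dist])
qed

lemma AE_std_normal_nonzero: "AE y in std_normal_distribution. y \<noteq> 0"
  by (subst AE_density) (auto intro: AE_mp[OF AE_lborel_singleton[of 0]])

subsection \<open>Zeros on a level set\<close>

text \<open>\<open>N\<close>, \<open>l\<close> and \<open>v\<close> are the Gaussian coordinates of
  \<open>X\<close> from \<open>ex_gaussian_coordinates\<close>. \<open>L\<^sub>0\<close> puts the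
  fact that \<open>f\<^sub>0\<close> is not in \<open>F\<close> into usable form: it reads off the
  coefficient of \<open>f\<^sub>0\<close>.\<close>

locale gaussian_level =
  fixes A :: "('a::{t2_space,second_countable_topology} set \<times> ('a \<Rightarrow> 'e::euclidean_space)) set"
    and P :: "'w measure" and F :: "('a \<Rightarrow> real) set" and X X\<^sub>0 :: "'w \<Rightarrow> 'a \<Rightarrow> real"
    and f\<^sub>0 :: "'a \<Rightarrow> real" and \<xi>\<^sub>0 :: "'w \<Rightarrow> real" and \<Phi>\<^sub>0 :: "'a \<Rightarrow> real" and t :: real and S :: "'a set"
    and N :: nat and l :: "nat \<Rightarrow> ('a \<Rightarrow> real) \<Rightarrow> real" and v :: "nat \<Rightarrow> 'a \<Rightarrow> real" and L\<^sub>0 :: "('a \<Rightarrow> real) \<Rightarrow> real"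
  assumes manifold: "smooth_atlas A" and dim: "DIM('e) > 1"
    and prob: "prob_space P"
    and F_smooth: "F \<subseteq> smooth_funs A UNIV" and F_nonzero: "\<And>x. \<exists>f\<in>F. f x \<noteq> 0"
    and X_in_F: "\<And>\<omega>. \<omega> \<in> space P \<Longrightarrow> X \<omega> \<in> F"
    and f0_smooth: "f\<^sub>0 \<in> smooth_funs A UNIV" and f0_nonzero: "\<And>x. f\<^sub>0 x \<noteq> 0"
    and xi0: "distributed P lborel \<xi>\<^sub>0 (\<lambda>y. ennreal (std_normal_density y))"
    and X_xi0_indep: "independent_rv P path_space X borel \<xi>\<^sub>0"
    and X0: "\<And>\<omega> x. X\<^sub>0 \<omega> x = X \<omega> x + \<xi>\<^sub>0 \<omega> * f\<^sub>0 x"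
    and Phi0: "\<And>x. \<Phi>\<^sub>0 x = 1/2 * ln ((\<integral>\<omega>. (X \<omega> x)\<^sup>2 \<partial>P) / (f\<^sub>0 x)\<^sup>2)"
    and regular: "regular_value A \<Phi>\<^sub>0 t"
    and S: "S = {x. \<Phi>\<^sub>0 x = t}"
    and l: "\<And>i. i < N \<Longrightarrow> l i \<in> eval_functionals" and v: "\<And>i. i < N \<Longrightarrow> v i \<in> F"
    and rep: "\<And>f. f \<in> F \<Longrightarrow> f = (\<Sum>i<N. l i f *\<^sub>R v i)"
    and box: "\<And>B. (\<And>i. i < N \<Longrightarrow> B i \<in> sets borel) \<Longrightarrow>
       (\<integral>\<omega>. (\<Prod>i<N. indicator (B i) (l i (X \<omega>))) \<partial>P) = (\<Prod>i<N. measure std_normal_distribution (B i))"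
    and var: "\<And>x. (\<integral>\<omega>. (X \<omega> x)\<^sup>2 \<partial>P) = (\<Sum>i<N. (v i x)\<^sup>2)"
    and L0: "L\<^sub>0 \<in> eval_functionals" "\<And>f. f \<in> F \<Longrightarrow> L\<^sub>0 f = 0" "L\<^sub>0 f\<^sub>0 = 1"
begin

sublocale prob_space P by (rule prob)

lemma X_measurable: "X \<in> measurable P path_space"
  using X_xi0_indep by (simp add: independent_rv_def)

lemma path_space_component: "(\<lambda>g. g x) \<in> measurable path_space (borel :: 'b::topological_space measure)"
  unfolding path_space_def by (rule measurable_component_singleton) simp

lemma X_component: "(\<lambda>\<omega>. X \<omega> x) \<in> borel_measurable P"
  by (rule measurable_compose[OF X_measurable path_space_component])

definition vhat :: "nat \<Rightarrow> 'a \<Rightarrow> real" where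
  "vhat k x = v k x / (exp t * f\<^sub>0 x)"

lemma variance_pos: "(\<Sum>k<N. (v k x)\<^sup>2) > 0"
proof (rule ccontr)
  assume "\<not> (\<Sum>k<N. (v k x)\<^sup>2) > 0"
  then have "(\<Sum>k<N. (v k x)\<^sup>2) = 0" using sum_nonneg[of "{..<N}" "\<lambda>k. (v k x)\<^sup>2"] by simp
  then have z: "v k x = 0" if "k < N" for k using that by (simp add: sum_nonneg_eq_0_iff)
  obtain f where f: "f \<in> F" "f x \<noteq> 0" using F_nonzero by blast
  have "f x = (\<Sum>i<N. l i f *\<^sub>R v i) x" using rep[OF f(1)] by simp
  also have "\<dots> = 0" using z by (simp add: sum_fun_apply scaleR_fun_apply)
  finally show False using f(2) by simp
qed

lemma sum_vhat: "(\<Sum>k<N. (vhat k x)\<^sup>2) = (\<Sum>k<N. (v k x)\<^sup>2) / (f\<^sub>0 x)\<^sup>2 / exp (2 * t)"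
proof -
  have e: "exp (2 * t) = (exp t)\<^sup>2" by (rule exp_double)
  show ?thesis unfolding vhat_def e by (simp add: power_divide power_mult_distrib sum_divide_distrib[symmetric] mult.commute)
qed

lemma sum_vhat_pos: "(\<Sum>k<N. (vhat k x)\<^sup>2) > 0"
  unfolding sum_vhat using variance_pos f0_nonzero by simp

text \<open>The squared length of \<open>vhat\<close> is
  \<open>exp (2 * (\<Phi>\<^sub>0 - t))\<close>; the division by \<open>exp t\<close> in
  \<open>vhat\<close> is chosen so that the level \<open>t\<close> becomes length 1.\<close>

lemma Phi0_eq: "\<Phi>\<^sub>0 x = t + 1/2 * ln (\<Sum>k<N. (vhat k x)\<^sup>2)"
proof -
  have "(\<Sum>k<N. (v k x)\<^sup>2) / (f\<^sub>0 x)\<^sup>2 > 0" using variance_pos f0_nonzero by simp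
  then have "ln ((\<Sum>k<N. (v k x)\<^sup>2) / (f\<^sub>0 x)\<^sup>2 / exp (2 * t)) = ln ((\<Sum>k<N. (v k x)\<^sup>2) / (f\<^sub>0 x)\<^sup>2) - 2 * t"
    by (subst ln_divide_pos) simp_all
  then show ?thesis unfolding Phi0 var sum_vhat by linarith
qed

lemma in_S_iff: "x \<in> S \<longleftrightarrow> (\<Sum>k<N. (vhat k x)\<^sup>2) - 1 = 0"
  unfolding S using sum_vhat_pos[of x] by (simp add: Phi0_eq)

lemma vhat_C1:
  assumes k: "k < N" and D: "(D, \<phi>) \<in> A"
  shows "C1_on (vhat k \<circ> inv_into D \<phi>) (\<phi> ` D)"
proof -
  have v1: "C1_on (v k \<circ> inv_into D \<phi>) (\<phi> ` D)"
    using smooth_funs_UNIV_C1[OF manifold _ D] v[OF k] F_smooth by blast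
  have f1: "C1_on (f\<^sub>0 \<circ> inv_into D \<phi>) (\<phi> ` D)"
    by (rule smooth_funs_UNIV_C1[OF manifold f0_smooth D])
  have "C1_on (\<lambda>y. exp (- t) * (v k \<circ> inv_into D \<phi>) y * inverse ((f\<^sub>0 \<circ> inv_into D \<phi>) y)) (\<phi> ` D)"
    by (intro C1_on_real_mult C1_on_const v1 C1_on_inverse[OF f1]) (simp add: f0_nonzero)
  moreover have "vhat k \<circ> inv_into D \<phi> = (\<lambda>y. exp (- t) * (v k \<circ> inv_into D \<phi>) y * inverse ((f\<^sub>0 \<circ> inv_into D \<phi>) y))"
    by (simp add: fun_eq_iff vhat_def exp_minus field_simps)
  ultimately show ?thesis by simp
qed

lemma vhat_C1_along: "k < N \<Longrightarrow> C1_along A S (vhat k)"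
  unfolding C1_along_def C1_on_open_def using vhat_C1
  by (intro ballI exI[of _ UNIV] exI[of _ "vhat k"]) auto

lemma zero_C1_along: "C1_along A S (\<lambda>_. 0)"
  unfolding C1_along_def C1_on_open_def
  by (intro ballI exI[of _ UNIV] exI[of _ "\<lambda>_. 0"]) (auto simp: o_def C1_on_const)

text \<open>\<open>S\<close> is the zero set of a function that is C1 in charts, the squared length
  of \<open>vhat\<close> minus 1, called \<open>q\<close>. Regularity carries over because
  \<open>\<Phi>\<^sub>0 = t + ln (q + 1) / 2\<close> and \<open>ln\<close> has slope 1 at 1, so on
  \<open>S\<close> the derivative of \<open>\<Phi>\<^sub>0\<close> is half that of
  \<open>q\<close>.\<close>

lemma ex_parametrization:
  assumes "x \<in> S"
  shows "\<exists>(Om :: (real^('e hyper)) set) \<psi>. parametrization A S Om \<psi> \<and> x \<in> \<psi> ` Om"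
proof -
  define q where "q x = (\<Sum>k<N. (vhat k x)\<^sup>2) - 1" for x
  obtain Om :: "(real^('e hyper)) set" and \<psi> where "parametrization A S Om \<psi>" "x \<in> \<psi> ` Om"
  proof (rule ex_parametrization_level_set[OF manifold dim, of q S x])
    fix D \<phi> assume D: "(D, \<phi>) \<in> A"
    have "C1_on (\<lambda>y. (\<Sum>k<N. (vhat k \<circ> inv_into D \<phi>) y * (vhat k \<circ> inv_into D \<phi>) y) + (- 1)) (\<phi> ` D)"
      by (intro C1_on_add C1_on_sum C1_on_real_mult C1_on_const vhat_C1[OF _ D]) simp_all
    then show "C1_on (q \<circ> inv_into D \<phi>) (\<phi> ` D)"
      by (simp add: q_def o_def power2_eq_square)
  next
    fix x D \<phi> d assume x: "q x = 0" and D: "(D, \<phi>) \<in> A" "x \<in> D"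
      and d: "(q \<circ> inv_into D \<phi> has_derivative d) (at (\<phi> x))"
    have Dh: "homeomorphism D (\<phi> ` D) \<phi> (inv_into D \<phi>)"
      using manifold D(1) unfolding smooth_atlas_def by auto
    have ix: "inv_into D \<phi> (\<phi> x) = x" using Dh D(2) by (simp add: homeomorphism_def)
    have xS: "\<Phi>\<^sub>0 x = t" using x in_S_iff[of x] unfolding q_def S by simp
    have "surj (frechet_derivative (\<Phi>\<^sub>0 \<circ> inv_into D \<phi>) (at (\<phi> x)))"
      using regular xS D unfolding regular_value_def by blast
    moreover have "(\<Phi>\<^sub>0 \<circ> inv_into D \<phi> has_derivative (\<lambda>h. 1/2 * d h)) (at (\<phi> x))"
    proof -
      have e: "\<Phi>\<^sub>0 \<circ> inv_into D \<phi> = (\<lambda>y. t + 1/2 * ln ((q \<circ> inv_into D \<phi>) y + 1))"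
        by (simp add: fun_eq_iff Phi0_eq q_def)
      have q1: "(q \<circ> inv_into D \<phi>) (\<phi> x) + 1 = 1" using x ix by simp
      have "((\<lambda>y. (q \<circ> inv_into D \<phi>) y + 1) has_derivative d) (at (\<phi> x))"
        using has_derivative_add[OF d has_derivative_const[of 1]] by simp
      from has_derivative_ln[OF _ this] q1
      have "((\<lambda>y. ln ((q \<circ> inv_into D \<phi>) y + 1)) has_derivative d) (at (\<phi> x))" by simp
      from has_derivative_add[OF has_derivative_const[of t] has_derivative_mult_right[OF this, of "1/2"]]
      show ?thesis unfolding e by simp
    qed
    ultimately have "surj (\<lambda>h. 1/2 * d h)" using frechet_derivative_at by metis
    then obtain h where "1 = 1/2 * d h" by (rule surjE)
    then show "\<exists>v. d v \<noteq> 0" by (intro exI[of _ h]) auto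
  qed (use assms in \<open>auto simp: q_def in_S_iff\<close>)
  then show ?thesis by blast
qed

text \<open>Index \<open>N\<close> is given to \<open>\<xi>\<^sub>0\<close>, so that the indices
  below \<open>Suc N\<close> form one family of independent standard normals.\<close>

definition \<Xi> :: "nat \<Rightarrow> 'w \<Rightarrow> real" where
  "\<Xi> k \<omega> = (if k < N then l k (X \<omega>) else \<xi>\<^sub>0 \<omega>)"

lemma xi0_measurable: "\<xi>\<^sub>0 \<in> borel_measurable P"
  using distributed_measurable[OF xi0] by simp

lemma Xi_measurable: "\<Xi> k \<in> borel_measurable P"
  unfolding \<Xi>_def using eval_functional_measurable[OF l X_component] xi0_measurable by (cases "k < N") auto

text \<open>A box in the coordinates of \<open>X\<close> is an event of the path of
  \<open>X\<close>, because the \<open>l k\<close> are evaluation functionals; independence of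
  \<open>X\<close> and \<open>\<xi>\<^sub>0\<close> then supplies the last factor.\<close>

lemma Xi_box:
  assumes B: "\<And>k. k < Suc N \<Longrightarrow> B k \<in> sets borel"
  shows "measure P {\<omega>\<in>space P. \<forall>k<Suc N. \<Xi> k \<omega> \<in> B k} = (\<Prod>k<Suc N. measure std_normal_distribution (B k))"
proof -
  define C where "C = {g\<in>space path_space. \<forall>k<N. l k g \<in> B k}"
  have lm: "(\<lambda>g. l k g) \<in> borel_measurable path_space" if "k < N" for k
    by (rule eval_functional_measurable[OF l[OF that]]) (rule path_space_component)
  have C: "C \<in> sets path_space"
  proof -
    have "{g\<in>space path_space. l k g \<in> B k} \<in> sets path_space" if "k \<in> {..<N}" for k
    proof -
      have "l k -` B k \<inter> space path_space \<in> sets path_space"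
        using that by (intro measurable_sets[OF lm B]) auto
      also have "l k -` B k \<inter> space path_space = {g\<in>space path_space. l k g \<in> B k}" by auto
      finally show ?thesis .
    qed
    then have "{g\<in>space path_space. \<forall>k\<in>{..<N}. l k g \<in> B k} \<in> sets path_space"
      by (intro sets.sets_Collect_finite_All) auto
    then show ?thesis unfolding C_def by (simp only: Ball_def lessThan_iff)
  qed
  have XC: "X \<omega> \<in> C \<longleftrightarrow> (\<forall>k<N. l k (X \<omega>) \<in> B k)" if "\<omega> \<in> space P" for \<omega>
    using measurable_space[OF X_measurable that] by (simp add: C_def)
  have ev: "{\<omega>\<in>space P. X \<omega> \<in> C} \<in> sets P"
  proof -
    have "X -` C \<inter> space P = {\<omega>\<in>space P. X \<omega> \<in> C}" by auto
    then show ?thesis using measurable_sets[OF X_measurable C] by simp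
  qed
  have "{\<omega>\<in>space P. \<forall>k<Suc N. \<Xi> k \<omega> \<in> B k} = {\<omega>\<in>space P. X \<omega> \<in> C \<and> \<xi>\<^sub>0 \<omega> \<in> B N}"
    using XC by (auto simp: \<Xi>_def less_Suc_eq)
  then have "measure P {\<omega>\<in>space P. \<forall>k<Suc N. \<Xi> k \<omega> \<in> B k} = measure P {\<omega>\<in>space P. X \<omega> \<in> C} * measure P {\<omega>\<in>space P. \<xi>\<^sub>0 \<omega> \<in> B N}"
    using independent_rv_prob[OF prob X_xi0_indep C B] by simp
  also have "measure P {\<omega>\<in>space P. X \<omega> \<in> C} = (\<integral>\<omega>. indicator {\<omega>\<in>space P. X \<omega> \<in> C} \<omega> \<partial>P)"
    using ev by simp
  also have "\<dots> = (\<integral>\<omega>. (\<Prod>i<N. indicator (B i) (l i (X \<omega>))) \<partial>P)"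
  proof (rule Bochner_Integration.integral_cong[OF refl])
    fix \<omega> assume \<omega>: "\<omega> \<in> space P"
    show "indicator {\<omega>\<in>space P. X \<omega> \<in> C} \<omega> = (\<Prod>i<N. indicator (B i) (l i (X \<omega>)) :: real)"
    proof (cases "X \<omega> \<in> C")
      case True
      then have "\<forall>k<N. l k (X \<omega>) \<in> B k" using XC[OF \<omega>] by simp
      then show ?thesis using True \<omega> by simp
    next
      case False
      then obtain k where "k < N" "l k (X \<omega>) \<notin> B k" using XC[OF \<omega>] by blast
      then have "(\<Prod>i<N. indicator (B i) (l i (X \<omega>)) :: real) = 0" by (intro prod_zero bexI[of _ k]) auto
      then show ?thesis using False by simp
    qed
  qed
  also have "\<dots> = (\<Prod>i<N. measure std_normal_distribution (B i))" by (rule box) (use B in simp)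
  also have "measure P {\<omega>\<in>space P. \<xi>\<^sub>0 \<omega> \<in> B N} = measure std_normal_distribution (B N)"
  proof -
    have "std_normal_distribution = distr P lborel \<xi>\<^sub>0" using distributed_distr_eq_density[OF xi0] by simp
    then have "measure std_normal_distribution (B N) = measure P (\<xi>\<^sub>0 -` B N \<inter> space P)"
      using measure_distr[of \<xi>\<^sub>0 P lborel "B N"] xi0_measurable B by simp
    moreover have "\<xi>\<^sub>0 -` B N \<inter> space P = {\<omega>\<in>space P. \<xi>\<^sub>0 \<omega> \<in> B N}" by auto
    ultimately show ?thesis by simp
  qed
  finally show ?thesis by simp
qed

lemma X_eq_sum: "\<omega> \<in> space P \<Longrightarrow> X \<omega> x = exp t * f\<^sub>0 x * (\<Sum>k<N. \<Xi> k \<omega> * vhat k x)"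
proof -
  assume "\<omega> \<in> space P"
  then have "X \<omega> x = (\<Sum>i<N. l i (X \<omega>) *\<^sub>R v i) x" using rep[OF X_in_F] by simp
  also have "\<dots> = (\<Sum>i<N. \<Xi> i \<omega> * v i x)" by (simp add: sum_fun_apply scaleR_fun_apply \<Xi>_def)
  also have "\<dots> = exp t * f\<^sub>0 x * (\<Sum>k<N. \<Xi> k \<omega> * vhat k x)"
    unfolding sum_distrib_left vhat_def using f0_nonzero by (intro sum.cong) auto
  finally show ?thesis .
qed

lemma X_zero_iff: "\<omega> \<in> space P \<Longrightarrow> X \<omega> x = 0 \<longleftrightarrow> (\<Sum>k<N. \<Xi> k \<omega> * vhat k x) = 0"
  using f0_nonzero by (simp add: X_eq_sum)

lemma X0_zero_iff: "\<omega> \<in> space P \<Longrightarrow> X\<^sub>0 \<omega> x = 0 \<longleftrightarrow> (\<Sum>k<N. \<Xi> k \<omega> * vhat k x) = - exp (- t) * \<Xi> N \<omega>"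
proof -
  assume "\<omega> \<in> space P"
  then have "X\<^sub>0 \<omega> x = f\<^sub>0 x * (exp t * (\<Sum>k<N. \<Xi> k \<omega> * vhat k x) + \<Xi> N \<omega>)"
    unfolding X0 by (simp add: X_eq_sum \<Xi>_def algebra_simps)
  then have "X\<^sub>0 \<omega> x = 0 \<longleftrightarrow> exp t * (\<Sum>k<N. \<Xi> k \<omega> * vhat k x) + \<Xi> N \<omega> = 0"
    using f0_nonzero by simp
  also have "\<dots> \<longleftrightarrow> (\<Sum>k<N. \<Xi> k \<omega> * vhat k x) = - exp (- t) * \<Xi> N \<omega>"
    by (auto simp: exp_minus field_simps eq_neg_iff_add_eq_0 add.commute)
  finally show ?thesis .
qed

lemma ex_row_index: "\<exists>h. bij_betw h (UNIV :: 'e hyper set) {..<DIM('e) - 1}"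
  using ex_bij_betw_finite_nat[of "UNIV :: 'e hyper set"] CARD_hyper[OF dim] by (simp add: atLeast0LessThan)

lemma ex_vhat_nonzero:
  assumes "x \<in> S"
  shows "\<exists>k<N. vhat k x \<noteq> 0"
proof (rule ccontr)
  assume "\<not> ?thesis"
  then have "(\<Sum>k<N. (vhat k x)\<^sup>2) = 0" by simp
  then show False using sum_vhat_pos[of x] by simp
qed

text \<open>The equations of the copies are the rows of one system: variable \<open>(r, k)\<close>
  is coordinate \<open>k\<close> of copy \<open>r\<close> and enters only the row of that copy. So
  the rows are orthogonal and of norm 1 on \<open>S\<close>, all of them are Gaussian
  (\<open>R = UNIV\<close>), and the variables \<open>(r, N)\<close>, the copies of
  \<open>\<xi>\<^sub>0\<close>, give the right-hand side.\<close>

lemma iid_ratio: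
  assumes U: "openin (top_of_set S) U"
  shows "\<exists>q<1. expected_zeros_iid (DIM('e) - 1) P X\<^sub>0 U = q * expected_zeros_iid (DIM('e) - 1) P X U"
proof -
  define d where "d = DIM('e) - 1"
  obtain h where h: "bij_betw h (UNIV :: 'e hyper set) {..<d}" using ex_row_index unfolding d_def by blast
  have d0: "d > 0" using dim by (simp add: d_def)
  have hd: "h i < d" for i using h by (auto simp: bij_betw_def)
  have hinj: "h i = h j \<longleftrightarrow> i = j" for i j using h by (auto simp: bij_betw_def inj_eq)
  have hsurj: "\<exists>i. h i = r" if "r < d" for r using h that unfolding bij_betw_def by (metis imageE lessThan_iff)
  define J where "J = {..<d} \<times> {..<N}"
  define K1 where "K1 = {..<d} \<times> {N}"
  define vv :: "nat \<times> nat \<Rightarrow> 'a \<Rightarrow> real^('e hyper)" where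
    "vv j x = (\<chi> i. if h i = fst j then vhat (snd j) x else 0)" for j x
  have fin: "finite J" "finite K1" by (simp_all add: J_def K1_def)
  interpret sf: spanning_fields A S J vv
  proof
    show "\<exists>(Om :: (real^('e hyper)) set) \<psi>. parametrization A S Om \<psi> \<and> x \<in> \<psi> ` Om" if "x \<in> S" for x
      by (rule ex_parametrization[OF that])
    show "finite J" by (rule fin)
    show "C1_along A S (\<lambda>x. vv j x $ i)" if "j \<in> J" for j i
      unfolding vv_def using that vhat_C1_along zero_C1_along by (cases "h i = fst j") (auto simp: J_def)
    show "z = 0" if x: "x \<in> S" and z: "\<And>j. j \<in> J \<Longrightarrow> vv j x \<bullet> z = 0" for x z
    proof (rule vec_eq_iff[THEN iffD2], rule allI)
      fix i
      obtain k where k: "k < N" "vhat k x \<noteq> 0" using ex_vhat_nonzero[OF x] by blast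
      have "vv (h i, k) x \<bullet> z = (\<Sum>i'\<in>UNIV. if i' = i then vhat k x * z $ i else 0)"
        unfolding vv_def inner_vec_def by (intro sum.cong) (auto simp: hinj)
      also have "\<dots> = vhat k x * z $ i" by simp
      finally show "z $ i = 0 $ i" using z[of "(h i, k)"] k hd[of i] by (simp add: J_def)
    qed
  qed
  let ?L = "\<lambda>_ :: nat \<times> nat. lborel :: real measure"
  define P' where "P' = (\<Pi>\<^sub>M j\<in>{..<d}. P)"
  interpret PP: finite_product_prob_space "\<lambda>_. P" "{..<d}" by standard simp
  interpret P': prob_space P' unfolding P'_def by (rule PP.prob_space_axioms)
  have comp: "(\<lambda>\<eta>. \<Xi> k (\<eta> r)) \<in> borel_measurable P'" if "r < d" for r k
    unfolding P'_def using that by (intro measurable_compose[OF measurable_component_singleton[of r "{..<d}" "\<lambda>_. P"] Xi_measurable]) simp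
  have sp: "\<eta> r \<in> space P" if "\<eta> \<in> space P'" "r < d" for \<eta> r
    using that unfolding P'_def by (auto simp: space_PiM PiE_iff)
  have KJ: "K1 \<union> J = {..<d} \<times> {..<Suc N}" unfolding K1_def J_def by auto
  define \<Theta> where "\<Theta> \<eta> = (\<lambda>j\<in>K1 \<union> J. \<Xi> (snd j) (\<eta> (fst j)))" for \<eta>
  have Tm: "\<Theta> \<in> measurable P' (Pi\<^sub>M (K1 \<union> J) ?L)"
    unfolding \<Theta>_def by (intro measurable_restrict) (auto simp: KJ intro: comp)
  have Tlaw: "distr P' (Pi\<^sub>M (K1 \<union> J) ?L) \<Theta> = Pi\<^sub>M (K1 \<union> J) (\<lambda>_. std_normal_distribution)"
    unfolding \<Theta>_def
  proof (rule distr_eq_PiM_std_normal)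
    show "prob_space P'" by (rule P'.prob_space_axioms)
    show "finite (K1 \<union> J)" using fin by simp
    show "(\<lambda>\<eta>. \<Xi> (snd k) (\<eta> (fst k))) \<in> borel_measurable P'" if "k \<in> K1 \<union> J" for k
      using that comp by (auto simp: KJ)
    fix B :: "nat \<times> nat \<Rightarrow> real set" assume B: "\<And>k. k \<in> K1 \<union> J \<Longrightarrow> B k \<in> sets borel"
    \<comment> \<open>A box for all copies is a product over the copies, and \<open>Xi_box\<close>
      evaluates each factor.\<close>
    define E where "E r = {\<omega>\<in>space P. \<forall>k<Suc N. \<Xi> k \<omega> \<in> B (r, k)}" for r
    have Br: "B (r, k) \<in> sets borel" if "r < d" "k < Suc N" for r k using B that by (simp add: KJ)
    have Em: "E r \<in> sets P" if r: "r < d" for r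
    proof -
      have "{\<omega>\<in>space P. \<Xi> k \<omega> \<in> B (r, k)} \<in> sets P" if "k \<in> {..<Suc N}" for k
      proof -
        have "\<Xi> k -` B (r, k) \<inter> space P \<in> sets P"
          using that by (intro measurable_sets[OF Xi_measurable Br[OF r]]) auto
        also have "\<Xi> k -` B (r, k) \<inter> space P = {\<omega>\<in>space P. \<Xi> k \<omega> \<in> B (r, k)}" by auto
        finally show ?thesis .
      qed
      then have "{\<omega>\<in>space P. \<forall>k\<in>{..<Suc N}. \<Xi> k \<omega> \<in> B (r, k)} \<in> sets P"
        by (intro sets.sets_Collect_finite_All) auto
      then show ?thesis unfolding E_def by (simp only: Ball_def lessThan_iff)
    qed
    have "{\<eta>\<in>space P'. \<forall>k\<in>K1 \<union> J. \<Xi> (snd k) (\<eta> (fst k)) \<in> B k} = Pi\<^sub>E {..<d} E"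
      unfolding KJ P'_def E_def by (auto simp: space_PiM PiE_iff extensional_def)
    then have "measure P' {\<eta>\<in>space P'. \<forall>k\<in>K1 \<union> J. \<Xi> (snd k) (\<eta> (fst k)) \<in> B k} = (\<Prod>r<d. measure P (E r))"
      unfolding P'_def using PP.prob_times[of E] Em by simp
    also have "\<dots> = (\<Prod>r<d. \<Prod>k<Suc N. measure std_normal_distribution (B (r, k)))"
      unfolding E_def using Xi_box Br by (intro prod.cong) auto
    also have "\<dots> = (\<Prod>k\<in>K1 \<union> J. measure std_normal_distribution (B k))"
      unfolding KJ prod.cartesian_product by (simp add: case_prod_beta')
    finally show "measure P' {\<eta>\<in>space P'. \<forall>k\<in>K1 \<union> J. \<Xi> (snd k) (\<eta> (fst k)) \<in> B k} = (\<Prod>k\<in>K1 \<union> J. measure std_normal_distribution (B k))" .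
  qed
  \<comment> \<open>There is no block besides the Gaussian one: \<open>I\<close> is empty, and this
    constant value is the only point of the product over the empty set.\<close>
  define c :: "(nat \<Rightarrow> 'w) \<Rightarrow> nat \<times> nat \<Rightarrow> real" where "c = (\<lambda>_ _. undefined)"
  define s :: "(nat \<times> nat \<Rightarrow> real) \<Rightarrow> real^('e hyper)" where
    "s z = (\<Sum>i\<in>UNIV. (- exp (- t) * z (h i, N)) *\<^sub>R axis i 1)" for z
  have s_nth: "s z $ i = - exp (- t) * z (h i, N)" for z i
    unfolding s_def by (simp add: axis_def sum_negf if_distrib[of "\<lambda>c. _ * c"] cong: if_cong)
  have cm: "c \<in> measurable P' (Pi\<^sub>M {} ?L)" unfolding c_def by (intro measurable_const) (simp add: space_PiM)
  have claw: "distr P' (Pi\<^sub>M {} ?L) c = density (Pi\<^sub>M {} ?L) (\<lambda>_. 1)"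
  proof -
    interpret product_sigma_finite ?L ..
    have "distr P' (Pi\<^sub>M {} ?L) c = Pi\<^sub>M {} ?L"
    proof (rule PiM_eqI)
      fix B :: "nat \<times> nat \<Rightarrow> real set"
      have "emeasure (distr P' (Pi\<^sub>M {} ?L) c) (Pi\<^sub>E {} B) = emeasure P' (c -` Pi\<^sub>E {} B \<inter> space P')"
        by (rule emeasure_distr[OF cm]) (simp add: sets_PiM_empty)
      also have "c -` Pi\<^sub>E {} B \<inter> space P' = space P'" by (auto simp: c_def)
      finally show "emeasure (distr P' (Pi\<^sub>M {} ?L) c) (Pi\<^sub>E {} B) = (\<Prod>i\<in>{}. emeasure lborel (B i))"
        by (simp add: P'.emeasure_space_1)
    qed simp_all
    then show ?thesis by (simp add: density_1)
  qed
  have "\<exists>q<1. (\<integral>\<^sup>+\<eta>. emeasure (count_space UNIV) {x\<in>U. (\<Sum>j\<in>J. merge {} J (c \<eta>, \<Theta> \<eta>) j *\<^sub>R vv j x) = s (restrict (\<Theta> \<eta>) K1)} \<partial>P') =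
    q * (\<integral>\<^sup>+\<eta>. emeasure (count_space UNIV) {x\<in>U. (\<Sum>j\<in>J. merge {} J (c \<eta>, \<Theta> \<eta>) j *\<^sub>R vv j x) = 0} \<partial>P')"
  proof (rule sf.expected_zeros_ratio[where I = "{}" and ?K0.0 = J and ?K1.0 = K1 and r = "\<lambda>_. 1" and R = UNIV])
    show "prob_space P'" by (rule P'.prob_space_axioms)
    show "J \<inter> K1 = {}" by (auto simp: J_def K1_def)
    show "measure P' {\<eta>\<in>space P'. c \<eta> \<in> C \<and> \<Theta> \<eta> \<in> D} = measure P' {\<eta>\<in>space P'. c \<eta> \<in> C} * measure P' {\<eta>\<in>space P'. \<Theta> \<eta> \<in> D}" for C D
      unfolding c_def by (cases "(\<lambda>_. undefined) \<in> C") (simp_all add: P'.prob_space)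
    show "s \<in> borel_measurable (Pi\<^sub>M K1 ?L)"
      unfolding s_def
    proof (intro borel_measurable_sum borel_measurable_scaleR borel_measurable_times borel_measurable_const)
      fix i
      show "(\<lambda>z. z (h i, N)) \<in> borel_measurable (Pi\<^sub>M K1 ?L)"
        using measurable_component_singleton[of "(h i, N)" K1 ?L] hd[of i] by (simp add: K1_def)
    qed
    show "(\<Sum>j\<in>J. (vv j x $ i)\<^sup>2) = 1" if "x \<in> S" for x i
    proof -
      have "(\<Sum>j\<in>J. (vv j x $ i)\<^sup>2) = (\<Sum>r<d. \<Sum>k<N. if r = h i then (vhat k x)\<^sup>2 else 0)"
        unfolding J_def sum.cartesian_product vv_def by (intro sum.cong) auto
      also have "\<dots> = (\<Sum>r<d. if r = h i then (\<Sum>k<N. (vhat k x)\<^sup>2) else 0)" by (intro sum.cong) auto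
      also have "\<dots> = 1" using hd[of i] that in_S_iff[of x] by simp
      finally show ?thesis .
    qed
    show "(\<forall>x\<in>S. vv j x $ k = 0) \<or> (\<forall>x\<in>S. vv j x $ i = 0)" if "k \<noteq> i" for j i k
    proof -
      have "h k \<noteq> fst j \<or> h i \<noteq> fst j" using that hinj[of k i] by auto
      then show ?thesis by (auto simp: vv_def)
    qed
    show "AE z in Pi\<^sub>M K1 (\<lambda>_. std_normal_distribution). s z \<noteq> 0"
    proof -
      \<comment> \<open>One nonzero component is enough, and component 0 exists because
        \<open>d > 0\<close>.\<close>
      obtain i where i: "h i = 0" using hsurj[OF d0] by blast
      have "(0, N) \<in> K1" using d0 by (simp add: K1_def)
      then have "AE z in Pi\<^sub>M K1 (\<lambda>_. std_normal_distribution). z (0, N) \<noteq> 0"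
        by (intro AE_PiM_component prob_space_std_normal AE_std_normal_nonzero)
      then show ?thesis
      proof eventually_elim
        case (elim z)
        then have "s z $ i \<noteq> 0" by (simp add: s_nth i)
        then show ?case by auto
      qed
    qed
  qed (use fin U cm claw Tm Tlaw in simp_all)
  moreover have conv: "(\<Sum>j\<in>J. merge {} J (c \<eta>, \<Theta> \<eta>) j *\<^sub>R vv j x) $ i = (\<Sum>k<N. \<Xi> k (\<eta> (h i)) * vhat k x)" for \<eta> x i
  proof -
    have "(\<Sum>j\<in>J. merge {} J (c \<eta>, \<Theta> \<eta>) j *\<^sub>R vv j x) $ i = (\<Sum>r<d. \<Sum>k<N. if r = h i then \<Xi> k (\<eta> (h i)) * vhat k x else 0)"
      unfolding sum_component J_def sum.cartesian_product
      by (intro sum.cong) (auto simp: vv_def merge_def \<Theta>_def J_def)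
    also have "\<dots> = (\<Sum>r<d. if r = h i then (\<Sum>k<N. \<Xi> k (\<eta> (h i)) * vhat k x) else 0)" by (intro sum.cong) auto
    finally show ?thesis using hd[of i] by simp
  qed
  have all_rows: "(\<forall>i. Q (h i)) \<longleftrightarrow> (\<forall>r<d. Q r)" for Q using hd hsurj by metis
  have "expected_zeros_iid d P X\<^sub>0 U = (\<integral>\<^sup>+\<eta>. emeasure (count_space UNIV) {x\<in>U. (\<Sum>j\<in>J. merge {} J (c \<eta>, \<Theta> \<eta>) j *\<^sub>R vv j x) = s (restrict (\<Theta> \<eta>) K1)} \<partial>P')"
    unfolding expected_zeros_iid_def P'_def[symmetric]
  proof (rule nn_integral_cong)
    fix \<eta> assume \<eta>: "\<eta> \<in> space P'"
    have "(\<Sum>j\<in>J. merge {} J (c \<eta>, \<Theta> \<eta>) j *\<^sub>R vv j x) = s (restrict (\<Theta> \<eta>) K1) \<longleftrightarrow> (\<forall>r<d. X\<^sub>0 (\<eta> r) x = 0)" for x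
    proof -
      have "(\<Sum>j\<in>J. merge {} J (c \<eta>, \<Theta> \<eta>) j *\<^sub>R vv j x) = s (restrict (\<Theta> \<eta>) K1) \<longleftrightarrow>
          (\<forall>i. (\<Sum>k<N. \<Xi> k (\<eta> (h i)) * vhat k x) = - exp (- t) * \<Xi> N (\<eta> (h i)))"
        unfolding vec_eq_iff conv s_nth using hd by (simp add: \<Theta>_def K1_def)
      also have "\<dots> \<longleftrightarrow> (\<forall>i. X\<^sub>0 (\<eta> (h i)) x = 0)" using X0_zero_iff[OF sp[OF \<eta> hd]] by simp
      also have "\<dots> \<longleftrightarrow> (\<forall>r<d. X\<^sub>0 (\<eta> r) x = 0)" by (rule all_rows)
      finally show ?thesis .
    qed
    then show "emeasure (count_space UNIV) {x\<in>U. \<forall>j<d. X\<^sub>0 (\<eta> j) x = 0} =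
      emeasure (count_space UNIV) {x\<in>U. (\<Sum>j\<in>J. merge {} J (c \<eta>, \<Theta> \<eta>) j *\<^sub>R vv j x) = s (restrict (\<Theta> \<eta>) K1)}" by simp
  qed
  moreover have "expected_zeros_iid d P X U = (\<integral>\<^sup>+\<eta>. emeasure (count_space UNIV) {x\<in>U. (\<Sum>j\<in>J. merge {} J (c \<eta>, \<Theta> \<eta>) j *\<^sub>R vv j x) = 0} \<partial>P')"
    unfolding expected_zeros_iid_def P'_def[symmetric]
  proof (rule nn_integral_cong)
    fix \<eta> assume \<eta>: "\<eta> \<in> space P'"
    have "(\<Sum>j\<in>J. merge {} J (c \<eta>, \<Theta> \<eta>) j *\<^sub>R vv j x) = 0 \<longleftrightarrow> (\<forall>r<d. X (\<eta> r) x = 0)" for x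
    proof -
      have "(\<Sum>j\<in>J. merge {} J (c \<eta>, \<Theta> \<eta>) j *\<^sub>R vv j x) = 0 \<longleftrightarrow> (\<forall>i. (\<Sum>k<N. \<Xi> k (\<eta> (h i)) * vhat k x) = 0)"
        unfolding vec_eq_iff conv by simp
      also have "\<dots> \<longleftrightarrow> (\<forall>i. X (\<eta> (h i)) x = 0)" using X_zero_iff[OF sp[OF \<eta> hd]] by simp
      also have "\<dots> \<longleftrightarrow> (\<forall>r<d. X (\<eta> r) x = 0)" by (rule all_rows)
      finally show ?thesis .
    qed
    then show "emeasure (count_space UNIV) {x\<in>U. \<forall>j<d. X (\<eta> j) x = 0} =
      emeasure (count_space UNIV) {x\<in>U. (\<Sum>j\<in>J. merge {} J (c \<eta>, \<Theta> \<eta>) j *\<^sub>R vv j x) = 0}" by simp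
  qed
  ultimately show ?thesis unfolding d_def by simp
qed

end

section \<open>The case of one Gaussian equation and an auxiliary field\<close>

context gaussian_level
begin

text \<open>\<open>X\<^sub>0\<close> alone determines the coordinates of both parts:
  \<open>L\<^sub>0\<close> returns \<open>\<xi>\<^sub>0\<close>, after which each \<open>l k\<close>
  returns its value at \<open>X\<close>.\<close>

lemma l_X0: "k < N \<Longrightarrow> l k (X\<^sub>0 \<omega>) = l k (X \<omega>) + \<xi>\<^sub>0 \<omega> * l k f\<^sub>0"
  and L0_X0: "\<omega> \<in> space P \<Longrightarrow> L\<^sub>0 (X\<^sub>0 \<omega>) = \<xi>\<^sub>0 \<omega>"
proof -
  have e: "X\<^sub>0 \<omega> = X \<omega> + \<xi>\<^sub>0 \<omega> *\<^sub>R f\<^sub>0" by (simp add: fun_eq_iff X0 scaleR_fun_apply)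
  show "l k (X\<^sub>0 \<omega>) = l k (X \<omega>) + \<xi>\<^sub>0 \<omega> * l k f\<^sub>0" if "k < N"
    unfolding e linear_add[OF eval_functional_linear[OF l[OF that]]] linear_cmul[OF eval_functional_linear[OF l[OF that]]] by simp
  show "L\<^sub>0 (X\<^sub>0 \<omega>) = \<xi>\<^sub>0 \<omega>" if "\<omega> \<in> space P"
    unfolding e linear_add[OF eval_functional_linear[OF L0(1)]] linear_cmul[OF eval_functional_linear[OF L0(1)]]
    by (simp add: L0(2)[OF X_in_F[OF that]] L0(3))
qed

text \<open>One row, with index \<open>i0\<close>, carries the Gaussian field, and the other
  \<open>m\<close> rows carry the components of \<open>W\<close>. Variables below \<open>G\<close>
  are the coordinates of \<open>W\<close>, variable \<open>G + k\<close> is coordinate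
  \<open>k\<close> of \<open>X\<close>, and \<open>G + N\<close> is \<open>\<xi>\<^sub>0\<close>.
  Only row \<open>i0\<close> is shifted (\<open>R = {i0}\<close>); for \<open>DIM('e) = 2\<close> it
  is the only row.\<close>

lemma field_ratio:
  assumes U: "openin (top_of_set S) U" and W: "admissible A S (DIM('e) - 2) P W"
    and WX0: "independent_rv P path_space W path_space X\<^sub>0"
  shows "\<exists>q<1. expected_zeros P X\<^sub>0 W U = q * expected_zeros P X W U"
proof -
  define m where "m = DIM('e) - 2"
  have dm: "DIM('e) - 1 = Suc m" using dim by (simp add: m_def)
  obtain h where h: "bij_betw h (UNIV :: 'e hyper set) {..<Suc m}" using ex_row_index unfolding dm by blast
  have hd: "h i < Suc m" for i using h by (auto simp: bij_betw_def)
  have hinj: "h i = h j \<longleftrightarrow> i = j" for i j using h by (auto simp: bij_betw_def inj_eq)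
  have hsurj: "\<exists>i. h i = r" if "r < Suc m" for r using h that unfolding bij_betw_def by (metis imageE lessThan_iff)
  obtain i0 where i0: "h i0 = 0" using hsurj[of 0] by blast
  have h0: "h i = 0 \<longleftrightarrow> i = i0" for i using hinj[of i i0] i0 by simp
  obtain G e \<Lambda> r where e: "\<And>i. i < (G::nat) \<Longrightarrow> e i \<in> smooth_fields A S m"
    and surj: "\<And>x w. x \<in> S \<Longrightarrow> w \<in> Rn m \<Longrightarrow> \<exists>a. \<forall>k. w k = (\<Sum>i<G. a i * e i x k)"
    and \<Lambda>: "\<And>i. i < G \<Longrightarrow> \<Lambda> i \<in> eval_functionals"
    and Wrep: "AE \<omega> in P. \<forall>x k. W \<omega> x k = (\<Sum>i<G. \<Lambda> i (uncurry_field (W \<omega>)) * e i x k)"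
    and rm: "r \<in> borel_measurable (Pi\<^sub>M {..<G} (\<lambda>_. lborel))"
    and claw: "distr P (Pi\<^sub>M {..<G} (\<lambda>_. lborel)) (\<lambda>\<omega>. \<lambda>i\<in>{..<G}. \<Lambda> i (uncurry_field (W \<omega>))) = density (Pi\<^sub>M {..<G} (\<lambda>_. lborel)) r"
    by (rule admissible_coordinates[OF prob W[folded m_def]]) (rule that)
  define K0 where "K0 = (\<lambda>k. G + k) ` {..<N}"
  define K1 where "K1 = {G + N}"
  define J where "J = {..<G} \<union> K0"
  have fin: "finite {..<G}" "finite K0" "finite K1" by (simp_all add: K0_def K1_def)
  have disj: "{..<G} \<inter> K0 = {}" "K0 \<inter> K1 = {}" by (auto simp: K0_def K1_def)
  have inj: "inj_on (\<lambda>k. G + k) B" for B by simp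
  \<comment> \<open>Row number 0 is kept for the Gaussian field, so a row with
    \<open>h i > 0\<close> holds component \<open>h i - 1\<close> of \<open>W\<close>; the case
    distinction keeps the truncated subtraction away from 0.\<close>
  define vv :: "nat \<Rightarrow> 'a \<Rightarrow> real^('e hyper)" where
    "vv j x = (\<chi> i. if j < G then (if h i = 0 then 0 else e j x (h i - 1)) else (if h i = 0 then vhat (j - G) x else 0))" for j x
  have sumJ: "(\<Sum>j\<in>J. g j) = (\<Sum>j<G. g j) + (\<Sum>k<N. g (G + k))" for g :: "nat \<Rightarrow> real"
    unfolding J_def using fin disj by (simp add: sum.union_disjoint K0_def sum.reindex[OF inj] o_def)
  have row: "(\<Sum>j\<in>J. a j * vv j x $ i) = (if i = i0 then (\<Sum>k<N. a (G + k) * vhat k x) else (\<Sum>j<G. a j * e j x (h i - 1)))" for a x i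
    unfolding sumJ by (simp add: vv_def h0)
  interpret sf: spanning_fields A S J vv
  proof
    show "\<exists>(Om :: (real^('e hyper)) set) \<psi>. parametrization A S Om \<psi> \<and> x \<in> \<psi> ` Om" if "x \<in> S" for x
      by (rule ex_parametrization[OF that])
    show "finite J" using fin by (simp add: J_def)
    show "C1_along A S (\<lambda>x. vv j x $ i)" if "j \<in> J" for j i
    proof (cases "j < G")
      case True
      then have "(\<lambda>x. e j x (h i - 1)) \<in> smooth_funs A S" using e[OF True] by (simp add: smooth_fields_def)
      then show ?thesis using True zero_C1_along smooth_funs_imp_C1_along
        by (cases "h i = 0") (auto simp: vv_def)
    next
      case False
      then have "j - G < N" using that by (auto simp: J_def K0_def)
      then show ?thesis using False zero_C1_along vhat_C1_along by (cases "h i = 0") (auto simp: vv_def)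
    qed
    show "z = 0" if x: "x \<in> S" and z: "\<And>j. j \<in> J \<Longrightarrow> vv j x \<bullet> z = 0" for x z
    proof (rule vec_eq_iff[THEN iffD2], rule allI)
      fix i
      obtain k where k: "k < N" "vhat k x \<noteq> 0" using ex_vhat_nonzero[OF x] by blast
      have "vv (G + k) x \<bullet> z = (\<Sum>i'\<in>UNIV. if i' = i0 then vhat k x * z $ i0 else 0)"
        unfolding vv_def inner_vec_def by (intro sum.cong) (auto simp: h0)
      then have z0: "z $ i0 = 0" using z[of "G + k"] k by (simp add: J_def K0_def)
      \<comment> \<open>\<open>w\<close> lists the entries of \<open>z\<close> in the rows of
        \<open>W\<close>; the entry at \<open>i0\<close> is already 0. Surjectivity of the
        evaluation writes \<open>w\<close> as a combination of the \<open>e j x\<close>, and pairing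
        \<open>z\<close> with the same combination of the \<open>vv j x\<close> shows that its
        squared norm is 0.\<close>
      define w where "w n = (if n < m then z $ (inv_into UNIV h (Suc n)) else 0)" for n
      have "w \<in> Rn m" by (simp add: w_def Rn_def)
      then obtain a where a: "\<forall>n. w n = (\<Sum>j<G. a j * e j x n)" using surj[OF x] by blast
      have wi: "w (h i - 1) = z $ i" if "i \<noteq> i0" for i
      proof -
        have "h i - 1 < m" "Suc (h i - 1) = h i" using that hd[of i] h0[of i] by linarith+
        moreover have "inv_into UNIV h (h i) = i" using h by (simp add: bij_betw_def inv_into_f_f)
        ultimately show ?thesis by (simp add: w_def)
      qed
      have "(\<Sum>i\<in>UNIV. (z $ i)\<^sup>2) = (\<Sum>i\<in>UNIV. \<Sum>j<G. a j * (vv j x $ i * z $ i))"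
      proof (rule sum.cong)
        fix i :: "'e hyper"
        show "(z $ i)\<^sup>2 = (\<Sum>j<G. a j * (vv j x $ i * z $ i))"
        proof (cases "i = i0")
          case False
          have "(z $ i)\<^sup>2 = (\<Sum>j<G. a j * e j x (h i - 1)) * z $ i"
            using wi[OF False] a by (simp add: power2_eq_square)
          also have "\<dots> = (\<Sum>j<G. a j * (vv j x $ i * z $ i))"
            using False by (simp add: sum_distrib_right vv_def h0 mult.assoc)
          finally show ?thesis .
        qed (simp add: z0)
      qed simp
      also have "\<dots> = (\<Sum>j<G. a j * (vv j x \<bullet> z))"
        unfolding inner_vec_def by (subst sum.swap) (simp add: sum_distrib_left)
      also have "\<dots> = 0" using z by (intro sum.neutral) (auto simp: J_def)
      finally show "z $ i = 0 $ i" by (simp add: sum_nonneg_eq_0_iff)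
    qed
  qed
  let ?L = "\<lambda>_ :: nat. lborel :: real measure"
  have Wm: "W \<in> measurable P path_space" and X0m: "X\<^sub>0 \<in> measurable P path_space"
    using WX0 by (simp_all add: independent_rv_def)
  define cf where "cf w = (\<lambda>i\<in>{..<G}. \<Lambda> i (uncurry_field w))" for w
  have cfm: "cf \<in> measurable path_space (Pi\<^sub>M {..<G} ?L)"
  proof -
    have "(\<lambda>w. uncurry_field w q) \<in> borel_measurable path_space" for q
    proof -
      obtain x k where q: "q = (x, k)" by (cases q)
      have "(\<lambda>f :: nat \<Rightarrow> real. f k) \<in> borel_measurable borel"
        by (rule borel_measurable_continuous_onI) (rule continuous_on_product_coordinates)
      from measurable_compose[OF path_space_component this] show ?thesis unfolding q uncurry_field_def by simp
    qed
    then have "(\<lambda>w. \<Lambda> i (uncurry_field w)) \<in> borel_measurable path_space" if "i < G" for i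
      by (rule eval_functional_measurable[OF \<Lambda>[OF that]])
    then show ?thesis unfolding cf_def by (intro measurable_restrict) simp
  qed
  \<comment> \<open>The Gaussian coordinates as functions of the path of \<open>X\<^sub>0\<close>.
    Joint independence of \<open>W\<close> from \<open>X\<close> and \<open>\<xi>\<^sub>0\<close> is
    not assumed directly; it is obtained by writing both in terms of
    \<open>X\<^sub>0\<close>.\<close>
  define Tf where "Tf g = (\<lambda>j\<in>K1 \<union> K0. if j - G < N then l (j - G) g - L\<^sub>0 g * l (j - G) f\<^sub>0 else L\<^sub>0 g)" for g
  have Tfm: "Tf \<in> measurable path_space (Pi\<^sub>M (K1 \<union> K0) ?L)"
  proof -
    have L0m: "L\<^sub>0 \<in> borel_measurable path_space"
      by (rule eval_functional_measurable[OF L0(1)]) (rule path_space_component)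
    have lm: "l k \<in> borel_measurable path_space" if "k < N" for k
      by (rule eval_functional_measurable[OF l[OF that]]) (rule path_space_component)
    have "(\<lambda>g. if j - G < N then l (j - G) g - L\<^sub>0 g * l (j - G) f\<^sub>0 else L\<^sub>0 g) \<in> borel_measurable path_space" for j
      using L0m lm by (cases "j - G < N") simp_all
    then show ?thesis unfolding Tf_def by (intro measurable_restrict) simp
  qed
  define c where "c \<omega> = cf (W \<omega>)" for \<omega>
  define \<Theta> where "\<Theta> \<omega> = (\<lambda>j\<in>K1 \<union> K0. \<Xi> (j - G) \<omega>)" for \<omega>
  have \<Theta>Tf: "\<Theta> \<omega> = Tf (X\<^sub>0 \<omega>)" if "\<omega> \<in> space P" for \<omega>
    unfolding \<Theta>_def Tf_def using l_X0 L0_X0[OF that] by (auto simp: fun_eq_iff \<Xi>_def)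
  have cm: "c \<in> measurable P (Pi\<^sub>M {..<G} ?L)" unfolding c_def by (rule measurable_compose[OF Wm cfm])
  have Tm: "\<Theta> \<in> measurable P (Pi\<^sub>M (K1 \<union> K0) ?L)"
    unfolding \<Theta>_def by (intro measurable_restrict) (simp add: Xi_measurable)
  have KK: "K1 \<union> K0 = (\<lambda>k. G + k) ` {..<Suc N}" unfolding K0_def K1_def by (auto simp: lessThan_Suc)
  have Tlaw: "distr P (Pi\<^sub>M (K1 \<union> K0) ?L) \<Theta> = Pi\<^sub>M (K1 \<union> K0) (\<lambda>_. std_normal_distribution)"
    unfolding \<Theta>_def
  proof (rule distr_eq_PiM_std_normal[OF prob])
    show "finite (K1 \<union> K0)" using fin by simp
    show "\<Xi> (k - G) \<in> borel_measurable P" for k by (rule Xi_measurable)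
    fix B :: "nat \<Rightarrow> real set" assume B: "\<And>k. k \<in> K1 \<union> K0 \<Longrightarrow> B k \<in> sets borel"
    have "measure P {\<omega>\<in>space P. \<forall>k\<in>K1 \<union> K0. \<Xi> (k - G) \<omega> \<in> B k} = measure P {\<omega>\<in>space P. \<forall>k<Suc N. \<Xi> k \<omega> \<in> B (G + k)}"
      unfolding KK by (rule arg_cong[where f = "measure P"]) auto
    also have "\<dots> = (\<Prod>k<Suc N. measure std_normal_distribution (B (G + k)))"
      by (rule Xi_box) (rule B, simp add: KK)
    also have "\<dots> = (\<Prod>k\<in>K1 \<union> K0. measure std_normal_distribution (B k))"
      unfolding KK prod.reindex[OF inj] o_def ..
    finally show "measure P {\<omega>\<in>space P. \<forall>k\<in>K1 \<union> K0. \<Xi> (k - G) \<omega> \<in> B k} = (\<Prod>k\<in>K1 \<union> K0. measure std_normal_distribution (B k))" .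
  qed
  have ind: "measure P {\<omega>\<in>space P. c \<omega> \<in> C \<and> \<Theta> \<omega> \<in> D} = measure P {\<omega>\<in>space P. c \<omega> \<in> C} * measure P {\<omega>\<in>space P. \<Theta> \<omega> \<in> D}"
    if C: "C \<in> sets (Pi\<^sub>M {..<G} ?L)" and D: "D \<in> sets (Pi\<^sub>M (K1 \<union> K0) ?L)" for C D
  proof -
    have Cs: "cf -` C \<inter> space path_space \<in> sets path_space" by (rule measurable_sets[OF cfm C])
    have Ds: "Tf -` D \<inter> space path_space \<in> sets path_space" by (rule measurable_sets[OF Tfm D])
    have c': "c \<omega> \<in> C \<longleftrightarrow> W \<omega> \<in> cf -` C \<inter> space path_space" if "\<omega> \<in> space P" for \<omega>
      using measurable_space[OF Wm that] by (simp add: c_def)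
    have t': "\<Theta> \<omega> \<in> D \<longleftrightarrow> X\<^sub>0 \<omega> \<in> Tf -` D \<inter> space path_space" if "\<omega> \<in> space P" for \<omega>
      using measurable_space[OF X0m that] by (simp add: \<Theta>Tf[OF that])
    have "{\<omega>\<in>space P. c \<omega> \<in> C \<and> \<Theta> \<omega> \<in> D} = {\<omega>\<in>space P. W \<omega> \<in> cf -` C \<inter> space path_space \<and> X\<^sub>0 \<omega> \<in> Tf -` D \<inter> space path_space}"
      "{\<omega>\<in>space P. c \<omega> \<in> C} = {\<omega>\<in>space P. W \<omega> \<in> cf -` C \<inter> space path_space}"
      "{\<omega>\<in>space P. \<Theta> \<omega> \<in> D} = {\<omega>\<in>space P. X\<^sub>0 \<omega> \<in> Tf -` D \<inter> space path_space}"
      by (rule Collect_cong, use c' t' in blast)+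
    then show ?thesis using independent_rv_prob[OF prob WX0 Cs Ds] by simp
  qed
  define s :: "(nat \<Rightarrow> real) \<Rightarrow> real^('e hyper)" where "s z = (- exp (- t) * z (G + N)) *\<^sub>R axis i0 1" for z
  have s_nth: "s z $ i = (if i = i0 then - exp (- t) * z (G + N) else 0)" for z i
    unfolding s_def by (simp add: axis_def)
  let ?\<theta> = "\<lambda>\<omega>. merge {..<G} K0 (c \<omega>, \<Theta> \<omega>)"
  have ratio: "\<exists>q<1. (\<integral>\<^sup>+\<omega>. emeasure (count_space UNIV) {x\<in>U. (\<Sum>j\<in>J. ?\<theta> \<omega> j *\<^sub>R vv j x) = s (restrict (\<Theta> \<omega>) K1)} \<partial>P) =
    q * (\<integral>\<^sup>+\<omega>. emeasure (count_space UNIV) {x\<in>U. (\<Sum>j\<in>J. ?\<theta> \<omega> j *\<^sub>R vv j x) = 0} \<partial>P)"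
  proof (rule sf.expected_zeros_ratio[OF prob fin disj J_def cm rm _ Tm Tlaw ind U, where R = "{i0}"])
    show "distr P (Pi\<^sub>M {..<G} ?L) c = density (Pi\<^sub>M {..<G} ?L) r"
      unfolding c_def cf_def by (rule claw)
    show "s \<in> borel_measurable (Pi\<^sub>M K1 ?L)"
      unfolding s_def
    proof (intro borel_measurable_scaleR borel_measurable_times borel_measurable_const)
      show "(\<lambda>z. z (G + N)) \<in> borel_measurable (Pi\<^sub>M K1 ?L)"
        using measurable_component_singleton[of "G + N" K1 ?L] by (simp add: K1_def)
    qed
    show "s z $ i = 0" if "i \<notin> {i0}" for z i using that by (simp add: s_nth)
    show "(\<Sum>j\<in>J. (vv j x $ i)\<^sup>2) = 1" if "x \<in> S" "i \<in> {i0}" for x i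
      unfolding sumJ using that in_S_iff[of x] by (simp add: vv_def h0)
    show "(\<forall>x\<in>S. vv j x $ k = 0) \<or> (\<forall>x\<in>S. vv j x $ i = 0)" if "i \<in> {i0}" "k \<noteq> i" for j i k
      using that by (cases "j < G") (auto simp: vv_def h0)
    show "vv j x $ i = 0" if "j \<in> {..<G}" "i \<in> {i0}" for j i x
      using that by (simp add: vv_def h0)
    show "AE z in Pi\<^sub>M K1 (\<lambda>_. std_normal_distribution). s z \<noteq> 0"
    proof -
      have "AE z in Pi\<^sub>M K1 (\<lambda>_. std_normal_distribution). z (G + N) \<noteq> 0"
        by (intro AE_PiM_component prob_space_std_normal AE_std_normal_nonzero) (simp add: K1_def)
      then show ?thesis
      proof eventually_elim
        case (elim z)
        then have "s z $ i0 \<noteq> 0" by (simp add: s_nth)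
        then show ?case by auto
      qed
    qed
  qed assumption+
  have conv: "(\<Sum>j\<in>J. ?\<theta> \<omega> j *\<^sub>R vv j x) $ i =
     (if i = i0 then (\<Sum>k<N. \<Xi> k \<omega> * vhat k x) else W \<omega> x (h i - 1))"
    if w: "\<forall>x k. W \<omega> x k = (\<Sum>i<G. \<Lambda> i (uncurry_field (W \<omega>)) * e i x k)" for \<omega> x i
  proof -
    have 1: "?\<theta> \<omega> (G + k) = \<Xi> k \<omega>" if "k < N" for k
      using that by (simp add: merge_def \<Theta>_def K0_def)
    have 2: "?\<theta> \<omega> j = \<Lambda> j (uncurry_field (W \<omega>))" if "j < G" for j
      using that by (simp add: merge_def c_def cf_def)
    have "(\<Sum>j\<in>J. ?\<theta> \<omega> j *\<^sub>R vv j x) $ i = (\<Sum>j\<in>J. ?\<theta> \<omega> j * vv j x $ i)" by simp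
    then show ?thesis unfolding row using w 1 2 by simp
  qed
  have W0: "W \<omega> x = 0 \<longleftrightarrow> (\<forall>i. i \<noteq> i0 \<longrightarrow> W \<omega> x (h i - 1) = 0)" if "\<omega> \<in> space P" for \<omega> x
  proof
    assume a: "\<forall>i. i \<noteq> i0 \<longrightarrow> W \<omega> x (h i - 1) = 0"
    have "W \<omega> \<in> smooth_fields A S m" using W that unfolding admissible_def m_def by blast
    then have R: "W \<omega> x \<in> Rn m" by (simp add: smooth_fields_def)
    have "W \<omega> x n = 0" for n
    proof (cases "n < m")
      case True
      then obtain i where "h i = Suc n" using hsurj[of "Suc n"] by auto
      then show ?thesis using a[rule_format, of i] h0[of i] by simp
    next
      case False
      then show ?thesis using R by (simp add: Rn_def)
    qed
    then show "W \<omega> x = 0" by (simp add: fun_eq_iff zero_fun_def)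
  qed (simp add: zero_fun_def)
  have E0: "expected_zeros P X\<^sub>0 W U = (\<integral>\<^sup>+\<omega>. emeasure (count_space UNIV) {x\<in>U. (\<Sum>j\<in>J. ?\<theta> \<omega> j *\<^sub>R vv j x) = s (restrict (\<Theta> \<omega>) K1)} \<partial>P)"
    unfolding expected_zeros_def
  proof (rule nn_integral_cong_AE)
    show "AE \<omega> in P. emeasure (count_space UNIV) {x\<in>U. X\<^sub>0 \<omega> x = 0 \<and> W \<omega> x = 0} =
      emeasure (count_space UNIV) {x\<in>U. (\<Sum>j\<in>J. ?\<theta> \<omega> j *\<^sub>R vv j x) = s (restrict (\<Theta> \<omega>) K1)}"
      using Wrep AE_space
    proof eventually_elim
      case (elim \<omega>)
      have "(\<Sum>j\<in>J. ?\<theta> \<omega> j *\<^sub>R vv j x) = s (restrict (\<Theta> \<omega>) K1) \<longleftrightarrow> X\<^sub>0 \<omega> x = 0 \<and> W \<omega> x = 0" for x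
        unfolding vec_eq_iff conv[OF elim(1)] s_nth X0_zero_iff[OF elim(2)] W0[OF elim(2)]
        by (auto simp: \<Theta>_def K1_def)
      then show ?case by simp
    qed
  qed
  have E1: "expected_zeros P X W U = (\<integral>\<^sup>+\<omega>. emeasure (count_space UNIV) {x\<in>U. (\<Sum>j\<in>J. ?\<theta> \<omega> j *\<^sub>R vv j x) = 0} \<partial>P)"
    unfolding expected_zeros_def
  proof (rule nn_integral_cong_AE)
    show "AE \<omega> in P. emeasure (count_space UNIV) {x\<in>U. X \<omega> x = 0 \<and> W \<omega> x = 0} =
      emeasure (count_space UNIV) {x\<in>U. (\<Sum>j\<in>J. ?\<theta> \<omega> j *\<^sub>R vv j x) = 0}"
      using Wrep AE_space
    proof eventually_elim
      case (elim \<omega>)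
      have "(\<Sum>j\<in>J. ?\<theta> \<omega> j *\<^sub>R vv j x) = 0 \<longleftrightarrow> X \<omega> x = 0 \<and> W \<omega> x = 0" for x
        unfolding vec_eq_iff conv[OF elim(1)] X_zero_iff[OF elim(2)] W0[OF elim(2)]
        by (auto split: if_splits)
      then show ?case by simp
    qed
  qed
  show ?thesis unfolding E0 E1 by (rule ratio)
qed

end

section \<open>From the ratio to the inequalities and the case of equality\<close>

text \<open>Apart from \<open>b = 0\<close>, strictness can fail only for infinite \<open>b\<close>,
  where \<open>q * b\<close> is infinite as soon as \<open>q > 0\<close>; hence the finiteness
  condition on the equality clause.\<close>

lemma strict_fraction_comparison:
  fixes a b q :: ennreal
  assumes a: "a = q * b" and q: "q < 1"
  shows "a \<le> b \<and> (b < \<infinity> \<longrightarrow> (a = b \<longleftrightarrow> b = 0)) \<and> (b = 0 \<longrightarrow> a = 0)"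
proof -
  have "a \<le> b" unfolding a using mult_right_mono[of q 1 b] q by simp
  moreover have "a \<noteq> b" if "b < \<infinity>" "b \<noteq> 0"
  proof -
    have "q * b < 1 * b" using q that by (intro ennreal_mult_strict_right_mono) (auto simp: zero_less_iff_neq_zero)
    then show ?thesis unfolding a by simp
  qed
  ultimately show ?thesis using a by auto
qed

text \<open>Since \<open>f\<^sub>0\<close> is not in \<open>F\<close>, its remainder after expansion
  in the \<open>v i\<close> is nonzero at some \<open>x\<close>. The functional that evaluates such
  remainders at \<open>x\<close> kills \<open>F\<close>, and division by \<open>g x\<close>
  normalizes it.\<close>

lemma ex_complementary_eval_functional:
  fixes f\<^sub>0 :: "'x \<Rightarrow> real"
  assumes F: "subspace F" and f0: "f\<^sub>0 \<notin> F" and l: "\<And>i. i < (N::nat) \<Longrightarrow> l i \<in> eval_functionals"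
    and v: "\<And>i. i < N \<Longrightarrow> v i \<in> F" and rep: "\<And>f. f \<in> F \<Longrightarrow> f = (\<Sum>i<N. l i f *\<^sub>R v i)"
  obtains L where "L \<in> eval_functionals" "\<And>f. f \<in> F \<Longrightarrow> L f = 0" "L f\<^sub>0 = 1"
proof -
  define g where "g = f\<^sub>0 - (\<Sum>i<N. l i f\<^sub>0 *\<^sub>R v i)"
  have "(\<Sum>i<N. l i f\<^sub>0 *\<^sub>R v i) \<in> F"
    using v by (intro subspace_sum[OF F] subspace_scale[OF F]) auto
  then have "f\<^sub>0 \<noteq> (\<Sum>i<N. l i f\<^sub>0 *\<^sub>R v i)" using f0 by metis
  then have "\<exists>x. g x \<noteq> 0" unfolding g_def by (auto simp: fun_eq_iff)
  then obtain x where x: "g x \<noteq> 0" by blast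
  define L where "L = (1 / g x) *\<^sub>R ((\<lambda>h. h x) - (\<Sum>i<N. v i x *\<^sub>R l i))"
  have Lh: "L h = (h x - (\<Sum>i<N. v i x * l i h)) / g x" for h
    unfolding L_def by (simp add: scaleR_fun_apply sum_fun_apply)
  have "L \<in> eval_functionals" unfolding L_def
    using l by (intro subspace_scale[OF subspace_eval_functionals] subspace_diff[OF subspace_eval_functionals]
      subspace_sum[OF subspace_eval_functionals] eval_functionals_base) auto
  moreover have "L f = 0" if "f \<in> F" for f
  proof -
    have "f x = (\<Sum>i<N. l i f *\<^sub>R v i) x" using rep[OF that] by simp
    also have "\<dots> = (\<Sum>i<N. v i x * l i f)" by (simp add: sum_fun_apply scaleR_fun_apply mult.commute)
    finally show ?thesis unfolding Lh by simp
  qed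
  moreover have "L f\<^sub>0 = 1"
  proof -
    have "g x = f\<^sub>0 x - (\<Sum>i<N. v i x * l i f\<^sub>0)"
      unfolding g_def by (simp add: sum_fun_apply scaleR_fun_apply mult.commute)
    then show ?thesis unfolding Lh using x by simp
  qed
  ultimately show ?thesis by (rule that)
qed

theorem proposition3p21:
  fixes A :: "('a::{t2_space,second_countable_topology} set \<times> ('a \<Rightarrow> 'e::euclidean_space)) set"
    and P :: "'w measure"
    and F :: "('a \<Rightarrow> real) set"
    and X X\<^sub>0 :: "'w \<Rightarrow> 'a \<Rightarrow> real"
    and f\<^sub>0 :: "'a \<Rightarrow> real"
    and \<xi>\<^sub>0 :: "'w \<Rightarrow> real"
    and \<Phi>\<^sub>0 :: "'a \<Rightarrow> real"
    and t :: real
    and S :: "'a set"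
  assumes manifold: "smooth_atlas A" "DIM('e) > 1"
    and prob: "prob_space P"
    and F: "finite_dim_subspace F" "F \<subseteq> smooth_funs A UNIV" "\<And>x. \<exists>f\<in>F. f x \<noteq> 0"
    and X: "centered_nondegenerate_gaussian P F X"
    and f0: "f\<^sub>0 \<in> smooth_funs A UNIV" "f\<^sub>0 \<notin> F" "\<And>x. f\<^sub>0 x \<noteq> 0"
    and xi0: "distributed P lborel \<xi>\<^sub>0 (\<lambda>y. ennreal (std_normal_density y))"
      "independent_rv P path_space X borel \<xi>\<^sub>0"
    and X0: "\<And>\<omega> x. X\<^sub>0 \<omega> x = X \<omega> x + \<xi>\<^sub>0 \<omega> * f\<^sub>0 x"
    and Phi0: "\<And>x. \<Phi>\<^sub>0 x = 1/2 * ln ((\<integral>\<omega>. (X \<omega> x)\<^sup>2 \<partial>P) / (f\<^sub>0 x)\<^sup>2)"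
    and t: "regular_value A \<Phi>\<^sub>0 t"
    and S: "S = {x. \<Phi>\<^sub>0 x = t}"
  shows "(\<forall>W U. admissible A S (DIM('e) - 2) P W \<and>
            independent_rv P path_space W path_space X \<and>
            independent_rv P path_space W path_space X\<^sub>0 \<and>
            openin (top_of_set S) U \<longrightarrow>
          expected_zeros P X\<^sub>0 W U \<le> expected_zeros P X W U \<and>
          (expected_zeros P X W U < \<infinity> \<longrightarrow>
             (expected_zeros P X\<^sub>0 W U = expected_zeros P X W U \<longleftrightarrow> expected_zeros P X W U = 0)) \<and>
          (expected_zeros P X W U = 0 \<longrightarrow> expected_zeros P X\<^sub>0 W U = 0)) \<and>
      (\<forall>U. openin (top_of_set S) U \<longrightarrow>
          expected_zeros_iid (DIM('e) - 1) P X\<^sub>0 U \<le> expected_zeros_iid (DIM('e) - 1) P X U \<and>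
          (expected_zeros_iid (DIM('e) - 1) P X U < \<infinity> \<longrightarrow>
             (expected_zeros_iid (DIM('e) - 1) P X\<^sub>0 U = expected_zeros_iid (DIM('e) - 1) P X U
                \<longleftrightarrow> expected_zeros_iid (DIM('e) - 1) P X U = 0)) \<and>
          (expected_zeros_iid (DIM('e) - 1) P X U = 0
             \<longrightarrow> expected_zeros_iid (DIM('e) - 1) P X\<^sub>0 U = 0))"
proof -
  interpret prob_space P by (rule prob)
  have "X \<in> measurable P path_space" using xi0(2) by (simp add: independent_rv_def)
  then have Xm: "(\<lambda>\<omega>. X \<omega> x) \<in> borel_measurable P" for x
    unfolding path_space_def by (rule measurable_compose) (rule measurable_component_singleton, simp)
  obtain N l v where l: "\<And>i. i < N \<Longrightarrow> l i \<in> eval_functionals" and v: "\<And>i. i < (N::nat) \<Longrightarrow> v i \<in> F"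
    and rep: "\<And>f. f \<in> F \<Longrightarrow> f = (\<Sum>i<N. l i f *\<^sub>R v i)"
    and box: "\<forall>B. (\<forall>i<N. B i \<in> sets borel) \<longrightarrow>
       (\<integral>\<omega>. (\<Prod>i<N. indicator (B i) (l i (X \<omega>))) \<partial>P) = (\<Prod>i<N. measure std_normal_distribution (B i))"
    and var: "\<And>x. (\<integral>\<omega>. (X \<omega> x)\<^sup>2 \<partial>P) = (\<Sum>i<N. (v i x)\<^sup>2)"
    by (rule ex_gaussian_coordinates[OF prob F(1) X Xm]) (rule that)
  have sF: "subspace F" using F(1) by (simp add: finite_dim_subspace_def)
  obtain L where L: "L \<in> eval_functionals" "\<And>f. f \<in> F \<Longrightarrow> L f = 0" "L f\<^sub>0 = 1"
    by (rule ex_complementary_eval_functional[OF sF f0(2) l v rep]) (assumption | rule that)+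
  have XF: "X \<omega> \<in> F" if "\<omega> \<in> space P" for \<omega>
    using X that by (simp add: centered_nondegenerate_gaussian_def)
  interpret gaussian_level A P F X X\<^sub>0 f\<^sub>0 \<xi>\<^sub>0 \<Phi>\<^sub>0 t S N l v L
    by unfold_locales (use manifold F f0 xi0 X0 Phi0 t S l v rep box var L XF in \<open>assumption | blast\<close>)+
  show ?thesis
  proof (intro conjI allI impI)
    fix W :: "'w \<Rightarrow> 'a \<Rightarrow> nat \<Rightarrow> real" and U
    assume "admissible A S (DIM('e) - 2) P W \<and> independent_rv P path_space W path_space X \<and>
      independent_rv P path_space W path_space X\<^sub>0 \<and> openin (top_of_set S) U"
    then obtain q where q: "q < 1" "expected_zeros P X\<^sub>0 W U = q * expected_zeros P X W U"
      using field_ratio[of U W] by blast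
    note c = strict_fraction_comparison[OF q(2,1)]
    from c show "expected_zeros P X\<^sub>0 W U \<le> expected_zeros P X W U" by simp
    from c show "(expected_zeros P X\<^sub>0 W U = expected_zeros P X W U) = (expected_zeros P X W U = 0)"
      if "expected_zeros P X W U < \<infinity>" using that by simp
    from c show "expected_zeros P X\<^sub>0 W U = 0" if "expected_zeros P X W U = 0" using that by simp
  next
    fix U assume "openin (top_of_set S) U"
    then obtain q where q: "q < 1" "expected_zeros_iid (DIM('e) - 1) P X\<^sub>0 U = q * expected_zeros_iid (DIM('e) - 1) P X U"
      using iid_ratio[of U] by blast
    note c = strict_fraction_comparison[OF q(2,1)]
    from c show "expected_zeros_iid (DIM('e) - 1) P X\<^sub>0 U \<le> expected_zeros_iid (DIM('e) - 1) P X U" by simp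
    from c show "(expected_zeros_iid (DIM('e) - 1) P X\<^sub>0 U = expected_zeros_iid (DIM('e) - 1) P X U) =
        (expected_zeros_iid (DIM('e) - 1) P X U = 0)"
      if "expected_zeros_iid (DIM('e) - 1) P X U < \<infinity>" using that by simp
    from c show "expected_zeros_iid (DIM('e) - 1) P X\<^sub>0 U = 0" if "expected_zeros_iid (DIM('e) - 1) P X U = 0" using that by simp
  qed
qed

end
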